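(* Let $d=2$, let $E\subset[1,2]$ be nonempty, $\beta=\dim_{\mathrm M}E$ its upper Minkowski dimension and $\gamma=\dim_{\mathrm{qA}}E$ its quasi-Assouad dimension. Let $\Delta_\beta$ be the closed triangle with vertices $P_1=(0,0)$, $P_{2,\beta}=(\frac1{1+\beta},\frac1{1+\beta})$, $P^{\mathrm{rad}}_{3,\beta}=(\frac2{3+\beta},\frac1{3+\beta})$. For $2\gamma-\beta>1$ let $\mathcal Q^{\mathrm{rad}}_{\beta,\gamma}$ be the closed quadrangle with vertices $P_1$, $P_{2,\beta}$, $$P^{\mathrm{rad}}_{4,\gamma}=\Big(\tfrac1{1+\gamma},\tfrac1{2(1+\gamma)}\Big),\qquad P^{\mathrm{rad}}_{5,\beta,\gamma}=\Big(\tfrac{(1-\beta)(2-\beta/\gamma)+2(1-\beta/\gamma)}{2((1-\beta)+2(1-\beta/\gamma))},\ \tfrac{1-\beta/\gamma}{1-\beta+2(1-\beta/\gamma)}\Big).$$ (i) If $2\gamma-\beta\le1$, then $\overline{\mathcal T_E^{\mathrm{rad}}}=\Delta_\beta$. (ii) If $2\gamma-\beta>1$, then $\mathcal Q^{\mathrm{rad}}_{\beta,\gamma}\subset\overline{\mathcal T_E^{\mathrm{rad}}}\subset\Delta_\beta$. Moreover, the left inclusion is sharp in the sense that there exist sets $E\subset[1,2]$ (with $2\gamma-\beta>1$, where $\beta=\dim_{\mathrm M}E$, $\gamma=\dim_{\mathrm{qA}}E$) for which $\overline{\mathcal T_E^{\mathrm{rad}}}=\mathcal Q^{\mathrm{r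ad}}_{\beta,\gamma}$.
   Context: For $f\in L^1_{\mathrm{loc}}(\mathbb R^d)$ and $t>0$, $A_tf(x)$ is the average of $f$ over the sphere of radius $t$ centered at $x$ (with respect to normalized surface measure). For $E\subset[1,2]$, $M_Ef(x)=\sup_{t\in E}|A_tf(x)|$. $L^p_{\mathrm{rad}}\subset L^p(\mathbb R^d)$ is the space of radial $L^p$ functions. "$M_E:L^p_{\mathrm{rad}}\to L^q$" means there is $C<\infty$ with $\|M_Ef\|_{L^q(\mathbb R^d)}\le C\|f\|_{L^p(\mathbb R^d)}$ for all $f\in L^p_{\mathrm{rad}}$. The radial type set is $\mathcal T_E^{\mathrm{rad}}=\{(\frac1p,\frac1q)\in[0,1]^2: M_E:L^p_{\mathrm{rad}}\to L^q\}$, and the bar denotes closure. For a set $F\subset[1,2]$ and $\delta\in(0,1)$, $N(F,\delta)$ is the minimum number of intervals of length $\delta$ required to cover $F$, and $\dim_{\mathrm M}E=\limsup_{\delta\to0}\frac{\log N(E,\delta)}{\log(1/\delta)}$. For $\theta\in[0,1)$, the upper Assouad spectrum $\overline{\dim_{\mathrm A,\theta}}E$ is the infimum of all $a>0$ for which there is $c\in(0,\infty)$ such that $N(E\cap J,\delta)\le c(|J|/\delta)^a$ for all $\delta\in(0,1)$ and all intervals $J\subset[1,2]$ of length $|J|\ge\delta^\theta$. The quasi-Assouad dimension is $\dim_{\mathrm{qA}}E=\lim_{\theta\to1-}\overline{\dim_{\mathrm A,\theta}}E$. *)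

theory Defs
  imports "HOL-Analysis.Analysis"
begin

section \<open>Norms and radial functions on the plane\<close>

definition ennreal_powr :: "ennreal \<Rightarrow> real \<Rightarrow> ennreal" where
  "ennreal_powr x a = (if x = \<infinity> then \<infinity> else ennreal (enn2real x powr a))"

text \<open>
  The norm is applied to maximal functions that are suprema over uncountable index sets, so it is
  written such that it makes sense for arbitrary functions. The essential supremum is the
  unguarded right-hand side of the definition of \<open>esssup\<close>, which would assign the value
  \<open>\<infinity>\<close> to every nonmeasurable function.
\<close>
definition Lp_norm :: "ennreal \<Rightarrow> (real^2 \<Rightarrow> ennreal) \<Rightarrow> ennreal" where
  "Lp_norm p g =
     (if p = \<infinity> then Limsup (ae_filter lebesgue) g
      else ennreal_powr (\<integral>\<^sup>+x. ennreal_powr (g x) (enn2real p) \<partial>lebesgue) (1 / enn2real p))"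

definition radial :: "(real^2 \<Rightarrow> complex) \<Rightarrow> bool" where
  "radial f \<longleftrightarrow> (\<forall>x y. norm x = norm y \<longrightarrow> f x = f y)"

text \<open>
  Every rotation-invariant class in \<open>L\<^sup>p\<close> has an exactly radial representative, and two
  such representatives that agree almost everywhere have the same averages over every circle
  not centred at the origin. So the choice of representative does not matter below.
\<close>
definition Lp_rad :: "ennreal \<Rightarrow> (real^2 \<Rightarrow> complex) set" where
  "Lp_rad p = {f. f \<in> borel_measurable lebesgue \<and> radial f \<and>
                  Lp_norm p (\<lambda>x. ennreal (norm (f x))) < \<infinity>}"

section \<open>Circular averages and maximal functions\<close>

definition circle_pt :: "real^2 \<Rightarrow> real \<Rightarrow> real \<Rightarrow> real^2" where
  "circle_pt x t \<phi> = x + t *\<^sub>R vector [cos \<phi>, sin \<phi>]"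

definition circ_integrable :: "(real^2 \<Rightarrow> complex) \<Rightarrow> real \<Rightarrow> real^2 \<Rightarrow> bool" where
  "circ_integrable f t x \<longleftrightarrow>
     integrable (lebesgue_on {0..2*pi}) (\<lambda>\<phi>. f (circle_pt x t \<phi>))"

text \<open>The normalized surface measure of the circle is \<open>d\<phi> / (2 \<pi>)\<close> in the angle \<open>\<phi>\<close>.\<close>
definition circ_avg :: "(real^2 \<Rightarrow> complex) \<Rightarrow> real \<Rightarrow> real^2 \<Rightarrow> complex" where
  "circ_avg f t x =
     (1 / (2*pi)) *\<^sub>R integral\<^sup>L (lebesgue_on {0..2*pi}) (\<lambda>\<phi>. f (circle_pt x t \<phi>))"

text \<open>
  Where the average does not converge absolutely, \<open>|A\<^sub>t f(x)|\<close> is \<open>\<infinity>\<close>, which is its true value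
  for \<open>f \<ge> 0\<close>; the Bochner integral alone would return \<open>0\<close> there. With this
  convention the maximal function of \<open>f\<close> is dominated by that of \<open>|f|\<close>.
\<close>
definition abs_circ_avg :: "(real^2 \<Rightarrow> complex) \<Rightarrow> real \<Rightarrow> real^2 \<Rightarrow> ennreal" where
  "abs_circ_avg f t x =
     (if circ_integrable f t x then ennreal (norm (circ_avg f t x)) else \<infinity>)"

definition max_fun :: "real set \<Rightarrow> (real^2 \<Rightarrow> complex) \<Rightarrow> real^2 \<Rightarrow> ennreal" where
  "max_fun E f x = (SUP t\<in>E. abs_circ_avg f t x)"

definition max_bounded :: "real set \<Rightarrow> ennreal \<Rightarrow> ennreal \<Rightarrow> bool" where
  "max_bounded E p q \<longleftrightarrow>
     (\<exists>C::real. \<forall>f\<in>Lp_rad p.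
        Lp_norm q (max_fun E f) \<le> ennreal C * Lp_norm p (\<lambda>x. ennreal (norm (f x))))"

definition radial_type_set :: "real set \<Rightarrow> (real \<times> real) set" where
  "radial_type_set E =
     {(enn2real (1/p), enn2real (1/q)) |p q. 1 \<le> p \<and> 1 \<le> q \<and> max_bounded E p q}"

section \<open>Dimensions of subsets of \<open>[1,2]\<close>\<close>

definition cover_num :: "real set \<Rightarrow> real \<Rightarrow> nat" where
  "cover_num F \<delta> =
     (LEAST n. \<exists>\<I>. finite \<I> \<and> card \<I> = n \<and> (\<forall>I\<in>\<I>. \<exists>a. I = {a..a+\<delta>}) \<and> F \<subseteq> \<Union>\<I>)"

definition minkowski_dim :: "real set \<Rightarrow> real" where
  "minkowski_dim E =
     real_of_ereal (Limsup (at_right 0) (\<lambda>\<delta>. ereal (ln (real (cover_num E \<delta>)) / ln (1/\<delta>))))"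

text \<open>Since \<open>N(\<cdot>,\<delta>)\<close> is monotone, it suffices to test closed intervals \<open>J = [u,v]\<close>.\<close>
definition upper_assouad_spectrum :: "real \<Rightarrow> real set \<Rightarrow> real" where
  "upper_assouad_spectrum \<theta> E =
     Inf {a. a > 0 \<and> (\<exists>c>0. \<forall>\<delta>\<in>{0<..<1}. \<forall>u v.
            1 \<le> u \<and> u \<le> v \<and> v \<le> 2 \<and> v - u \<ge> \<delta> powr \<theta> \<longrightarrow>
            real (cover_num (E \<inter> {u..v}) \<delta>) \<le> c * ((v - u) / \<delta>) powr a)}"

definition quasi_assouad_dim :: "real set \<Rightarrow> real" where
  "quasi_assouad_dim E = Lim (at_left 1) (\<lambda>\<theta>. upper_assouad_spectrum \<theta> E)"

section \<open>The triangle and the quadrangle\<close>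

definition P1 :: "real \<times> real" where
  "P1 = (0, 0)"

definition P2 :: "real \<Rightarrow> real \<times> real" where
  "P2 \<beta> = (1 / (1 + \<beta>), 1 / (1 + \<beta>))"

definition P3_rad :: "real \<Rightarrow> real \<times> real" where
  "P3_rad \<beta> = (2 / (3 + \<beta>), 1 / (3 + \<beta>))"

definition P4_rad :: "real \<Rightarrow> real \<times> real" where
  "P4_rad \<gamma> = (1 / (1 + \<gamma>), 1 / (2 * (1 + \<gamma>)))"

definition P5_rad :: "real \<Rightarrow> real \<Rightarrow> real \<times> real" where
  "P5_rad \<beta> \<gamma> =
     (((1 - \<beta>) * (2 - \<beta>/\<gamma>) + 2 * (1 - \<beta>/\<gamma>)) / (2 * ((1 - \<beta>) + 2 * (1 - \<beta>/\<gamma>))),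
      (1 - \<beta>/\<gamma>) / (1 - \<beta> + 2 * (1 - \<beta>/\<gamma>)))"

definition triangle_rad :: "real \<Rightarrow> (real \<times> real) set" where
  "triangle_rad \<beta> = convex hull {P1, P2 \<beta>, P3_rad \<beta>}"

text \<open>
  For \<open>0 \<le> \<beta> \<le> \<gamma> \<le> 1\<close> and \<open>2\<gamma> - \<beta> > 1\<close>, \<open>P4_rad \<gamma>\<close> lies on the side from \<open>P1\<close> to
  \<open>P3_rad \<beta>\<close> and \<open>P5_rad \<beta> \<gamma>\<close> on the side from \<open>P2 \<beta>\<close> to \<open>P3_rad \<beta>\<close> of the triangle. Hence
  the quadrangle is convex and is the hull of its vertices.
\<close>
definition quadrangle_rad :: "real \<Rightarrow> real \<Rightarrow> (real \<times> real) set" where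
  "quadrangle_rad \<beta> \<gamma> = convex hull {P1, P2 \<beta>, P4_rad \<gamma>, P5_rad \<beta> \<gamma>}"

end

theory Submission
  imports Defs
begin

text \<open>
  In the variable \<open>u = |y|\<^sup>2\<close> Lebesgue measure on the plane becomes \<open>\<pi> du\<close>, and the average of a radial
  function over the circle of radius \<open>t\<close> about \<open>x\<close>, \<open>|x| = r\<close>, becomes an arcsine kernel on the interval from
  \<open>(r - t)\<^sup>2\<close> to \<open>(r + t)\<^sup>2\<close>. A dyadic decomposition at the two endpoints dominates \<open>A\<^sub>t f(x)\<close> by a sum over \<open>j\<close> of
  integrals of \<open>|f|\<close> over annuli around \<open>|y| = |r \<plusminus> t|\<close>, of width \<open>4 r t / 2\<^sup>j\<close> in \<open>|y|\<^sup>2\<close>. For \<open>q > p\<close>, Hoelder's inequality and Tonelli's theorem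
  reduce the \<open>L\<^sup>p \<rightarrow> L\<^sup>q\<close> bound to the area, for fixed \<open>y\<close>, of the set of \<open>x\<close> for which \<open>y\<close> is in such an annulus for
  some \<open>t \<in> E\<close>, hence to covering numbers: of \<open>E\<close> at scale \<open>2\<^sup>-\<^sup>j\<close> for large \<open>r\<close>, of \<open>E\<close> at scale \<open>2\<^sup>-\<^sup>j\<^sup>/\<^sup>2\<close>
  for \<open>r\<close> of order one, and of \<open>E \<inter> J\<close> with \<open>|J|\<close> of order \<open>r\<close> at scale \<open>r / 2\<^sup>j\<close> for small \<open>r\<close>. Only the
  last one sees \<open>\<gamma>\<close>. Bounding it by the geometric mean, with weights \<open>\<theta>\<close> and \<open>1 - \<theta>\<close>, of the Minkowski and the
  Assouad bounds gives conditions that are linear in \<open>a = 1/p\<close>, \<open>b = 1/q\<close> and \<open>\<mu> = b \<theta>\<close>, and all vertices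
  of the triangle, respectively the quadrangle, satisfy them.

  Conversely, the indicator functions of large discs, of thin annuli and of small discs give the three
  sides of the triangle. For \<open>E = {1 + 1/n}\<close> the annulus of width \<open>\<rho>\<^sup>2\<close> around the unit circle, tested
  on \<open>|x| \<sim> \<rho>\<close>, gives the side of the quadrangle through \<open>P4_rad\<close> and \<open>P5_rad\<close>.
\<close>

section \<open>Radial functions and circular averages\<close>

text \<open>Only closures are compared, so every sufficient condition may be strict; each dimension
  bound, and the sum over j, costs a small power of the scale that the slack pays for. This permits
  a crude Hoelder inequality and a crude summation lemma in place of the sharp ones. The threshold
  2\<gamma> - \<beta> = 1 comes from the vertex \<open>P3_rad\<close>: there a = 2b, so convergence
  over small radii (\<beta> \<mu> \<le> 2b - a) leaves no room for the Minkowski bound when \<beta>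
  > 0, and with \<mu> = 0 summability in j asks for (1 + \<gamma>) b \<le> 1/2 with b = 1/(3 +
  \<beta>), that is 2\<gamma> - \<beta> \<le> 1. A second obstacle is measurability: a circle is a
  null set of the plane, \<open>f\<close> is only Lebesgue measurable, and the supremum runs over an
  arbitrary \<open>E\<close>. Radial symmetry settles the former, through null sets of values of
  |y|^2; the latter is avoided by merging the open annuli for all t into one open set before
  integrating.\<close>

lemma emeasure_cball_plane: "0 \<le> r \<Longrightarrow> emeasure lborel (cball (x::real^2) r) = ennreal (pi * r\<^sup>2)"
  by (simp add: emeasure_cball unit_ball_vol_2)

text \<open>The disc |y|^2 \<le> a has area pi a, linear in a; hence the squared norm, unlike the
  norm, yields a constant density. Half-lines determine both measures.\<close>

lemma distr_norm_power2:
  "distr lborel borel (\<lambda>y::real^2. (norm y)\<^sup>2) = density lborel (\<lambda>u. ennreal pi * indicator {0..} u)"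
  (is "?M = ?N")
proof (rule measure_eqI_generator_eq[where E = "range (\<lambda>a::real. {..a})" and \<Omega> = UNIV and A = "\<lambda>i. {..real i}"])
  show "Int_stable (range (\<lambda>a::real. {..a}))"
    by (auto simp: Int_stable_def)
  have M: "emeasure ?M {..a} = ennreal (pi * max 0 a)" for a :: real
  proof -
    have "emeasure ?M {..a} = emeasure lborel {y::real^2. (norm y)\<^sup>2 \<le> a}"
      by (subst emeasure_distr) (auto simp: vimage_def)
    also have "{y::real^2. (norm y)\<^sup>2 \<le> a} = (if a < 0 then {} else cball 0 (sqrt a))"
    proof (cases "a < 0")
      case True
      have "\<not> (norm y)\<^sup>2 \<le> a" for y :: "real^2" using True zero_le_power2[of "norm y"] by linarith
      then show ?thesis using True by simp
    next
      case False
      have "(norm y)\<^sup>2 \<le> a \<longleftrightarrow> norm y \<le> sqrt a" for y :: "real^2"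
        using False by (metis norm_ge_zero not_less real_le_lsqrt real_sqrt_le_iff real_sqrt_unique)
      then show ?thesis using False by (simp only: cball_def dist_0_norm if_False)
    qed
    also have "emeasure lborel \<dots> = ennreal (pi * max 0 a)"
      by (auto simp: emeasure_cball_plane max_def)
    finally show ?thesis .
  qed
  have N: "emeasure ?N {..a} = ennreal (pi * max 0 a)" for a :: real
  proof -
    have "emeasure ?N {..a} = (\<integral>\<^sup>+u. ennreal pi * indicator {0..a} u \<partial>lborel)"
      by (subst emeasure_density) (auto intro!: nn_integral_cong simp: indicator_def)
    also have "\<dots> = ennreal pi * emeasure lborel {0..a}"
      by (subst nn_integral_cmult_indicator) auto
    also have "\<dots> = ennreal (pi * max 0 a)"
      by (cases "a \<ge> 0") (auto simp: ennreal_mult max_def)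
    finally show ?thesis .
  qed
  show "emeasure ?M X = emeasure ?N X" if "X \<in> range (\<lambda>a::real. {..a})" for X
    using that M N by auto
  show "emeasure ?M {..real i} \<noteq> \<infinity>" for i
    unfolding M by simp
  show "(\<Union>i. {..real i}) = UNIV"
    by (auto simp: real_arch_simple)
  have "sets borel = sigma_sets UNIV (range (\<lambda>a::real. {..a}))"
    by (subst borel_eq_atMost) (rule sets_measure_of, simp)
  then show "sets ?M = sigma_sets UNIV (range (\<lambda>a::real. {..a}))"
    "sets ?N = sigma_sets UNIV (range (\<lambda>a::real. {..a}))"
    by (simp_all only: sets_distr sets_density sets_lborel)
qed auto

lemma nn_integral_norm_power2:
  assumes [measurable]: "h \<in> borel_measurable borel"
  shows "(\<integral>\<^sup>+y. h ((norm (y::real^2))\<^sup>2) \<partial>lborel) = ennreal pi * (\<integral>\<^sup>+u. h u * indicator {0..} u \<partial>lborel)"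
proof -
  have "(\<integral>\<^sup>+y. h ((norm (y::real^2))\<^sup>2) \<partial>lborel) = (\<integral>\<^sup>+u. h u \<partial>distr lborel borel (\<lambda>y::real^2. (norm y)\<^sup>2))"
    by (subst nn_integral_distr) auto
  also have "\<dots> = (\<integral>\<^sup>+u. ennreal pi * (h u * indicator {0..} u) \<partial>lborel)"
    unfolding distr_norm_power2 by (subst nn_integral_density) (auto intro!: nn_integral_cong simp: ac_simps)
  also have "\<dots> = ennreal pi * (\<integral>\<^sup>+u. h u * indicator {0..} u \<partial>lborel)"
    by (subst nn_integral_cmult) auto
  finally show ?thesis .
qed

lemma emeasure_norm_power2_vimage:
  assumes [measurable]: "A \<in> sets borel"
  shows "emeasure lborel {y::real^2. (norm y)\<^sup>2 \<in> A} = ennreal pi * emeasure lborel (A \<inter> {0..})"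
proof -
  have "emeasure lborel {y::real^2. (norm y)\<^sup>2 \<in> A} = (\<integral>\<^sup>+y. indicator A ((norm (y::real^2))\<^sup>2) \<partial>lborel)"
  proof -
    have "{y::real^2. (norm y)\<^sup>2 \<in> A} \<in> sets lborel" by measurable
    from nn_integral_indicator[OF this, symmetric] show ?thesis
      by (simp add: indicator_def)
  qed
  also have "\<dots> = ennreal pi * (\<integral>\<^sup>+u. indicator (A \<inter> {0..}) u \<partial>lborel)"
    unfolding indicator_inter_arith by (rule nn_integral_norm_power2) simp
  finally show ?thesis by simp
qed

text \<open>A Lebesgue set is almost \<open>\<sigma>\<close>-compact, and the image of a \<open>\<sigma>\<close>-compact set is \<open>\<sigma>\<close>-compact;
  applied to the radial set and to its complement this squeezes \<open>A\<close> between two Borel sets.\<close>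
lemma lebesgue_norm_power2_vimageD:
  fixes A :: "real set"
  assumes A: "A \<subseteq> {0..}" and S: "{y::real^2. (norm y)\<^sup>2 \<in> A} \<in> sets lebesgue"
  shows "A \<in> sets lebesgue"
proof -
  have inner: "\<exists>B. B \<in> sets borel \<and> B \<subseteq> A \<and>
      {y::real^2. (norm y)\<^sup>2 \<in> A - B} \<in> null_sets lebesgue"
    if S: "{y::real^2. (norm y)\<^sup>2 \<in> A} \<in> sets lebesgue" for A
  proof -
    from lebesgue_set_almost_fsigma[OF S] obtain C T where
      C: "fsigma C" "T \<in> null_sets lebesgue" "C \<union> T = {y::real^2. (norm y)\<^sup>2 \<in> A}" by metis
    from C(1) obtain K :: "nat \<Rightarrow> (real^2) set" where
      K: "range K \<subseteq> Collect compact" "C = \<Union>(K ` UNIV)"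
      unfolding fsigma_Union_compact by blast
    define B where "B = (\<Union>n. (\<lambda>y. (norm y)\<^sup>2) ` K n)"
    have "compact ((\<lambda>y. (norm y)\<^sup>2) ` K n)" for n
      using K by (intro compact_continuous_image continuous_intros) auto
    then have "B \<in> sets borel"
      unfolding B_def by (intro sets.countable_UN) (auto intro: borel_compact)
    moreover have "B \<subseteq> A"
      using C(3) K(2) by (auto simp: B_def)
    moreover have "{y::real^2. (norm y)\<^sup>2 \<in> A - B} \<in> null_sets lebesgue"
    proof (rule null_sets_completion_subset[OF _ C(2)])
      show "{y::real^2. (norm y)\<^sup>2 \<in> A - B} \<subseteq> T"
        using C(3) K(2) by (auto simp: B_def)
    qed
    ultimately show ?thesis by blast
  qed
  obtain B where B: "B \<in> sets borel" "B \<subseteq> A" "{y::real^2. (norm y)\<^sup>2 \<in> A - B} \<in> null_sets lebesgue"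
    using inner[OF S] by blast
  have "{y::real^2. (norm y)\<^sup>2 \<in> - A} = UNIV - {y::real^2. (norm y)\<^sup>2 \<in> A}"
    by auto
  then have "{y::real^2. (norm y)\<^sup>2 \<in> - A} \<in> sets lebesgue"
    using sets.compl_sets[OF S] by simp
  then obtain D where D: "D \<in> sets borel" "D \<subseteq> - A" "{y::real^2. (norm y)\<^sup>2 \<in> - A - D} \<in> null_sets lebesgue"
    using inner by blast
  \<comment> \<open>\<open>Q\<close> is the gap left by the inner approximations \<open>B\<close> of
    \<open>A\<close> and \<open>D\<close> of its complement. It is Borel with a null preimage, so
    the exact area formula makes \<open>Q\<close> null, and it contains
    \<open>A - B\<close>.\<close>
  define Q where "Q = {0..} - D - B"
  have [measurable]: "Q \<in> sets borel"
    using B D by (auto simp: Q_def)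
  have "{y::real^2. (norm y)\<^sup>2 \<in> Q} \<in> null_sets lebesgue"
    by (rule null_sets_completion_subset[OF _ null_sets.Un[OF B(3) D(3)]]) (auto simp: Q_def)
  then have "emeasure lborel {y::real^2. (norm y)\<^sup>2 \<in> Q} = 0"
    by (auto simp: null_sets_def)
  then have "ennreal pi * emeasure lborel (Q \<inter> {0..}) = 0"
    by (simp add: emeasure_norm_power2_vimage)
  moreover have "Q \<inter> {0..} = Q"
    by (auto simp: Q_def)
  ultimately have "Q \<in> null_sets lborel"
    by (intro null_setsI) auto
  then have "A - B \<in> null_sets lebesgue"
    by (intro null_sets_completion_subset[of "A - B" Q] null_sets_completionI) (use A D in \<open>auto simp: Q_def\<close>)
  moreover have "A = B \<union> (A - B)"
    using B by auto
  ultimately show ?thesis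
    using B by (metis null_setsD2 sets.Un sets_completionI_sets sets_lborel)
qed

text \<open>Equality almost everywhere in the plane says nothing about a single circle. The
  exceptional set is therefore sought as a null set \<open>Z\<close> of values of |y|^2:
  \<open>f\<close> restricted to a ray is Lebesgue measurable by the preceding lemma, and so has a
  Borel version off \<open>Z\<close>.\<close>

lemma radial_borel_representative:
  assumes f: "f \<in> borel_measurable lebesgue" "radial f"
  obtains G :: "real \<Rightarrow> complex" and Z where
    "G \<in> borel_measurable borel" "Z \<in> null_sets lborel" "\<And>y. (norm y)\<^sup>2 \<notin> Z \<Longrightarrow> f y = G ((norm y)\<^sup>2)"
proof -
  define F where "F u = (if u < 0 then 0 else f (sqrt u *\<^sub>R axis 1 1))" for u :: real
  have F: "f y = F ((norm y)\<^sup>2)" for y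
  proof -
    have "norm (sqrt ((norm y)\<^sup>2) *\<^sub>R axis 1 1 :: real^2) = norm y"
      by (simp add: norm_axis_1)
    then have "f y = f (sqrt ((norm y)\<^sup>2) *\<^sub>R axis 1 1)"
      using f(2) unfolding radial_def by metis
    moreover have "\<not> (norm y)\<^sup>2 < 0"
      by simp
    ultimately show ?thesis
      unfolding F_def by presburger
  qed
  have "F \<in> borel_measurable lebesgue"
  proof (rule measurableI)
    fix B :: "complex set" assume B: "B \<in> sets borel"
    have "{y. (norm y)\<^sup>2 \<in> F -` B \<inter> {0..}} = f -` B \<inter> space lebesgue"
      by (auto simp: F)
    also have "\<dots> \<in> sets lebesgue"
      using f(1) B by (rule measurable_sets)
    finally have "F -` B \<inter> {0..} \<in> sets lebesgue"
      by (intro lebesgue_norm_power2_vimageD) auto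
    moreover have "F -` B \<inter> {..<0} = (if 0 \<in> B then {..<0} else {})"
      by (auto simp: F_def)
    ultimately have "(F -` B \<inter> {0..}) \<union> (F -` B \<inter> {..<0}) \<in> sets lebesgue"
      by (intro sets.Un) auto
    also have "(F -` B \<inter> {0..}) \<union> (F -` B \<inter> {..<0}) = F -` B \<inter> space lebesgue"
      by auto
    finally show "F -` B \<inter> space lebesgue \<in> sets lebesgue" .
  qed auto
  then have "(\<lambda>u. Re (F u)) \<in> borel_measurable lebesgue" "(\<lambda>u. Im (F u)) \<in> borel_measurable lebesgue"
    by (auto simp: borel_measurable_complex_iff)
  then obtain R I where RI: "R \<in> borel_measurable lborel" "AE u in lborel. Re (F u) = R u"
    "I \<in> borel_measurable lborel" "AE u in lborel. Im (F u) = I u"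
    using completion_ex_borel_measurable_real[of "\<lambda>u. Re (F u)" lborel]
      completion_ex_borel_measurable_real[of "\<lambda>u. Im (F u)" lborel] by blast
  define G where "G u = Complex (R u) (I u)" for u
  have "AE u in lborel. F u = G u"
    using RI(2,4) by eventually_elim (simp add: G_def complex_eq_iff)
  then obtain Z where Z: "Z \<in> null_sets lborel" "{u. F u \<noteq> G u} \<subseteq> Z"
    unfolding eventually_ae_filter space_lborel by auto
  have "(\<lambda>u. G u) \<in> borel_measurable borel"
    using RI by (subst borel_measurable_complex_iff) (auto simp: G_def)
  moreover have "f y = G ((norm y)\<^sup>2)" if "(norm y)\<^sup>2 \<notin> Z" for y
    using that Z(2) F[of y] by auto
  ultimately show ?thesis using Z(1) that by blast
qed

section \<open>Circle averages as arcsine averages\<close>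

lemma nn_integral_periodic_shift:
  fixes h :: "real \<Rightarrow> ennreal"
  assumes [measurable]: "h \<in> borel_measurable borel"
    and per: "\<And>\<phi>. h (\<phi> + 2*pi) = h \<phi>" and a: "0 \<le> a" "a \<le> 2*pi"
  shows "(\<integral>\<^sup>+\<phi>. h (\<phi> - a) * indicator {0..2*pi} \<phi> \<partial>lborel) = (\<integral>\<^sup>+\<phi>. h \<phi> * indicator {0..2*pi} \<phi> \<partial>lborel)"
proof -
  have shift: "(\<integral>\<^sup>+x. f x \<partial>lborel) = (\<integral>\<^sup>+x. f (c + x) \<partial>lborel)" if [measurable]: "f \<in> borel_measurable borel"
    for f :: "real \<Rightarrow> ennreal" and c
    using nn_integral_real_affine[OF that, of 1 c] by simp
  have "(\<integral>\<^sup>+\<phi>. h (\<phi> - a) * indicator {0..2*pi} \<phi> \<partial>lborel)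
      = (\<integral>\<^sup>+\<phi>. h \<phi> * indicator {-a..2*pi-a} \<phi> \<partial>lborel)"
    by (subst shift[where c = a]) (auto intro!: nn_integral_cong simp: indicator_def)
  also have "\<dots> = (\<integral>\<^sup>+\<phi>. h \<phi> * indicator {-a..<0} \<phi> + h \<phi> * indicator {0..2*pi-a} \<phi> \<partial>lborel)"
    using a by (intro nn_integral_cong) (auto simp: indicator_def)
  also have "\<dots> = (\<integral>\<^sup>+\<phi>. h \<phi> * indicator {-a..<0} \<phi> \<partial>lborel) + (\<integral>\<^sup>+\<phi>. h \<phi> * indicator {0..2*pi-a} \<phi> \<partial>lborel)"
    by (subst nn_integral_add) auto
  also have "(\<integral>\<^sup>+\<phi>. h \<phi> * indicator {-a..<0} \<phi> \<partial>lborel) = (\<integral>\<^sup>+\<phi>. h \<phi> * indicator {2*pi-a..<2*pi} \<phi> \<partial>lborel)"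
    by (subst (2) shift[where c = "2*pi"]) (auto intro!: nn_integral_cong simp: indicator_def per add.commute[of "2*pi"])
  also have "(\<integral>\<^sup>+\<phi>. h \<phi> * indicator {2*pi-a..<2*pi} \<phi> \<partial>lborel) + (\<integral>\<^sup>+\<phi>. h \<phi> * indicator {0..2*pi-a} \<phi> \<partial>lborel)
     = (\<integral>\<^sup>+\<phi>. h \<phi> * indicator {2*pi-a..<2*pi} \<phi> + h \<phi> * indicator {0..2*pi-a} \<phi> \<partial>lborel)"
    by (subst nn_integral_add) auto
  also have "\<dots> = (\<integral>\<^sup>+\<phi>. h \<phi> * indicator {0..2*pi} \<phi> \<partial>lborel)"
  proof (rule nn_integral_cong_AE)
    \<comment> \<open>The two windows count 2 pi - a twice and miss 2 pi.\<close>
    have "AE \<phi> in lborel. \<phi> \<noteq> 2*pi-a \<and> \<phi> \<noteq> 2*pi"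
      using AE_lborel_singleton by auto
    then show "AE \<phi> in lborel. h \<phi> * indicator {2*pi-a..<2*pi} \<phi> + h \<phi> * indicator {0..2*pi-a} \<phi> = h \<phi> * indicator {0..2*pi} \<phi>"
      by eventually_elim (use a in \<open>auto simp: indicator_def\<close>)
  qed
  finally show ?thesis .
qed

lemma norm_power2_vector2: "(norm (x::real^2))\<^sup>2 = (x$1)\<^sup>2 + (x$2)\<^sup>2"
  unfolding power2_norm_eq_inner by (simp add: inner_vec_def sum_2 power2_eq_square)

text \<open>The law of cosines, with \<open>a\<close> the polar angle of \<open>x\<close>. One
  \<open>a\<close> serves all \<open>t\<close> and all angles, so a single rotation removes it from
  the integral.\<close>

lemma norm_circle_pt:
  obtains a where "0 \<le> a" "a \<le> 2*pi"
    "\<And>t \<phi>. (norm (circle_pt x t \<phi>))\<^sup>2 = (norm x)\<^sup>2 + t\<^sup>2 + 2 * norm x * t * cos (\<phi> - a)"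
proof -
  obtain a where a: "0 \<le> a" "a \<le> 2*pi" "x$1 = norm x * cos a" "x$2 = norm x * sin a"
  proof (cases "norm x = 0")
    case False
    have "(x$1 / norm x)\<^sup>2 + (x$2 / norm x)\<^sup>2 = (norm x)\<^sup>2 / (norm x)\<^sup>2"
      unfolding norm_power2_vector2 power_divide add_divide_distrib ..
    also have "\<dots> = 1"
      using False by simp
    finally have "(x$1 / norm x)\<^sup>2 + (x$2 / norm x)\<^sup>2 = 1" .
    from sincos_total_2pi[OF this] obtain a where "0 \<le> a" "a < 2*pi" "x$1 / norm x = cos a" "x$2 / norm x = sin a"
      by metis
    with False show ?thesis by (intro that[of a]) (auto simp: field_simps)
  qed (auto intro: that[of 0])
  have "(norm (circle_pt x t \<phi>))\<^sup>2 = (norm x)\<^sup>2 + t\<^sup>2 + 2 * norm x * t * cos (\<phi> - a)" for t \<phi>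
  proof -
    have "(norm (circle_pt x t \<phi>))\<^sup>2 = (norm x)\<^sup>2 + t\<^sup>2 * ((cos \<phi>)\<^sup>2 + (sin \<phi>)\<^sup>2) + 2 * t * (x$1 * cos \<phi> + x$2 * sin \<phi>)"
    proof -
      have "circle_pt x t \<phi> $ 1 = x$1 + t * cos \<phi>" "circle_pt x t \<phi> $ 2 = x$2 + t * sin \<phi>"
        by (simp_all add: circle_pt_def)
      then show ?thesis unfolding norm_power2_vector2 by algebra
    qed
    moreover have "x$1 * cos \<phi> + x$2 * sin \<phi> = norm x * cos (\<phi> - a)"
      unfolding cos_diff by (subst a(3), subst a(4)) (simp add: algebra_simps)
    ultimately show ?thesis
      by (simp add: mult.assoc mult.left_commute)
  qed
  with a that show ?thesis by blast
qed

lemma nn_integral_circle_pt: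
  fixes h :: "real \<Rightarrow> ennreal"
  assumes [measurable]: "h \<in> borel_measurable borel"
  shows "(\<integral>\<^sup>+\<phi>. h ((norm (circle_pt x t \<phi>))\<^sup>2) * indicator {0..2*pi} \<phi> \<partial>lborel) =
         (\<integral>\<^sup>+\<phi>. h ((norm x)\<^sup>2 + t\<^sup>2 + 2 * norm x * t * cos \<phi>) * indicator {0..2*pi} \<phi> \<partial>lborel)"
proof -
  obtain a where a: "0 \<le> a" "a \<le> 2*pi"
    "\<And>t \<phi>. (norm (circle_pt x t \<phi>))\<^sup>2 = (norm x)\<^sup>2 + t\<^sup>2 + 2 * norm x * t * cos (\<phi> - a)"
    using norm_circle_pt[of x] by metis
  show ?thesis
    unfolding a(3)
    by (rule nn_integral_periodic_shift[where h = "\<lambda>\<phi>. h ((norm x)\<^sup>2 + t\<^sup>2 + 2 * norm x * t * cos \<phi>)"])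
      (use a in auto)
qed

text \<open>Both half circles contribute equally, which is the factor 2; on each of them v = cos
  \<phi> turns the uniform angle into the arcsine density.\<close>

lemma nn_integral_cos:
  fixes h :: "real \<Rightarrow> ennreal"
  assumes [measurable]: "h \<in> borel_measurable borel"
  shows "(\<integral>\<^sup>+\<phi>. h (cos \<phi>) * indicator {0..2*pi} \<phi> \<partial>lborel) =
         2 * (\<integral>\<^sup>+v. h v * ennreal (1 / sqrt (1 - v\<^sup>2)) * indicator {-1..1} v \<partial>lborel)"
proof -
  have "(\<integral>\<^sup>+\<phi>. h (cos \<phi>) * indicator {0..2*pi} \<phi> \<partial>lborel)
      = (\<integral>\<^sup>+\<phi>. h (cos \<phi>) * indicator {0..pi} \<phi> + h (cos \<phi>) * indicator {pi<..2*pi} \<phi> \<partial>lborel)"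
    by (intro nn_integral_cong) (auto simp: indicator_def)
  also have "\<dots> = (\<integral>\<^sup>+\<phi>. h (cos \<phi>) * indicator {0..pi} \<phi> \<partial>lborel) + (\<integral>\<^sup>+\<phi>. h (cos \<phi>) * indicator {pi<..2*pi} \<phi> \<partial>lborel)"
    by (subst nn_integral_add) auto
  also have "(\<integral>\<^sup>+\<phi>. h (cos \<phi>) * indicator {pi<..2*pi} \<phi> \<partial>lborel) = (\<integral>\<^sup>+\<phi>. h (cos (2*pi - \<phi>)) * indicator {pi<..2*pi} (2*pi-\<phi>) \<partial>lborel)"
    using nn_integral_real_affine[of "\<lambda>\<phi>. h (cos \<phi>) * indicator {pi<..2*pi} \<phi>" "-1" "2*pi"] by simp
  also have "\<dots> = (\<integral>\<^sup>+\<phi>. h (cos \<phi>) * indicator {0..pi} \<phi> \<partial>lborel)"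
  proof (rule nn_integral_cong_AE)
    have "AE \<phi> in lborel. \<phi> \<noteq> pi"
      using AE_lborel_singleton by auto
    then show "AE \<phi> in lborel. h (cos (2*pi - \<phi>)) * indicator {pi<..2*pi} (2*pi-\<phi>) = h (cos \<phi>) * indicator {0..pi} \<phi>"
      by eventually_elim (auto simp: indicator_def)
  qed
  finally have 1: "(\<integral>\<^sup>+\<phi>. h (cos \<phi>) * indicator {0..2*pi} \<phi> \<partial>lborel) = 2 * (\<integral>\<^sup>+\<phi>. h (cos \<phi>) * indicator {0..pi} \<phi> \<partial>lborel)"
    unfolding mult_2 .
  \<comment> \<open>The substitution rule wants a nondecreasing map, so it is applied to - cos on
    [0, pi] and the sign is undone afterwards.\<close>
  define k where "k v = h (- v) * ennreal (1 / sqrt (1 - v\<^sup>2))" for v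
  have [measurable]: "k \<in> borel_measurable borel" unfolding k_def by measurable
  have "(\<integral>\<^sup>+v. k v * indicator {- cos 0..- cos pi} v \<partial>lborel) = (\<integral>\<^sup>+\<phi>. k (- cos \<phi>) * ennreal (sin \<phi>) * indicator {0..pi} \<phi> \<partial>lborel)"
    by (rule nn_integral_substitution_aux) (auto intro!: derivative_eq_intros continuous_intros sin_ge_zero)
  also have "\<dots> = (\<integral>\<^sup>+\<phi>. h (cos \<phi>) * indicator {0..pi} \<phi> \<partial>lborel)"
  proof (rule nn_integral_cong_AE)
    \<comment> \<open>At these two angles the weight is 1 / 0 = 0 and the cancellation
      fails.\<close>
    have "AE \<phi> in lborel. \<phi> \<noteq> 0 \<and> \<phi> \<noteq> pi"
      using AE_lborel_singleton by auto
    then show "AE \<phi> in lborel. k (- cos \<phi>) * ennreal (sin \<phi>) * indicator {0..pi} \<phi> = h (cos \<phi>) * indicator {0..pi} \<phi>"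
    proof eventually_elim
      case (elim \<phi>)
      have "1 / sqrt (1 - (cos \<phi>)\<^sup>2) * sin \<phi> = 1" if "\<phi> \<in> {0..pi}"
      proof -
        have "sin \<phi> > 0" using that elim by (intro sin_gt_zero) auto
        then show ?thesis by (simp add: sin_squared_eq[symmetric])
      qed
      then have "ennreal (1 / sqrt (1 - (cos \<phi>)\<^sup>2)) * ennreal (sin \<phi>) = 1" if "\<phi> \<in> {0..pi}"
        using that by (subst ennreal_mult''[symmetric]) (auto intro: sin_ge_zero)
      then show ?case by (auto simp: k_def indicator_def mult.assoc)
    qed
  qed
  also have "(\<integral>\<^sup>+v. k v * indicator {- cos 0..- cos pi} v \<partial>lborel) = (\<integral>\<^sup>+v. h v * ennreal (1 / sqrt (1 - v\<^sup>2)) * indicator {-1..1} v \<partial>lborel)"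
  proof -
    have "(\<integral>\<^sup>+v. k v * indicator {-1..1} v \<partial>lborel) = (\<integral>\<^sup>+v. k (- v) * indicator {-1..1} (- v) \<partial>lborel)"
      using nn_integral_real_affine[of "\<lambda>v. k v * indicator {-1..1} v" "-1" 0] by simp
    also have "\<dots> = (\<integral>\<^sup>+v. h v * ennreal (1 / sqrt (1 - v\<^sup>2)) * indicator {-1..1} v \<partial>lborel)"
      by (rule nn_integral_cong) (auto simp: k_def indicator_def)
    finally show ?thesis by simp
  qed
  finally have 2: "(\<integral>\<^sup>+\<phi>. h (cos \<phi>) * indicator {0..pi} \<phi> \<partial>lborel) = (\<integral>\<^sup>+v. h v * ennreal (1 / sqrt (1 - v\<^sup>2)) * indicator {-1..1} v \<partial>lborel)"
    by (rule sym)
  show ?thesis unfolding 1 2 ..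
qed

section \<open>Dyadic annuli and the pointwise bound\<close>

text \<open>On a circle of radius \<open>t\<close> whose centre has norm \<open>r\<close>, |y|^2
  runs through an interval of length 4 r t; \<open>\<eta>\<close> is the fraction of that length
  allowed around either endpoint. Strict inequalities make the set open.\<close>

definition annuli :: "real \<Rightarrow> real \<Rightarrow> real \<Rightarrow> (real^2) set" where
  "annuli r t \<eta> = {y. \<bar>(norm y)\<^sup>2 - (r + t)\<^sup>2\<bar> < 4 * r * t * \<eta> \<or> \<bar>(norm y)\<^sup>2 - (r - t)\<^sup>2\<bar> < 4 * r * t * \<eta>}"

lemma annuli_borel [measurable]: "annuli r t \<eta> \<in> sets borel"
  unfolding annuli_def by measurable

lemma emeasure_annuli_le:
  assumes "r * t * \<eta> \<ge> 0"
  shows "emeasure lborel (annuli r t \<eta>) \<le> ennreal (16 * pi * (r * t * \<eta>))"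
proof -
  define w where "w = 4 * r * t * \<eta>"
  have "w = 4 * (r * t * \<eta>)" by (simp add: w_def)
  with assms have w: "w \<ge> 0" by linarith
  have meas: "{y::real^2. (norm y)\<^sup>2 \<in> {c - w<..<c + w}} \<in> sets lborel" for c
  proof -
    have "(\<lambda>y::real^2. (norm y)\<^sup>2) -` {c - w<..<c + w} \<inter> space borel \<in> sets borel"
      by (rule measurable_sets[where A = borel]) auto
    then show ?thesis by (simp add: vimage_def)
  qed
  have one: "emeasure lborel {y::real^2. (norm y)\<^sup>2 \<in> {c - w<..<c + w}} \<le> ennreal (pi * (2 * w))" for c
  proof -
    have "emeasure lborel {y::real^2. (norm y)\<^sup>2 \<in> {c - w<..<c + w}} = ennreal pi * emeasure lborel ({c - w<..<c + w} \<inter> {0..})"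
      by (rule emeasure_norm_power2_vimage) simp
    also have "\<dots> \<le> ennreal pi * emeasure lborel {c - w<..<c + w}"
      by (intro mult_left_mono emeasure_mono) auto
    also have "\<dots> = ennreal (pi * (2 * w))"
      using w by (simp add: ennreal_mult)
    finally show ?thesis .
  qed
  define A B where "A = {y::real^2. (norm y)\<^sup>2 \<in> {(r + t)\<^sup>2 - w<..<(r + t)\<^sup>2 + w}}"
    and "B = {y::real^2. (norm y)\<^sup>2 \<in> {(r - t)\<^sup>2 - w<..<(r - t)\<^sup>2 + w}}"
  have "annuli r t \<eta> = A \<union> B"
    unfolding annuli_def w_def[symmetric] A_def B_def by (auto simp: abs_less_iff)
  then have "emeasure lborel (annuli r t \<eta>) \<le> emeasure lborel A + emeasure lborel B"
    using emeasure_subadditive[of A lborel B] meas unfolding A_def B_def by simp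
  also have "\<dots> \<le> ennreal (pi * (2 * w)) + ennreal (pi * (2 * w))"
    unfolding A_def B_def by (rule add_mono[OF one one])
  also have "\<dots> = ennreal (16 * pi * (r * t * \<eta>))"
  proof -
    have "ennreal (pi * (2 * w)) + ennreal (pi * (2 * w)) = ennreal (pi * (2 * w) + pi * (2 * w))"
      using w by (intro ennreal_plus[symmetric]) auto
    also have "pi * (2 * w) + pi * (2 * w) = 16 * pi * (r * t * \<eta>)"
      by (simp add: w_def)
    finally show ?thesis .
  qed
  finally show ?thesis .
qed

lemma ex_dyadic:
  fixes z :: real
  assumes "0 < z" "z \<le> 1"
  obtains j :: nat where "(1/2)^j \<le> z" "z < 2 * (1/2)^j"
proof -
  have ex: "\<exists>j. (1/2)^j \<le> z"
    using real_arch_pow_inv[of z "1/2"] assms by (auto intro: less_imp_le)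
  define j where "j = (LEAST j. (1/2)^j \<le> z)"
  have j: "(1/2)^j \<le> z"
    unfolding j_def by (rule LeastI_ex[OF ex])
  have "z < 2 * (1/2)^j"
  proof (cases j)
    case (Suc k)
    then have "\<not> (1/2)^k \<le> z"
      using not_less_Least[of k "\<lambda>j. (1/2)^j \<le> z"] unfolding j_def by simp
    then show ?thesis using Suc by simp
  qed (use assms in auto)
  with j that show ?thesis by blast
qed

text \<open>1 - v^2 \<ge> 1 - |v|, so where 1 - |v| lies between 2^(-j) and twice that, the density
  is at most 2^(j/2), and this one term of the series is enough. At |v| = 1 the left side is 1 / 0 =
  0.\<close>

lemma arcsine_density_le_dyadic:
  assumes "v \<in> {-1..1::real}"
  shows "ennreal (1 / sqrt (1 - v\<^sup>2)) \<le>
     (\<Sum>j. ennreal (((1/2)^j) powr (-1/2)) * indicator {v. 1 - \<bar>v\<bar> < 2 * (1/2)^j} v)"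
proof (cases "\<bar>v\<bar> = 1")
  case True
  then have "v\<^sup>2 = 1" by (simp add: power2_eq_1_iff abs_if split: if_splits)
  then show ?thesis by simp
next
  case False
  with assms have z: "0 < 1 - \<bar>v\<bar>" "1 - \<bar>v\<bar> \<le> 1" by auto
  from ex_dyadic[OF z] obtain j :: nat where j: "(1/2)^j \<le> 1 - \<bar>v\<bar>" "1 - \<bar>v\<bar> < 2 * (1/2)^j" .
  have "\<bar>v\<bar> * \<bar>v\<bar> \<le> \<bar>v\<bar> * 1" using z by (intro mult_left_mono) auto
  then have "(1/2)^j \<le> 1 - v\<^sup>2" using j by (simp add: power2_eq_square)
  then have "1 / sqrt (1 - v\<^sup>2) \<le> 1 / sqrt ((1/2)^j)"
    using less_le_trans[of 0 "(1/2)^j" "1 - v\<^sup>2"]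
    by (intro divide_left_mono mult_pos_pos real_sqrt_le_mono) simp_all
  also have "\<dots> = ((1/2)^j) powr (-1/2)"
    using powr_minus_divide[of "(1/2)^j" "1/2 :: real"] powr_half_sqrt[of "(1/2)^j :: real"]
    unfolding minus_divide_left by simp
  finally have "ennreal (1 / sqrt (1 - v\<^sup>2)) \<le> ennreal (((1/2)^j) powr (-1/2)) * indicator {v. 1 - \<bar>v\<bar> < 2 * (1/2)^j} v"
    using j by (simp add: ennreal_leI)
  also have "\<dots> \<le> (\<Sum>j. ennreal (((1/2)^j) powr (-1/2)) * indicator {v. 1 - \<bar>v\<bar> < 2 * (1/2)^j} v)"
    using sum_le_suminf[of "\<lambda>j. ennreal (((1/2)^j) powr (-1/2)) * indicator {v. 1 - \<bar>v\<bar> < 2 * (1/2)^j} v" "{j}"]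
    by (simp only: sum.insert sum.empty finite.intros empty_iff not_False_eq_True add_0_right summableI zero_le)
  finally show ?thesis .
qed

text \<open>Passing from v to |y|^2 = m(v) and on to y involves constant Jacobians only: the slope 2
  r t of the affine map and pi for the squared norm, whence the factor 1 / (2 pi r t). Nearness of v
  to 1 or -1 becomes nearness of |y|^2 to an endpoint.\<close>

lemma nn_integral_circle_le_dyadic:
  fixes h :: "real \<Rightarrow> ennreal"
  assumes [measurable]: "h \<in> borel_measurable borel" and x: "x \<noteq> 0" and t: "t > 0"
  shows "(\<integral>\<^sup>+\<phi>. h ((norm (circle_pt x t \<phi>))\<^sup>2) * indicator {0..2*pi} \<phi> \<partial>lborel) \<le>
    (\<Sum>j. ennreal (((1/2)^j) powr (-1/2) / (pi * norm x * t)) *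
      (\<integral>\<^sup>+y. h ((norm y)\<^sup>2) * indicator (annuli (norm x) t ((1/2)^j)) y \<partial>lborel))"
proof -
  define r where "r = norm x"
  have r: "r > 0" using x by (simp add: r_def)
  define m where "m v = r\<^sup>2 + t\<^sup>2 + 2 * r * t * v" for v :: real
  let ?I = "\<lambda>j. \<integral>\<^sup>+y. h ((norm y)\<^sup>2) * indicator (annuli r t ((1/2)^j)) y \<partial>lborel"
  let ?V = "\<lambda>j v. h (m v) * indicator {v. 1 - \<bar>v\<bar> < 2 * (1/2)^j} v * indicator {-1..1} v"
  let ?c = "\<lambda>j. ennreal (((1/2)^j) powr (-1/2))"
  define B where "B j = {u. \<bar>u - (r + t)\<^sup>2\<bar> < 4 * r * t * (1/2)^j \<or> \<bar>u - (r - t)\<^sup>2\<bar> < 4 * r * t * (1/2)^j}" for j :: nat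
  have [measurable]: "B j \<in> sets borel" for j unfolding B_def by measurable
  have [measurable]: "m \<in> borel_measurable borel" unfolding m_def by measurable
  have inB: "m v \<in> B j \<inter> {0..}" if "v \<in> {-1..1}" "1 - \<bar>v\<bar> < 2 * (1/2)^j" for v j
  proof -
    have rt: "2 * r * t > 0" using r t by simp
    have 1: "m v - (r + t)\<^sup>2 = - (2 * r * t * (1 - v))" "m v - (r - t)\<^sup>2 = 2 * r * t * (1 + v)"
      by (simp_all add: m_def power2_eq_square algebra_simps)
    have 2: "2 * r * t * (1 - v) \<ge> 0" "2 * r * t * (1 + v) \<ge> 0"
      using that rt by (auto intro!: mult_nonneg_nonneg)
    have "m v \<ge> 0"
      using 1(2) 2(2) zero_le_power2[of "r - t"] by linarith
    moreover have "m v \<in> B j"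
    proof (cases "v \<ge> 0")
      case True
      then have "2 * r * t * (1 - v) < 2 * r * t * (2 * (1/2)^j)"
        using that rt by (intro mult_strict_left_mono) auto
      then have "\<bar>m v - (r + t)\<^sup>2\<bar> < 4 * r * t * (1/2)^j"
        unfolding 1 using 2 by simp
      then show ?thesis by (simp add: B_def)
    next
      case False
      then have "2 * r * t * (1 + v) < 2 * r * t * (2 * (1/2)^j)"
        using that rt by (intro mult_strict_left_mono) auto
      then have "\<bar>m v - (r - t)\<^sup>2\<bar> < 4 * r * t * (1/2)^j"
        unfolding 1 using 2 by simp
      then show ?thesis by (simp add: B_def)
    qed
    ultimately show ?thesis by simp
  qed
  have piece: "(\<integral>\<^sup>+v. ?V j v \<partial>lborel) \<le>
      ennreal (1 / (2 * pi * r * t)) * ?I j" for j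
  proof -
    define k where "k u = h u * indicator (B j) u" for u
    have [measurable]: "k \<in> borel_measurable borel" unfolding k_def by measurable
    have "(\<integral>\<^sup>+v. ?V j v \<partial>lborel)
        \<le> (\<integral>\<^sup>+v. k (m v) * indicator {0..} (m v) \<partial>lborel)"
      using inB[of _ j] by (intro nn_integral_mono) (auto simp: indicator_def k_def)
    moreover have "(\<integral>\<^sup>+u. k u * indicator {0..} u \<partial>lborel) =
        ennreal (2 * r * t) * (\<integral>\<^sup>+v. k (m v) * indicator {0..} (m v) \<partial>lborel)"
      using nn_integral_real_affine[of "\<lambda>u. k u * indicator {0..} u" "2 * r * t" "r\<^sup>2 + t\<^sup>2"] r t
      by (simp add: m_def)
    moreover have "(\<integral>\<^sup>+y. k ((norm (y::real^2))\<^sup>2) \<partial>lborel) = ennreal pi * (\<integral>\<^sup>+u. k u * indicator {0..} u \<partial>lborel)"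
      by (rule nn_integral_norm_power2) simp
    moreover have "(\<integral>\<^sup>+y. k ((norm (y::real^2))\<^sup>2) \<partial>lborel) = ?I j"
      by (intro nn_integral_cong) (simp add: k_def annuli_def B_def indicator_def)
    moreover have "ennreal (1 / (2 * pi * r * t)) * (ennreal pi * (ennreal (2 * r * t) * X)) = X" for X
    proof -
      have "ennreal (1 / (2 * pi * r * t)) * (ennreal pi * (ennreal (2 * r * t) * X))
        = ennreal ((1 / (2 * pi * r * t)) * (pi * (2 * r * t))) * X"
        using r t by (subst ennreal_mult', simp, subst ennreal_mult', simp) (simp only: mult.assoc)
      also have "(1 / (2 * pi * r * t)) * (pi * (2 * r * t)) = 1"
        using r t by simp
      finally show ?thesis by simp
    qed
    ultimately show ?thesis by simp
  qed
  have "(\<integral>\<^sup>+\<phi>. h ((norm (circle_pt x t \<phi>))\<^sup>2) * indicator {0..2*pi} \<phi> \<partial>lborel)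
      = (\<integral>\<^sup>+\<phi>. h (m (cos \<phi>)) * indicator {0..2*pi} \<phi> \<partial>lborel)"
    by (subst nn_integral_circle_pt) (simp_all add: m_def r_def)
  also have "\<dots> = 2 * (\<integral>\<^sup>+v. h (m v) * ennreal (1 / sqrt (1 - v\<^sup>2)) * indicator {-1..1} v \<partial>lborel)"
    by (rule nn_integral_cos) measurable
  also have "\<dots> \<le> 2 * (\<integral>\<^sup>+v. (\<Sum>j. ?c j *
      ?V j v) \<partial>lborel)"
  proof (intro mult_left_mono nn_integral_mono)
    fix v :: real
    show "h (m v) * ennreal (1 / sqrt (1 - v\<^sup>2)) * indicator {-1..1} v \<le> (\<Sum>j. ?c j *
      ?V j v)"
    proof (cases "v \<in> {-1..1}")
      case True
      have "h (m v) * ennreal (1 / sqrt (1 - v\<^sup>2)) \<le> h (m v) * (\<Sum>j. ?c j * indicator {v. 1 - \<bar>v\<bar> < 2 * (1/2)^j} v)"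
        by (intro mult_left_mono arcsine_density_le_dyadic True) auto
      also have "\<dots> = (\<Sum>j. h (m v) * (?c j * indicator {v. 1 - \<bar>v\<bar> < 2 * (1/2)^j} v))"
        by (rule ennreal_suminf_cmult[symmetric])
      finally show ?thesis using True by (simp add: mult.left_commute)
    qed simp
  qed simp
  also have "\<dots> = 2 * (\<Sum>j. \<integral>\<^sup>+v. ?c j *
      ?V j v \<partial>lborel)"
    by (subst nn_integral_suminf) auto
  also have "\<dots> = 2 * (\<Sum>j. ?c j * (\<integral>\<^sup>+v.
      ?V j v \<partial>lborel))"
    by (subst nn_integral_cmult) auto
  also have "\<dots> \<le> 2 * (\<Sum>j. ?c j * (ennreal (1 / (2 * pi * r * t)) *
     ?I j))"
    by (intro mult_left_mono suminf_le piece) auto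
  also have "\<dots> = (\<Sum>j. 2 * (?c j * (ennreal (1 / (2 * pi * r * t)) *
     ?I j)))"
    by (rule ennreal_suminf_cmult[symmetric])
  also have "\<dots> = (\<Sum>j. ennreal (((1/2)^j) powr (-1/2) / (pi * norm x * t)) *
      (\<integral>\<^sup>+y. h ((norm y)\<^sup>2) * indicator (annuli (norm x) t ((1/2)^j)) y \<partial>lborel))"
  proof (rule suminf_cong)
    fix j
    have "2 * (?c j * ennreal (1 / (2 * pi * r * t))) = ennreal 2 * (?c j * ennreal (1 / (2 * pi * r * t)))"
      by simp
    also have "\<dots> = ennreal (2 * (((1/2)^j) powr (-1/2) * (1 / (2 * pi * r * t))))"
      using r t by (subst ennreal_mult', simp, subst ennreal_mult', simp) (rule refl)
    also have "2 * (((1/2)^j) powr (-1/2) * (1 / (2 * pi * r * t))) = ((1/2)^j) powr (-1/2) / (pi * r * t)"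
      using r t by (simp add: field_simps)
    finally show "2 * (?c j * (ennreal (1 / (2 * pi * r * t)) *
     ?I j)) =
     ennreal (((1/2)^j) powr (-1/2) / (pi * norm x * t)) *
      (\<integral>\<^sup>+y. h ((norm y)\<^sup>2) * indicator (annuli (norm x) t ((1/2)^j)) y \<partial>lborel)"
      by (simp add: mult.assoc[symmetric] r_def[symmetric])
  qed
  finally show ?thesis .
qed

lemma continuous_circle_pt: "continuous_on A (circle_pt x t)"
proof -
  have "circle_pt x t = (\<lambda>\<phi>. x + t *\<^sub>R (cos \<phi> *\<^sub>R axis 1 1 + sin \<phi> *\<^sub>R axis 2 1))"
    by (rule ext) (simp add: circle_pt_def vec_eq_iff forall_2 axis_def)
  then show ?thesis by (simp only:) (intro continuous_intros)
qed

lemma measurable_circle_pt [measurable]: "circle_pt x t \<in> borel_measurable borel"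
  by (rule borel_measurable_continuous_onI[OF continuous_circle_pt])

text \<open>The dyadic bound is used twice: with the indicator of \<open>Z\<close> it shows that the
  circle meets the exceptional radii in a null set of angles, and with |G| it bounds the average. A
  circle about the origin could lie in the exceptional set entirely, hence
  \<open>x \<noteq> 0\<close>.\<close>

lemma abs_circ_avg_le_dyadic:
  assumes f: "f \<in> borel_measurable lebesgue" "radial f" and x: "x \<noteq> 0" and t: "t > 0"
  shows "abs_circ_avg f t x \<le> (\<Sum>j. ennreal (((1/2)^j) powr (-1/2) / (2 * pi\<^sup>2 * norm x * t)) *
      (\<integral>\<^sup>+y. ennreal (norm (f y)) * indicator (annuli (norm x) t ((1/2)^j)) y \<partial>lebesgue))"
proof -
  obtain G :: "real \<Rightarrow> complex" and Z where
    G [measurable]: "G \<in> borel_measurable borel" and Z: "Z \<in> null_sets lborel"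
    and fG: "\<And>y. (norm y)\<^sup>2 \<notin> Z \<Longrightarrow> f y = G ((norm y)\<^sup>2)"
    using radial_borel_representative[OF f] by blast
  have [measurable]: "Z \<in> sets borel" using Z by auto
  have Z0: "emeasure lborel (Z \<inter> {0..}) = 0"
    using emeasure_mono[of "Z \<inter> {0..}" Z lborel] Z by (auto simp: null_sets_def)
  have aeZ: "AE y in lborel. (norm (y::real^2))\<^sup>2 \<notin> Z"
  proof -
    have "emeasure lborel {y::real^2. (norm y)\<^sup>2 \<in> Z} = 0"
      unfolding emeasure_norm_power2_vimage[OF \<open>Z \<in> sets borel\<close>] Z0 by simp
    then show ?thesis by (subst AE_iff_measurable[OF _ refl]) auto
  qed
  define N where "N = {\<phi>. (norm (circle_pt x t \<phi>))\<^sup>2 \<in> Z} \<inter> {0..2*pi}"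
  have [measurable]: "N \<in> sets borel" unfolding N_def by measurable
  have "emeasure lborel N = (\<integral>\<^sup>+\<phi>. indicator Z ((norm (circle_pt x t \<phi>))\<^sup>2) * indicator {0..2*pi} \<phi> \<partial>lborel)"
  proof -
    have "emeasure lborel N = (\<integral>\<^sup>+\<phi>. indicator N \<phi> \<partial>lborel)" by simp
    also have "\<dots> = (\<integral>\<^sup>+\<phi>. indicator Z ((norm (circle_pt x t \<phi>))\<^sup>2) * indicator {0..2*pi} \<phi> \<partial>lborel)"
      by (rule nn_integral_cong) (simp add: N_def indicator_def)
    finally show ?thesis .
  qed
  also have "\<dots> \<le> (\<Sum>j. ennreal (((1/2)^j) powr (-1/2) / (pi * norm x * t)) *
      (\<integral>\<^sup>+y. indicator Z ((norm y)\<^sup>2) * indicator (annuli (norm x) t ((1/2)^j)) y \<partial>lborel))"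
    by (rule nn_integral_circle_le_dyadic) (use x t in auto)
  also have "\<dots> = (\<Sum>j. 0)"
  proof (rule suminf_cong)
    fix j
    have "(\<integral>\<^sup>+y. indicator Z ((norm y)\<^sup>2) * indicator (annuli (norm x) t ((1/2)^j)) y \<partial>lborel) = (\<integral>\<^sup>+y. 0 \<partial>(lborel :: (real^2) measure))"
      by (rule nn_integral_cong_AE) (use aeZ in \<open>auto elim!: eventually_mono\<close>)
    then show "ennreal (((1/2)^j) powr (-1/2) / (pi * norm x * t)) *
      (\<integral>\<^sup>+y. indicator Z ((norm y)\<^sup>2) * indicator (annuli (norm x) t ((1/2)^j)) y \<partial>lborel) = 0"
      by simp
  qed
  finally have N: "N \<in> null_sets lborel" by (auto simp: null_sets_def)
  define F where "F \<phi> = f (circle_pt x t \<phi>)" for \<phi>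
  define H where "H \<phi> = G ((norm (circle_pt x t \<phi>))\<^sup>2)" for \<phi>
  have [measurable]: "H \<in> borel_measurable borel" unfolding H_def by measurable
  have FH: "F \<phi> = H \<phi>" if "\<phi> \<in> {0..2*pi}" "\<phi> \<notin> N" for \<phi>
    using that by (auto simp: F_def H_def N_def intro!: fG)
  \<comment> \<open>Off the null set \<open>N\<close> the function agrees with the Borel function
    \<open>H\<close>; inside \<open>N\<close> every preimage is null, hence measurable by
    completeness.\<close>
  have F: "F \<in> borel_measurable (lebesgue_on {0..2*pi})"
  proof (rule measurableI)
    fix B :: "complex set" assume [measurable]: "B \<in> sets borel"
    have "F -` B \<inter> N \<in> null_sets lebesgue"
      by (rule null_sets_completion_subset[OF _ null_sets_completionI[OF N]]) auto
    moreover have "H -` B \<inter> ({0..2*pi} - N) \<in> sets lebesgue"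
      by (intro sets_completionI_sets) measurable
    ultimately have "F -` B \<inter> N \<union> H -` B \<inter> ({0..2*pi} - N) \<in> sets lebesgue"
      by auto
    also have "F -` B \<inter> N \<union> H -` B \<inter> ({0..2*pi} - N) = F -` B \<inter> {0..2*pi}"
      using FH by (auto simp: N_def)
    finally have "F -` B \<inter> {0..2*pi} \<in> sets lebesgue" .
    then show "F -` B \<inter> space (lebesgue_on {0..2*pi}) \<in> sets (lebesgue_on {0..2*pi})"
      by (simp add: space_restrict_space sets_restrict_space_iff)
  qed auto
  have "(\<integral>\<^sup>+\<phi>. ennreal (norm (F \<phi>)) \<partial>lebesgue_on {0..2*pi}) = (\<integral>\<^sup>+\<phi>. ennreal (norm (F \<phi>)) * indicator {0..2*pi} \<phi> \<partial>lebesgue)"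
    by (rule nn_integral_restrict_space) simp
  also have "\<dots> = (\<integral>\<^sup>+\<phi>. ennreal (norm (G ((norm (circle_pt x t \<phi>))\<^sup>2))) * indicator {0..2*pi} \<phi> \<partial>lborel)"
    unfolding nn_integral_completion
  proof (rule nn_integral_cong_AE)
    show "AE \<phi> in lborel. ennreal (norm (F \<phi>)) * indicator {0..2*pi} \<phi> = ennreal (norm (G ((norm (circle_pt x t \<phi>))\<^sup>2))) * indicator {0..2*pi} \<phi>"
      using AE_not_in[OF N] by eventually_elim (auto simp: indicator_def FH H_def)
  qed
  also have "\<dots> \<le> (\<Sum>j. ennreal (((1/2)^j) powr (-1/2) / (pi * norm x * t)) *
      (\<integral>\<^sup>+y. ennreal (norm (G ((norm y)\<^sup>2))) * indicator (annuli (norm x) t ((1/2)^j)) y \<partial>lborel))"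
    by (rule nn_integral_circle_le_dyadic[where h = "\<lambda>u. ennreal (norm (G u))"]) (use x t in auto)
  also have "\<dots> = (\<Sum>j. ennreal (((1/2)^j) powr (-1/2) / (pi * norm x * t)) *
      (\<integral>\<^sup>+y. ennreal (norm (f y)) * indicator (annuli (norm x) t ((1/2)^j)) y \<partial>lebesgue))" (is "_ = ?R")
    unfolding nn_integral_completion
    by (intro suminf_cong arg_cong2[where f = "(*)"] refl nn_integral_cong_AE)
      (use aeZ in \<open>auto elim!: eventually_mono simp: fG\<close>)
  finally have le: "(\<integral>\<^sup>+\<phi>. ennreal (norm (F \<phi>)) \<partial>lebesgue_on {0..2*pi}) \<le> ?R" .
  have "ennreal (1 / (2*pi)) * ?R = (\<Sum>j. ennreal (((1/2)^j) powr (-1/2) / (2 * pi\<^sup>2 * norm x * t)) *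
      (\<integral>\<^sup>+y. ennreal (norm (f y)) * indicator (annuli (norm x) t ((1/2)^j)) y \<partial>lebesgue))" (is "_ = ?R'")
    unfolding ennreal_suminf_cmult[symmetric] mult.assoc[symmetric]
    using t by (subst ennreal_mult[symmetric]) (auto simp: power2_eq_square algebra_simps)
  moreover have "abs_circ_avg f t x \<le> ennreal (1 / (2*pi)) * (\<integral>\<^sup>+\<phi>. ennreal (norm (F \<phi>)) \<partial>lebesgue_on {0..2*pi})"
  proof (cases "(\<integral>\<^sup>+\<phi>. ennreal (norm (F \<phi>)) \<partial>lebesgue_on {0..2*pi}) = \<infinity>")
    \<comment> \<open>A divergent average is \<infinity> by convention, and then so is the
      bound.\<close>
    case True
    then show ?thesis by (simp add: ennreal_mult_top)
  next
    case False
    then have int: "integrable (lebesgue_on {0..2*pi}) F"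
      by (intro integrableI_bounded F) (simp add: less_top)
    have "norm (circ_avg f t x) = 1 / (2*pi) * norm (integral\<^sup>L (lebesgue_on {0..2*pi}) F)"
      unfolding circ_avg_def F_def[abs_def] by simp
    then have "ennreal (norm (circ_avg f t x)) = ennreal (1 / (2*pi)) * ennreal (norm (integral\<^sup>L (lebesgue_on {0..2*pi}) F))"
      by (simp only:) (rule ennreal_mult', simp)
    also have "\<dots> \<le> ennreal (1 / (2*pi)) * (\<integral>\<^sup>+\<phi>. ennreal (norm (F \<phi>)) \<partial>lebesgue_on {0..2*pi})"
      by (intro mult_left_mono integral_norm_bound_ennreal int) auto
    finally show ?thesis
      using int by (simp add: abs_circ_avg_def circ_integrable_def F_def[abs_def])
  qed
  ultimately show ?thesis
    using mult_left_mono[OF le, of "ennreal (1 / (2*pi))"] by (metis (no_types, lifting) order.trans zero_le)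
qed

section \<open>A Schur test for the maximal function\<close>

lemma ennreal_powr_mono: "x \<le> y \<Longrightarrow> 0 \<le> a \<Longrightarrow> ennreal_powr x a \<le> ennreal_powr y a"
  by (auto simp: ennreal_powr_def top_unique intro!: ennreal_leI powr_mono2 enn2real_mono simp: less_top)

lemma ennreal_powr_ennreal: "0 \<le> c \<Longrightarrow> ennreal_powr (ennreal c) a = ennreal (c powr a)"
  by (simp add: ennreal_powr_def)

text \<open>Summing \<open>z \<le> 1 + z\<^sup>p\<close> with the optimal scaling gives Hoelder's inequality up to the constant 2.\<close>
lemma nn_integral_Holder_crude:
  fixes g :: "'a \<Rightarrow> real"
  assumes [measurable]: "g \<in> borel_measurable M" "W \<in> sets M" and g: "\<And>y. g y \<ge> 0" and p: "p \<ge> 1"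
    and V: "emeasure M W \<le> ennreal V" "V > 0"
    and P: "(\<integral>\<^sup>+y. ennreal (g y powr p) * indicator W y \<partial>M) \<le> ennreal P" "P \<ge> 0"
  shows "(\<integral>\<^sup>+y. ennreal (g y) * indicator W y \<partial>M) \<le> ennreal (2 * V powr (1 - 1/p) * P powr (1/p))"
proof (cases "P = 0")
  case True
  then have "(\<integral>\<^sup>+y. ennreal (g y powr p) * indicator W y \<partial>M) = 0"
    using P by simp
  then have "AE y in M. ennreal (g y powr p) * indicator W y = 0"
    by (subst (asm) nn_integral_0_iff_AE) auto
  then have "(\<integral>\<^sup>+y. ennreal (g y) * indicator W y \<partial>M) = (\<integral>\<^sup>+y. 0 \<partial>M)"
    by (intro nn_integral_cong_AE) (auto elim!: eventually_mono simp: indicator_def split: if_splits)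
  then show ?thesis by simp
next
  case False
  \<comment> \<open>The scale at which the two terms of z \<le> 1 + z^p, with z = g / l, integrate
    to the same amount: l V = l^(1-p) P. It vanishes for P = 0, hence the separate case.\<close>
  define l where "l = (P / V) powr (1/p)"
  have l: "l > 0" using False P V by (simp add: l_def)
  have lp: "l powr p = P / V" using False P V p by (simp add: l_def powr_powr)
  have "ennreal (g y) * indicator W y \<le> ennreal l * indicator W y + ennreal (l / l powr p) * (ennreal (g y powr p) * indicator W y)" for y
  proof -
    have "z \<le> 1 + z powr p" if "z \<ge> 0" for z :: real
    proof (cases "z \<le> 1")
      case True
      then show ?thesis using powr_ge_zero[of z p] by linarith
    next
      case False
      then have "z powr 1 \<le> z powr p" using p by (intro powr_mono) auto
      then show ?thesis using False by simp
    qed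
    from this[of "g y / l"] have "g y / l \<le> 1 + (g y / l) powr p"
      using g l by simp
    then have "g y \<le> l * (1 + (g y / l) powr p)"
      using l by (simp add: field_simps)
    also have "\<dots> = l + l / l powr p * g y powr p"
      using g l by (simp add: powr_divide algebra_simps)
    finally have "ennreal (g y) \<le> ennreal l + ennreal (l / l powr p) * ennreal (g y powr p)"
      using l by (simp flip: ennreal_plus ennreal_mult' add: ennreal_leI)
    then show ?thesis by (simp add: indicator_def)
  qed
  then have "(\<integral>\<^sup>+y. ennreal (g y) * indicator W y \<partial>M) \<le> (\<integral>\<^sup>+y. ennreal l * indicator W y + ennreal (l / l powr p) * (ennreal (g y powr p) * indicator W y) \<partial>M)"
    by (intro nn_integral_mono)
  also have "\<dots> = ennreal l * emeasure M W + ennreal (l / l powr p) * (\<integral>\<^sup>+y. ennreal (g y powr p) * indicator W y \<partial>M)"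
    by (subst nn_integral_add) (auto simp: nn_integral_cmult)
  also have "\<dots> \<le> ennreal l * ennreal V + ennreal (l / l powr p) * ennreal P"
    by (intro add_mono mult_left_mono V P) auto
  also have "\<dots> = ennreal (l * V + l / l powr p * P)"
  proof -
    have "ennreal l * ennreal V = ennreal (l * V)" "ennreal (l / l powr p) * ennreal P = ennreal (l / l powr p * P)"
      using l V P by (auto simp only: ennreal_mult less_imp_le divide_nonneg_nonneg powr_ge_zero)
    then show ?thesis using l V P by (simp only:) (rule ennreal_plus[symmetric]; simp)
  qed
  also have "l * V + l / l powr p * P = 2 * (l * V)"
    unfolding lp using False V by simp
  also have "l * V = V powr (1 - 1/p) * P powr (1/p)"
    using False P V by (simp add: l_def powr_divide powr_diff)
  finally show ?thesis by (simp add: mult.assoc)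
qed

section \<open>The incidence set of points and annuli\<close>

text \<open>One set for all \<open>t\<close> in \<open>E\<close>: replacing the annulus by this
  union takes the supremum over \<open>t\<close> out of the integrals, at the price of the covering
  numbers that bound its sections.\<close>

definition near_set :: "real set \<Rightarrow> nat \<Rightarrow> real^2 \<Rightarrow> (real^2) set" where
  "near_set E j x = (\<Union>t\<in>E. annuli (norm x) t ((1/2)^j))"

text \<open>A union of open sets over an arbitrary index set. This is where the strict inequalities
  in \<open>annuli\<close> are used, and it makes Tonelli's theorem available for every
  \<open>E\<close>.\<close>

lemma open_near_pairs: "open {(x, y). y \<in> near_set E j x}"
proof -
  have "{(x, y). y \<in> near_set E j x} = (\<Union>t\<in>E. {z. \<bar>(norm (snd z))\<^sup>2 - (norm (fst z) + t)\<^sup>2\<bar> < 4 * norm (fst z) * t * (1/2)^j}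
     \<union> {z. \<bar>(norm (snd z))\<^sup>2 - (norm (fst z) - t)\<^sup>2\<bar> < 4 * norm (fst z) * t * (1/2)^j})"
    by (auto simp: near_set_def annuli_def)
  also have "open \<dots>"
    by (intro open_UN ballI open_Un open_Collect_less continuous_intros)
  finally show ?thesis .
qed

lemma near_pairs_borel [measurable]: "{(x, y). y \<in> near_set E j x} \<in> sets (borel \<Otimes>\<^sub>M borel)"
  using open_near_pairs[of E j] unfolding borel_prod by (rule borel_open)

lemma near_set_borel [measurable]: "near_set E j x \<in> sets borel"
proof -
  have "Pair x -` {(x, y). y \<in> near_set E j x} \<in> sets borel"
    using near_pairs_borel by (rule sets_Pair1)
  then show ?thesis by (simp add: vimage_def)
qed

text \<open>Hoelder on each annulus, with a bound \<open>P j\<close> that no longer mentions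
  \<open>t\<close>. The factor V of V^(1 - 1/p) cancels the normalization 1 / (r t) and turns
  2^(j/2) into 2^(-j/2); since t \<ge> 1, what remains is V^(-1/p) \<le> (r 2^(-j))^(-1/p), so the
  estimate survives the supremum over \<open>t\<close>. The constant 32 is a generous rounding of 16
  / pi.\<close>

lemma max_fun_le_dyadic:
  assumes E: "E \<subseteq> {1..2}" and f: "f \<in> borel_measurable lebesgue" "radial f" and x: "x \<noteq> 0" and p: "p \<ge> 1"
    and P: "\<And>j. P j \<ge> 0" "\<And>j. (\<integral>\<^sup>+y. ennreal (norm (f y) powr p) * indicator (near_set E j x) y \<partial>lebesgue) \<le> ennreal (P j)"
  shows "max_fun E f x \<le> (\<Sum>j. ennreal (32 * ((1/2)^j) powr (1/2) * (norm x * (1/2)^j) powr (-1/p) * P j powr (1/p)))"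
  unfolding max_fun_def
proof (rule SUP_least)
  fix t assume t: "t \<in> E"
  with E have t12: "1 \<le> t" "t \<le> 2" by auto
  define r where "r = norm x"
  have r: "r > 0" using x by (simp add: r_def)
  have "ennreal (((1/2)^j) powr (-1/2) / (2 * pi\<^sup>2 * r * t)) *
      (\<integral>\<^sup>+y. ennreal (norm (f y)) * indicator (annuli r t ((1/2)^j)) y \<partial>lebesgue)
    \<le> ennreal (32 * ((1/2)^j) powr (1/2) * (r * (1/2)^j) powr (-1/p) * P j powr (1/p))" for j
  proof -
    define \<eta> :: real where "\<eta> = (1/2)^j"
    have \<eta>: "\<eta> > 0" by (simp add: \<eta>_def)
    define V where "V = 16 * pi * (r * t * \<eta>)"
    have V: "V > 0" using r t12 \<eta> by (simp add: V_def)
    have sub: "annuli r t \<eta> \<subseteq> near_set E j x"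
      using t by (auto simp: near_set_def r_def \<eta>_def)
    have "(\<integral>\<^sup>+y. ennreal (norm (f y) powr p) * indicator (annuli r t \<eta>) y \<partial>lebesgue)
       \<le> (\<integral>\<^sup>+y. ennreal (norm (f y) powr p) * indicator (near_set E j x) y \<partial>lebesgue)"
      using sub by (intro nn_integral_mono) (auto simp: indicator_def)
    also note P(2)[of j]
    finally have Pj: "(\<integral>\<^sup>+y. ennreal (norm (f y) powr p) * indicator (annuli r t \<eta>) y \<partial>lebesgue) \<le> ennreal (P j)" .
    have "emeasure lebesgue (annuli r t \<eta>) \<le> ennreal V"
      unfolding V_def using emeasure_annuli_le[of r t \<eta>] r t12 \<eta> by simp
    then have "(\<integral>\<^sup>+y. ennreal (norm (f y)) * indicator (annuli r t \<eta>) y \<partial>lebesgue) \<le> ennreal (2 * V powr (1 - 1/p) * P j powr (1/p))"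
      using f V Pj P(1)[of j] p by (intro nn_integral_Holder_crude) auto
    then have "ennreal (\<eta> powr (-1/2) / (2 * pi\<^sup>2 * r * t)) * (\<integral>\<^sup>+y. ennreal (norm (f y)) * indicator (annuli r t \<eta>) y \<partial>lebesgue)
       \<le> ennreal (\<eta> powr (-1/2) / (2 * pi\<^sup>2 * r * t)) * ennreal (2 * V powr (1 - 1/p) * P j powr (1/p))"
      by (rule mult_left_mono) simp
    also have "\<dots> = ennreal (\<eta> powr (-1/2) / (2 * pi\<^sup>2 * r * t) * (2 * V powr (1 - 1/p) * P j powr (1/p)))"
      using r t12 by (intro ennreal_mult[symmetric]) auto
    also have "\<dots> \<le> ennreal (32 * \<eta> powr (1/2) * (r * \<eta>) powr (-1/p) * P j powr (1/p))"
    proof (rule ennreal_leI)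
      have "V powr (1 - 1/p) = V * V powr (-1/p)"
        using V powr_add[of V 1 "-1/p"] by simp
      also have "V powr (-1/p) \<le> (r * \<eta>) powr (-1/p)"
      proof (rule powr_mono2')
        have "1 * (r * \<eta>) \<le> (16 * pi * t) * (r * \<eta>)"
          using r \<eta> t12 pi_gt3 mult_mono[of 1 "16 * pi" 1 t] by (intro mult_right_mono) auto
        then show "r * \<eta> \<le> V" by (simp add: V_def algebra_simps)
      qed (use p r \<eta> in auto)
      finally have 1: "V powr (1 - 1/p) \<le> V * (r * \<eta>) powr (-1/p)"
        using V by (simp add: mult_left_mono)
      have h: "\<eta> powr (-1/2) * \<eta> = \<eta> powr (1/2)"
        using \<eta> powr_add[of \<eta> "-1/2" 1] by simp
      have "\<eta> powr (-1/2) / (2 * pi\<^sup>2 * r * t) * (2 * V powr (1 - 1/p) * P j powr (1/p))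
         \<le> \<eta> powr (-1/2) / (2 * pi\<^sup>2 * r * t) * (2 * (V * (r * \<eta>) powr (-1/p)) * P j powr (1/p))"
        using 1 r t12 by (intro mult_left_mono mult_right_mono) auto
      also have "\<dots> = 16 / pi * (\<eta> powr (-1/2) * \<eta>) * (r * \<eta>) powr (-1/p) * P j powr (1/p)"
        using r t12 by (simp add: V_def power2_eq_square)
      also have "\<dots> = 16 / pi * (\<eta> powr (1/2) * (r * \<eta>) powr (-1/p) * P j powr (1/p))"
        unfolding h by (simp only: mult.assoc)
      also have "\<dots> \<le> 32 * (\<eta> powr (1/2) * (r * \<eta>) powr (-1/p) * P j powr (1/p))"
        using pi_gt3 by (intro mult_right_mono) (auto simp: field_simps)
      finally show "\<eta> powr (-1/2) / (2 * pi\<^sup>2 * r * t) * (2 * V powr (1 - 1/p) * P j powr (1/p))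
        \<le> 32 * \<eta> powr (1/2) * (r * \<eta>) powr (-1/p) * P j powr (1/p)"
        by (simp only: mult.assoc)
    qed
    finally show ?thesis unfolding \<eta>_def .
  qed
  then have "(\<Sum>j. ennreal (((1/2)^j) powr (-1/2) / (2 * pi\<^sup>2 * r * t)) *
      (\<integral>\<^sup>+y. ennreal (norm (f y)) * indicator (annuli r t ((1/2)^j)) y \<partial>lebesgue)) \<le>
     (\<Sum>j. ennreal (32 * ((1/2)^j) powr (1/2) * (r * (1/2)^j) powr (-1/p) * P j powr (1/p)))"
    by (intro suminf_le) auto
  with abs_circ_avg_le_dyadic[OF f x, of t] t12
  show "abs_circ_avg f t x \<le> (\<Sum>j. ennreal (32 * ((1/2)^j) powr (1/2) * (norm x * (1/2)^j) powr (-1/p) * P j powr (1/p)))"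
    unfolding r_def by (meson order.trans less_le_trans zero_less_one)
qed

lemma powr_half_power: "((1/2::real)^j) powr e = ((1/2) powr e) ^ j"
  by (simp add: powr_realpow[symmetric] powr_powr mult.commute)

lemma summable_half_power_powr: "e > 0 \<Longrightarrow> summable (\<lambda>j. ((1/2::real)^j) powr e)"
  unfolding powr_half_power by (intro summable_geometric) (simp add: powr01_less_one)

text \<open>A weighted substitute for Minkowski's inequality: each term is bounded by the whole
  weighted sum s, so \<open>z j\<close> \<le> 2^(-j \<epsilon>) s^(1/q), and a geometric series
  remains. The price is the weight 2^(j \<epsilon> q).\<close>

lemma ennreal_powr_suminf_le:
  fixes z :: "nat \<Rightarrow> real"
  assumes z: "\<And>j. z j \<ge> 0" and e: "\<epsilon> > 0" and q: "q > 0"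
  shows "ennreal_powr (\<Sum>j. ennreal (z j)) q \<le> ennreal ((\<Sum>j. ((1/2)^j) powr \<epsilon>) powr q) * (\<Sum>j. ennreal (((1/2)^j) powr (-\<epsilon>*q) * z j powr q))"
proof (cases "(\<Sum>j. ennreal (((1/2)^j) powr (-\<epsilon>*q) * z j powr q))")
  case top
  have "(\<Sum>j. ((1/2::real)^j) powr \<epsilon>) > 0"
    by (intro suminf_pos summable_half_power_powr e) auto
  then show ?thesis unfolding top by (simp add: ennreal_mult_top)
next
  case (real s)
  have le: "z j \<le> ((1/2)^j) powr \<epsilon> * s powr (1/q)" for j
  proof -
    have "ennreal (((1/2)^j) powr (-\<epsilon>*q) * z j powr q) \<le> ennreal s"
      unfolding real(2)[symmetric]
      using sum_le_suminf[of "\<lambda>j. ennreal (((1/2)^j) powr (-\<epsilon>*q) * z j powr q)" "{j}"]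
      by (simp only: sum.insert sum.empty finite.intros empty_iff not_False_eq_True add_0_right summableI zero_le)
    then have "((1/2)^j) powr (-\<epsilon>*q) * z j powr q \<le> s"
      using real(1) by simp
    then have "(((1/2)^j) powr (-\<epsilon>*q) * z j powr q) powr (1/q) \<le> s powr (1/q)"
      using q by (intro powr_mono2) auto
    also have "(((1/2)^j) powr (-\<epsilon>*q) * z j powr q) powr (1/q) = ((1/2)^j) powr (-\<epsilon>) * z j"
      using q z[of j] by (simp add: powr_mult powr_powr)
    finally have "((1/2)^j) powr \<epsilon> * (((1/2)^j) powr (-\<epsilon>) * z j) \<le> ((1/2)^j) powr \<epsilon> * s powr (1/q)"
      by (intro mult_left_mono) auto
    moreover have "((1/2::real)^j) powr \<epsilon> * ((1/2)^j) powr (-\<epsilon>) = 1"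
      by (simp add: powr_add[symmetric])
    ultimately show ?thesis by (simp add: mult.assoc[symmetric])
  qed
  define S where "S = (\<Sum>j. ((1/2::real)^j) powr \<epsilon>)"
  have "S \<ge> 0" unfolding S_def by (intro suminf_nonneg summable_half_power_powr e) auto
  have "(\<Sum>j. ennreal (z j)) \<le> (\<Sum>j. ennreal (((1/2)^j) powr \<epsilon> * s powr (1/q)))"
    by (intro suminf_le ennreal_leI le) auto
  also have "\<dots> = ennreal (\<Sum>j. ((1/2)^j) powr \<epsilon> * s powr (1/q))"
    by (intro suminf_ennreal2 summable_mult2 summable_half_power_powr e) auto
  also have "(\<Sum>j. ((1/2)^j) powr \<epsilon> * s powr (1/q)) = S * s powr (1/q)"
    unfolding S_def by (intro suminf_mult2[symmetric] summable_half_power_powr e)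
  finally have "ennreal_powr (\<Sum>j. ennreal (z j)) q \<le> ennreal_powr (ennreal (S * s powr (1/q))) q"
    using q by (intro ennreal_powr_mono) auto
  also have "\<dots> = ennreal ((S * s powr (1/q)) powr q)"
    using \<open>S \<ge> 0\<close> by (intro ennreal_powr_ennreal) auto
  also have "(S * s powr (1/q)) powr q = S powr q * s"
    using \<open>S \<ge> 0\<close> real q by (simp add: powr_mult powr_powr)
  also have "ennreal (S powr q * s) = ennreal (S powr q) * ennreal s"
    using real by (intro ennreal_mult) auto
  finally show ?thesis unfolding real S_def .
qed

text \<open>Tonelli moves the integral over x inside, where \<open>H\<close> bounds the weighted
  mass of all x whose annuli reach a given y.\<close>

lemma nn_integral_suminf_near_set_swap:
  fixes g :: "real^2 \<Rightarrow> ennreal" and w :: "nat \<Rightarrow> real^2 \<Rightarrow> ennreal"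
  assumes [measurable]: "g \<in> borel_measurable borel" "\<And>j. w j \<in> borel_measurable borel"
    and H: "\<And>y. (\<Sum>j. \<integral>\<^sup>+x. w j x * indicator (near_set E j x) y \<partial>lborel) \<le> B"
  shows "(\<integral>\<^sup>+x. (\<Sum>j. w j x * (\<integral>\<^sup>+y. g y * indicator (near_set E j x) y \<partial>lborel)) \<partial>lborel) \<le> B * (\<integral>\<^sup>+y. g y \<partial>lborel)"
proof -
  define k where "k j x y = w j x * (g y * indicator (near_set E j x) y)" for j and x y :: "real^2"
  have [measurable]: "(\<lambda>(x, y). k j x y) \<in> borel_measurable (borel \<Otimes>\<^sub>M borel)" for j
  proof -
    have "(\<lambda>(x, y). k j x y) = (\<lambda>z. w j (fst z) * (g (snd z) * indicator {(x, y). y \<in> near_set E j x} z))"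
      by (auto simp: k_def indicator_def fun_eq_iff)
    then show ?thesis by simp
  qed
  have [measurable]: "(\<lambda>(x, y). k j x y) \<in> borel_measurable (lborel \<Otimes>\<^sub>M lborel)" for j
    by (subst measurable_cong_sets[OF sets_pair_measure_cong[OF sets_lborel sets_lborel] refl]) measurable
  have "(\<integral>\<^sup>+x. (\<Sum>j. w j x * (\<integral>\<^sup>+y. g y * indicator (near_set E j x) y \<partial>lborel)) \<partial>lborel)
      = (\<integral>\<^sup>+x. (\<Sum>j. \<integral>\<^sup>+y. k j x y \<partial>lborel) \<partial>lborel)"
    unfolding k_def by (intro nn_integral_cong suminf_cong nn_integral_cmult[symmetric]) measurable
  also have "\<dots> = (\<Sum>j. \<integral>\<^sup>+x. \<integral>\<^sup>+y. k j x y \<partial>lborel \<partial>lborel)"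
    by (intro nn_integral_suminf) measurable
  also have "\<dots> = (\<Sum>j. \<integral>\<^sup>+y. \<integral>\<^sup>+x. k j x y \<partial>lborel \<partial>lborel)"
    by (intro suminf_cong lborel_pair.Fubini'[symmetric]) measurable
  also have "\<dots> = (\<integral>\<^sup>+y. (\<Sum>j. \<integral>\<^sup>+x. k j x y \<partial>lborel) \<partial>lborel)"
    by (intro nn_integral_suminf[symmetric] lborel.borel_measurable_nn_integral) measurable
  also have "\<dots> \<le> (\<integral>\<^sup>+y. B * g y \<partial>lborel)"
  proof (rule nn_integral_mono)
    fix y :: "real^2"
    have ind: "(\<lambda>x. indicator (near_set E j x) y :: ennreal) \<in> borel_measurable borel" for j
    proof -
      have "(\<lambda>x. indicator (near_set E j x) y :: ennreal) = (\<lambda>x. indicator {(x, y). y \<in> near_set E j x} (x, y))"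
        by (auto simp: indicator_def fun_eq_iff)
      then show ?thesis by simp
    qed
    have "(\<integral>\<^sup>+x. k j x y \<partial>lborel) = g y * (\<integral>\<^sup>+x. w j x * indicator (near_set E j x) y \<partial>lborel)" for j
    proof -
      have "(\<integral>\<^sup>+x. k j x y \<partial>lborel) = (\<integral>\<^sup>+x. g y * (w j x * indicator (near_set E j x) y) \<partial>lborel)"
        by (simp add: k_def mult.left_commute)
      also have "\<dots> = g y * (\<integral>\<^sup>+x. w j x * indicator (near_set E j x) y \<partial>lborel)"
        using ind by (intro nn_integral_cmult) auto
      finally show ?thesis .
    qed
    then have "(\<Sum>j. \<integral>\<^sup>+x. k j x y \<partial>lborel) = g y * (\<Sum>j. \<integral>\<^sup>+x. w j x * indicator (near_set E j x) y \<partial>lborel)"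
      by simp
    also have "\<dots> \<le> g y * B"
      by (intro mult_left_mono H) auto
    finally show "(\<Sum>j. \<integral>\<^sup>+x. k j x y \<partial>lborel) \<le> B * g y"
      by (simp add: mult.commute)
  qed
  also have "\<dots> = B * (\<integral>\<^sup>+y. g y \<partial>lborel)"
    by (rule nn_integral_cmult) simp
  finally show ?thesis .
qed

text \<open>The kernel hypothesis is a Schur-type test: since \<open>q > p\<close>, the \<open>q/p\<close>-th power of the local
  integral of \<open>|f|\<^sup>p\<close> is at most the integral itself times a power of \<open>\<parallel>f\<parallel>\<^sub>p\<close>, and Tonelli applies.\<close>
lemma max_bounded_if_kernel_bound:
  assumes E: "E \<subseteq> {1..2}" and p: "1 \<le> p" "p < q" and e: "\<epsilon> > 0" and B: "B \<ge> 0"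
    and H: "\<And>y. (\<Sum>j. \<integral>\<^sup>+x. ennreal (((1/2)^j) powr (q/2 - \<epsilon> * q) * (norm x * (1/2)^j) powr (-q/p)) *
        indicator (near_set E j x) y \<partial>lborel) \<le> ennreal B"
  shows "max_bounded E (ennreal p) (ennreal q)"
proof -
  define S where "S = (\<Sum>j. ((1/2::real)^j) powr \<epsilon>)"
  define K where "K = S powr q * 32 powr q * B"
  have K: "K \<ge> 0" using B by (simp add: K_def)
  have "Lp_norm q (max_fun E f) \<le> ennreal (K powr (1/q)) * Lp_norm p (\<lambda>x. ennreal (norm (f x)))"
    if f': "f \<in> Lp_rad p" for f
  proof -
    have f: "f \<in> borel_measurable lebesgue" "radial f" and fin: "Lp_norm p (\<lambda>x. ennreal (norm (f x))) < \<infinity>"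
      using f' by (auto simp: Lp_rad_def)
    define X where "X = (\<integral>\<^sup>+y. ennreal (norm (f y) powr p) \<partial>lebesgue)"
    have pn: "Lp_norm p (\<lambda>x. ennreal (norm (f x))) = ennreal_powr X (1/p)"
      using p by (simp add: Lp_norm_def X_def ennreal_powr_ennreal)
    with fin have "X \<noteq> \<infinity>" by (auto simp: ennreal_powr_def split: if_splits)
    then obtain I where I: "X = ennreal I" "I \<ge> 0"
      by (cases X) auto
    define Q where "Q j x = (\<integral>\<^sup>+y. ennreal (norm (f y) powr p) * indicator (near_set E j x) y \<partial>lebesgue)" for j x
    have QX: "Q j x \<le> ennreal I" for j x
      unfolding I(1)[symmetric] Q_def X_def by (intro nn_integral_mono) (auto simp: indicator_def)
    define P where "P j x = enn2real (Q j x)" for j x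
    have QP: "Q j x = ennreal (P j x)" for j x
      unfolding P_def using QX[of j x] by (intro ennreal_enn2real[symmetric]) (auto simp: less_top[symmetric] top_unique)
    have P: "0 \<le> P j x" "P j x \<le> I" for j x
      using QX[of j x] I(2) unfolding QP by (auto simp: P_def)
    define w where "w j x = ((1/2)^j) powr (q/2 - \<epsilon> * q) * (norm x * (1/2)^j) powr (-q/p)" for j and x :: "real^2"
    define D where "D = S powr q * 32 powr q * I powr (q/p - 1)"
    have D: "D \<ge> 0" by (simp add: D_def)
    have pt: "ennreal_powr (max_fun E f x) q \<le> ennreal D * (\<Sum>j. ennreal (w j x) * Q j x)" if x: "x \<noteq> 0" for x
    proof -
      define z where "z j = 32 * ((1/2)^j) powr (1/2) * (norm x * (1/2)^j) powr (-1/p) * P j x powr (1/p)" for j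
      have "max_fun E f x \<le> (\<Sum>j. ennreal (z j))"
        unfolding z_def using P QP p by (intro max_fun_le_dyadic E f x) (auto simp: Q_def)
      then have "ennreal_powr (max_fun E f x) q \<le> ennreal_powr (\<Sum>j. ennreal (z j)) q"
        using p by (intro ennreal_powr_mono) auto
      also have "\<dots> \<le> ennreal (S powr q) * (\<Sum>j. ennreal (((1/2)^j) powr (-\<epsilon>*q) * z j powr q))"
        unfolding S_def using p by (intro ennreal_powr_suminf_le e) (auto simp: z_def)
      also have "\<dots> \<le> ennreal (S powr q) * (\<Sum>j. ennreal (32 powr q * I powr (q/p - 1)) * (ennreal (w j x) * Q j x))"
      proof (intro mult_left_mono suminf_le)
        fix j
        have "((1/2)^j) powr (-\<epsilon>*q) * z j powr q =
          32 powr q * (((1/2)^j) powr (-\<epsilon>*q) * ((1/2)^j) powr (q/2)) * (norm x * (1/2)^j) powr (-q/p) * P j x powr (q/p)"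
          using P(1)[of j x] by (simp add: z_def powr_mult powr_powr)
        also have "((1/2::real)^j) powr (-\<epsilon>*q) * ((1/2)^j) powr (q/2) = ((1/2)^j) powr (q/2 - \<epsilon>*q)"
          by (simp add: powr_add[symmetric])
        also have "32 powr q * ((1/2)^j) powr (q/2 - \<epsilon>*q) * (norm x * (1/2)^j) powr (-q/p) * P j x powr (q/p)
          = 32 powr q * w j x * P j x powr (q/p)"
          by (simp add: w_def)
        also have "P j x powr (q/p) = P j x powr (q/p - 1) * P j x"
          using P(1)[of j x] powr_add[of "P j x" "q/p - 1" 1] by simp
        also have "32 powr q * w j x * (P j x powr (q/p - 1) * P j x) \<le> 32 powr q * w j x * (I powr (q/p - 1) * P j x)"
          using P p by (intro mult_left_mono mult_right_mono powr_mono2) (auto simp: w_def)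
        also have "\<dots> = (32 powr q * I powr (q/p - 1)) * (w j x * P j x)"
          by simp
        finally have "ennreal (((1/2)^j) powr (-\<epsilon>*q) * z j powr q) \<le> ennreal ((32 powr q * I powr (q/p - 1)) * (w j x * P j x))"
          by (rule ennreal_leI)
        also have "\<dots> = ennreal (32 powr q * I powr (q/p - 1)) * (ennreal (w j x) * Q j x)"
          unfolding QP by (subst ennreal_mult', simp, subst ennreal_mult'[of "w j x"], simp add: w_def, rule refl)
        finally show "ennreal (((1/2)^j) powr (-\<epsilon>*q) * z j powr q) \<le> ennreal (32 powr q * I powr (q/p - 1)) * (ennreal (w j x) * Q j x)" .
      qed auto
      also have "\<dots> = ennreal D * (\<Sum>j. ennreal (w j x) * Q j x)"
        unfolding D_def mult.assoc[of "S powr q"]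
        by (subst ennreal_suminf_cmult, subst ennreal_mult'[of "S powr q"], simp) (simp only: mult.assoc)
      finally show ?thesis .
    qed
    have "(\<lambda>y. ennreal (norm (f y) powr p)) \<in> borel_measurable lebesgue"
      using f by simp
    \<comment> \<open>\<open>f\<close> is only Lebesgue measurable; Tonelli needs a Borel version of
      |f|^p.\<close>
    then obtain g where g [measurable]: "g \<in> borel_measurable lborel" and gae: "AE y in lborel. ennreal (norm (f y) powr p) = g y"
      using completion_ex_borel_measurable by blast
    have Qg: "Q j x = (\<integral>\<^sup>+y. g y * indicator (near_set E j x) y \<partial>lborel)" for j x
      unfolding Q_def nn_integral_completion by (rule nn_integral_cong_AE) (use gae in \<open>auto elim!: eventually_mono\<close>)
    have Xg: "(\<integral>\<^sup>+y. g y \<partial>lborel) = ennreal I"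
      unfolding I(1)[symmetric] X_def nn_integral_completion by (rule nn_integral_cong_AE) (use gae in \<open>auto elim!: eventually_mono\<close>)
    have [measurable]: "(\<lambda>x. ennreal (w j x)) \<in> borel_measurable borel" for j
      unfolding w_def by measurable
    have [measurable]: "Q j \<in> borel_measurable borel" for j
    proof -
      have "(\<lambda>(x, y). g y * indicator (near_set E j x) y) = (\<lambda>z. g (snd z) * indicator {(x, y). y \<in> near_set E j x} z)"
        by (auto simp: indicator_def fun_eq_iff)
      then have "(\<lambda>(x, y). g y * indicator (near_set E j x) y) \<in> borel_measurable (borel \<Otimes>\<^sub>M lborel)"
        using g by (simp add: measurable_cong_sets[OF sets_pair_measure_cong[OF refl sets_lborel] refl])
      then show ?thesis unfolding Qg by (rule lborel.borel_measurable_nn_integral)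
    qed
    \<comment> \<open>The maximal function may fail to be measurable. Only monotonicity of the
      integral is applied to it, and the majorant is Borel.\<close>
    have "(\<integral>\<^sup>+x. ennreal_powr (max_fun E f x) q \<partial>lebesgue) \<le> (\<integral>\<^sup>+x. ennreal D * (\<Sum>j. ennreal (w j x) * Q j x) \<partial>lborel)"
      unfolding nn_integral_completion
      using pt AE_lborel_singleton[of "0 :: real^2"] by (intro nn_integral_mono_AE) (auto elim!: eventually_mono)
    also have "\<dots> = ennreal D * (\<integral>\<^sup>+x. (\<Sum>j. ennreal (w j x) * Q j x) \<partial>lborel)"
      by (intro nn_integral_cmult) measurable
    also have "\<dots> \<le> ennreal D * (ennreal B * ennreal I)"
      unfolding Qg Xg[symmetric] using g H
      by (intro mult_left_mono nn_integral_suminf_near_set_swap) (auto simp: w_def)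
    also have "\<dots> = ennreal (K * I powr (q/p))"
    proof -
      have "I powr (q/p) = I powr (q/p - 1) * I"
        using I powr_add[of I "q/p - 1" 1] by simp
      then have "K * I powr (q/p) = D * (B * I)" by (simp add: K_def D_def)
      then show ?thesis using D B I by (simp add: ennreal_mult)
    qed
    finally have "ennreal_powr (\<integral>\<^sup>+x. ennreal_powr (max_fun E f x) q \<partial>lebesgue) (1/q) \<le> ennreal_powr (ennreal (K * I powr (q/p))) (1/q)"
      using p by (intro ennreal_powr_mono) auto
    also have "\<dots> = ennreal (K powr (1/q) * I powr (1/p))"
      using p K I by (subst ennreal_powr_ennreal) (auto simp: powr_mult powr_powr)
    also have "\<dots> = ennreal (K powr (1/q)) * ennreal_powr X (1/p)"
      unfolding I(1) using I(2) by (simp add: ennreal_powr_ennreal ennreal_mult)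
    finally show ?thesis
      using p unfolding pn by (simp add: Lp_norm_def)
  qed
  then show ?thesis unfolding max_bounded_def by blast
qed

section \<open>Covering numbers and dimensions\<close>

lemma cover_num_le_card:
  assumes "finite A" "F \<subseteq> (\<Union>a\<in>A. {a..a+\<delta>})"
  shows "cover_num F \<delta> \<le> card A"
proof -
  have "cover_num F \<delta> \<le> card ((\<lambda>a. {a..a+\<delta>}) ` A)"
    unfolding cover_num_def by (rule Least_le) (use assms in blast)
  also have "\<dots> \<le> card A"
    using assms by (intro card_image_le)
  finally show ?thesis .
qed

lemma real_interval_cover:
  fixes u l \<delta> :: real
  assumes "\<delta> > 0" "l \<ge> 0"
  obtains A where "finite A" "real (card A) \<le> 1 + l / \<delta>" "{u..u+l} \<subseteq> (\<Union>a\<in>A. {a..a+\<delta>})"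
proof -
  define m where "m = nat \<lfloor>l / \<delta>\<rfloor>"
  have m: "real m \<le> l / \<delta>" using assms by (simp add: m_def)
  show ?thesis
  proof (rule that[of "(\<lambda>i. u + real i * \<delta>) ` {..m}"])
    have "card ((\<lambda>i. u + real i * \<delta>) ` {..m}) \<le> card {..m}" by (rule card_image_le) simp
    then show "real (card ((\<lambda>i. u + real i * \<delta>) ` {..m})) \<le> 1 + l / \<delta>" using m by simp
    show "{u..u+l} \<subseteq> (\<Union>a\<in>(\<lambda>i. u + real i * \<delta>) ` {..m}. {a..a+\<delta>})"
    proof
      fix z assume z: "z \<in> {u..u+l}"
      define i where "i = nat \<lfloor>(z - u) / \<delta>\<rfloor>"
      have "(z - u) / \<delta> \<le> l / \<delta>" using z assms by (intro divide_right_mono) auto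
      then have "i \<le> m" unfolding i_def m_def by (intro nat_mono floor_mono)
      moreover have "real i \<le> (z - u) / \<delta>" "(z - u) / \<delta> < real i + 1"
        using z assms by (simp_all add: i_def)
      then have "u + real i * \<delta> \<le> z" "z \<le> u + real i * \<delta> + \<delta>"
        using assms by (auto simp: field_simps)
      ultimately show "z \<in> (\<Union>a\<in>(\<lambda>i. u + real i * \<delta>) ` {..m}. {a..a+\<delta>})" by auto
    qed
  qed simp
qed

lemma cover_num_le:
  assumes "\<delta> > 0" "l \<ge> 0" "F \<subseteq> {u..u+l}"
  shows "real (cover_num F \<delta>) \<le> 1 + l / \<delta>"
proof -
  obtain A where A: "finite A" "real (card A) \<le> 1 + l / \<delta>" "{u..u+l} \<subseteq> (\<Union>a\<in>A. {a..a+\<delta>})"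
    using real_interval_cover assms by metis
  then have "cover_num F \<delta> \<le> card A"
    using assms by (intro cover_num_le_card) auto
  with A show ?thesis by linarith
qed

text \<open>\<open>cover_num\<close> is a \<open>LEAST\<close>, which is informative only once some
  finite cover exists; boundedness provides one. The set \<open>A\<close> of left endpoints is
  easier to handle than the family of intervals.\<close>

lemma cover_num_attained:
  assumes "\<delta> > 0" "bounded F"
  obtains A where "finite A" "card A \<le> cover_num F \<delta>" "F \<subseteq> (\<Union>a\<in>A. {a..a+\<delta>})"
proof -
  obtain b where b: "\<And>x. x \<in> F \<Longrightarrow> \<bar>x\<bar> \<le> b" using assms(2) by (auto simp: bounded_iff)
  have F: "F \<subseteq> {-\<bar>b\<bar>..-\<bar>b\<bar> + 2*\<bar>b\<bar>}"
  proof
    fix x assume "x \<in> F"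
    then have "\<bar>x\<bar> \<le> \<bar>b\<bar>" using b[of x] by linarith
    then show "x \<in> {-\<bar>b\<bar>..-\<bar>b\<bar> + 2*\<bar>b\<bar>}" unfolding abs_le_iff by auto
  qed
  obtain A0 where A0: "finite A0" "{-\<bar>b\<bar>..-\<bar>b\<bar> + 2*\<bar>b\<bar>} \<subseteq> (\<Union>a\<in>A0. {a..a+\<delta>})"
  proof (rule real_interval_cover)
    show "\<delta> > 0" "2*\<bar>b\<bar> \<ge> 0" using assms by auto
  qed
  have "\<exists>n \<I>. finite \<I> \<and> card \<I> = n \<and> (\<forall>I\<in>\<I>. \<exists>a. I = {a..a+\<delta>}) \<and> F \<subseteq> \<Union>\<I>"
    using A0 F by (intro exI[of _ "card ((\<lambda>a. {a..a+\<delta>}) ` A0)"] exI[of _ "(\<lambda>a. {a..a+\<delta>}) ` A0"]) auto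
  from LeastI_ex[OF this] obtain \<I> where I: "finite \<I>" "card \<I> = cover_num F \<delta>" "\<forall>I\<in>\<I>. \<exists>a. I = {a..a+\<delta>}" "F \<subseteq> \<Union>\<I>"
    unfolding cover_num_def by blast
  from I(3) obtain a where a: "\<And>I. I \<in> \<I> \<Longrightarrow> I = {a I..a I + \<delta>}" by metis
  show ?thesis
  proof (rule that[of "a ` \<I>"])
    show "card (a ` \<I>) \<le> cover_num F \<delta>" using I card_image_le by metis
    show "F \<subseteq> (\<Union>a\<in>a ` \<I>. {a..a+\<delta>})" using I(4) a by blast
  qed (use I in auto)
qed

lemma cover_num_mono:
  assumes "\<delta> > 0" "bounded G" "F \<subseteq> G"
  shows "cover_num F \<delta> \<le> cover_num G \<delta>"
proof -
  obtain A where "finite A" "card A \<le> cover_num G \<delta>" "G \<subseteq> (\<Union>a\<in>A. {a..a+\<delta>})"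
    using cover_num_attained assms by metis
  then show ?thesis using cover_num_le_card[of A F \<delta>] assms by force
qed

lemma cover_num_empty: "cover_num {} \<delta> = 0"
  using cover_num_le_card[of "{}" "{}" \<delta>] by simp

lemma cover_num_pos:
  assumes "\<delta> > 0" "bounded F" "F \<noteq> {}"
  shows "cover_num F \<delta> \<ge> 1"
proof -
  obtain A where A: "finite A" "card A \<le> cover_num F \<delta>" "F \<subseteq> (\<Union>a\<in>A. {a..a+\<delta>})"
    using cover_num_attained assms by metis
  then have "A \<noteq> {}" using assms by auto
  then have "card A \<ge> 1" using A by (simp add: Suc_leI card_gt_0_iff)
  then show ?thesis using A by linarith
qed

lemma bounded_subset_12: "E \<subseteq> {1..2::real} \<Longrightarrow> bounded E"
  by (rule bounded_subset[OF bounded_closed_interval])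

lemma cover_num_12_le:
  assumes "E \<subseteq> {1..2}" "0 < \<delta>" "\<delta> \<le> 1"
  shows "real (cover_num E \<delta>) \<le> 2 / \<delta>"
proof -
  have "real (cover_num E \<delta>) \<le> 1 + 1 / \<delta>"
    using assms by (intro cover_num_le[where u = 1]) auto
  also have "\<dots> \<le> 2 / \<delta>" using assms by (simp add: field_simps)
  finally show ?thesis .
qed

section \<open>Areas of neighbourhoods of circles\<close>

text \<open>hi^2 - lo^2 = (hi - lo)(hi + lo), at most 2w times 2R. The factor \<open>R\<close> is
  the point: it is the gain for annuli inside a small disc. \<open>lo\<close> is cut off at 0 so
  that squaring is monotone.\<close>

lemma emeasure_annulus_le:
  assumes "R \<ge> 0" "w \<ge> 0" and S: "S \<subseteq> {x::real^2. norm x \<le> R \<and> \<bar>norm x - c\<bar> \<le> w}"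
  shows "emeasure lborel S \<le> ennreal (4 * pi * R * w)"
proof -
  define lo hi where "lo = max 0 (c - w)" and "hi = min R (c + w)"
  have sub: "S \<subseteq> {x::real^2. (norm x)\<^sup>2 \<in> {lo\<^sup>2..hi\<^sup>2}}"
  proof
    fix x assume "x \<in> S"
    then have "lo \<le> norm x" "norm x \<le> hi" using S by (auto simp: lo_def hi_def)
    moreover have "0 \<le> lo" by (simp add: lo_def)
    ultimately show "x \<in> {x. (norm x)\<^sup>2 \<in> {lo\<^sup>2..hi\<^sup>2}}" by (simp add: power_mono)
  qed
  show ?thesis
  proof (cases "lo \<le> hi")
    case False
    have "x \<notin> S" for x
    proof
      assume "x \<in> S"
      then have "lo \<le> norm x" "norm x \<le> hi" using S by (auto simp: lo_def hi_def)
      with False show False by simp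
    qed
    then have "S = {}" by blast
    then show ?thesis by simp
  next
    case True
    have "emeasure lborel S \<le> emeasure lborel {x::real^2. (norm x)\<^sup>2 \<in> {lo\<^sup>2..hi\<^sup>2}}"
      by (rule emeasure_mono[OF sub]) measurable
    also have "\<dots> = ennreal pi * emeasure lborel ({lo\<^sup>2..hi\<^sup>2} \<inter> {0..})"
      by (rule emeasure_norm_power2_vimage) simp
    also have "\<dots> \<le> ennreal pi * emeasure lborel {lo\<^sup>2..hi\<^sup>2}"
      by (intro mult_left_mono emeasure_mono) auto
    also have "\<dots> = ennreal (pi * (hi\<^sup>2 - lo\<^sup>2))"
      using True power_mono[of lo hi 2] by (simp add: ennreal_mult lo_def)
    also have "\<dots> \<le> ennreal (4 * pi * R * w)"
    proof (rule ennreal_leI)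
      have "hi\<^sup>2 - lo\<^sup>2 = (hi - lo) * (hi + lo)" by (simp add: power2_eq_square algebra_simps)
      also have "\<dots> \<le> (2 * w) * (2 * R)"
        using True assms by (intro mult_mono) (auto simp: lo_def hi_def)
      finally show "pi * (hi\<^sup>2 - lo\<^sup>2) \<le> 4 * pi * R * w"
        using mult_left_mono[of "hi\<^sup>2 - lo\<^sup>2" "(2 * w) * (2 * R)" pi] by (simp add: algebra_simps)
    qed
    finally show ?thesis .
  qed
qed

text \<open>For \<open>t\<close> in a covering interval that starts at \<open>a\<close>, |x| is
  within w + \<delta> of s - a, s + a or a - s, according to whether |x| + t, |x| - t or t - |x| is
  near s. Three annuli per interval give the constant 12 = 3 * 4.\<close>

lemma emeasure_near_circles_le:
  assumes R: "R \<ge> 0" and w: "w \<ge> 0" and d: "\<delta> > 0" and F: "bounded F"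
    and S: "S \<subseteq> {x::real^2. norm x \<le> R \<and> (\<exists>t\<in>F. \<bar>norm x + t - s\<bar> \<le> w \<or> \<bar>\<bar>norm x - t\<bar> - s\<bar> \<le> w)}"
  shows "emeasure lborel S \<le> ennreal (12 * pi * R * (w + \<delta>) * cover_num F \<delta>)"
proof -
  obtain A where A: "finite A" "card A \<le> cover_num F \<delta>" "F \<subseteq> (\<Union>a\<in>A. {a..a+\<delta>})"
    using cover_num_attained d F by metis
  define T where "T a = {x::real^2. norm x \<le> R \<and> \<bar>norm x - (s - a)\<bar> \<le> w + \<delta>} \<union>
     ({x. norm x \<le> R \<and> \<bar>norm x - (s + a)\<bar> \<le> w + \<delta>} \<union> {x. norm x \<le> R \<and> \<bar>norm x - (a - s)\<bar> \<le> w + \<delta>})" for a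
  have meas [measurable]: "{x::real^2. norm x \<le> R \<and> \<bar>norm x - c\<bar> \<le> w + \<delta>} \<in> sets borel" for c
    by measurable
  have Tm [measurable]: "T a \<in> sets borel" for a unfolding T_def by (intro sets.Un meas)
  have T: "emeasure lborel (T a) \<le> ennreal (12 * pi * R * (w + \<delta>))" for a
  proof -
    have one: "emeasure lborel {x::real^2. norm x \<le> R \<and> \<bar>norm x - c\<bar> \<le> w + \<delta>} \<le> ennreal (4 * pi * R * (w + \<delta>))" for c
      using R w d by (intro emeasure_annulus_le) auto
    have "emeasure lborel (T a) \<le> emeasure lborel {x::real^2. norm x \<le> R \<and> \<bar>norm x - (s - a)\<bar> \<le> w + \<delta>} +
      (emeasure lborel {x::real^2. norm x \<le> R \<and> \<bar>norm x - (s + a)\<bar> \<le> w + \<delta>} +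
       emeasure lborel {x::real^2. norm x \<le> R \<and> \<bar>norm x - (a - s)\<bar> \<le> w + \<delta>})"
      unfolding T_def by (rule order.trans[OF emeasure_subadditive add_left_mono[OF emeasure_subadditive]])
        (auto intro!: meas sets.Un)
    also have "\<dots> \<le> ennreal (4 * pi * R * (w + \<delta>)) + (ennreal (4 * pi * R * (w + \<delta>)) + ennreal (4 * pi * R * (w + \<delta>)))"
      by (intro add_mono one)
    also have "\<dots> = ennreal (4 * pi * R * (w + \<delta>) + (4 * pi * R * (w + \<delta>) + 4 * pi * R * (w + \<delta>)))"
    proof -
      have "4 * pi * R * (w + \<delta>) \<ge> 0" using R w d by simp
      then show ?thesis by (simp only: ennreal_plus add_nonneg_nonneg)
    qed
    also have "4 * pi * R * (w + \<delta>) + (4 * pi * R * (w + \<delta>) + 4 * pi * R * (w + \<delta>)) = 12 * pi * R * (w + \<delta>)"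
      by simp
    finally show ?thesis .
  qed
  have "S \<subseteq> (\<Union>a\<in>A. T a)"
  proof
    fix x assume "x \<in> S"
    then obtain t where t: "t \<in> F" "norm x \<le> R" "\<bar>norm x + t - s\<bar> \<le> w \<or> \<bar>\<bar>norm x - t\<bar> - s\<bar> \<le> w"
      using S by auto
    then obtain a where a: "a \<in> A" "a \<le> t" "t \<le> a + \<delta>" using A(3) by auto
    then have "\<bar>norm x - (s - a)\<bar> \<le> w + \<delta> \<or> \<bar>norm x - (s + a)\<bar> \<le> w + \<delta> \<or> \<bar>norm x - (a - s)\<bar> \<le> w + \<delta>"
      using t(3) by linarith
    with a t show "x \<in> (\<Union>a\<in>A. T a)" by (auto simp: T_def)
  qed
  then have "emeasure lborel S \<le> emeasure lborel (\<Union>a\<in>A. T a)"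
    using A(1) by (intro emeasure_mono) auto
  also have "\<dots> \<le> (\<Sum>a\<in>A. emeasure lborel (T a))"
    using A(1) by (intro emeasure_subadditive_finite) auto
  also have "\<dots> \<le> (\<Sum>a\<in>A. ennreal (12 * pi * R * (w + \<delta>)))"
    by (intro sum_mono T)
  also have "\<dots> = ennreal (real (card A) * (12 * pi * R * (w + \<delta>)))"
    using R w d by (simp add: ennreal_mult ennreal_of_nat_eq_real_of_nat)
  also have "\<dots> \<le> ennreal (12 * pi * R * (w + \<delta>) * cover_num F \<delta>)"
  proof (rule ennreal_leI)
    have "real (card A) * (12 * pi * R * (w + \<delta>)) \<le> real (cover_num F \<delta>) * (12 * pi * R * (w + \<delta>))"
      using A R w d by (intro mult_right_mono) auto
    then show "real (card A) * (12 * pi * R * (w + \<delta>)) \<le> 12 * pi * R * (w + \<delta>) * cover_num F \<delta>"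
      by (simp only: mult.commute)
  qed
  finally show ?thesis .
qed

section \<open>Minkowski dimension and power bounds\<close>

text \<open>Covers \<open>ln c\<close> and its negative, so multiplicative constants disappear from
  the logarithmic quotient in upper and lower bounds alike.\<close>

lemma eventually_abs_ln_le:
  assumes "\<epsilon> > 0"
  shows "\<forall>\<^sub>F \<delta> in at_right 0. \<bar>ln c\<bar> \<le> \<epsilon> * ln (1 / \<delta>) \<and> \<delta> < 1 \<and> \<delta> > (0::real)"
proof -
  define d where "d = min (exp (- \<bar>ln c\<bar> / \<epsilon>)) 1"
  have "d > 0" by (simp add: d_def)
  moreover have "\<bar>ln c\<bar> \<le> \<epsilon> * ln (1 / \<delta>) \<and> \<delta> < 1 \<and> \<delta> > 0" if "0 < \<delta>" "\<delta> < d" for \<delta>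
  proof -
    have "ln \<delta> \<le> ln (exp (- \<bar>ln c\<bar> / \<epsilon>))"
      using that by (subst ln_le_cancel_iff) (auto simp: d_def)
    then have "\<bar>ln c\<bar> / \<epsilon> \<le> - ln \<delta>" by simp
    moreover have "\<delta> < 1" using that by (simp add: d_def)
    ultimately show ?thesis using that assms by (auto simp: ln_div field_simps)
  qed
  ultimately show ?thesis
    unfolding eventually_at_right_field by blast
qed

text \<open>The limit superior before \<open>real_of_ereal\<close>, which would turn an infinite
  value into 0; finiteness is proved in \<open>cover_limsup_eq\<close>.\<close>

definition cover_limsup :: "real set \<Rightarrow> ereal" where
  "cover_limsup E = Limsup (at_right 0) (\<lambda>\<delta>. ereal (ln (real (cover_num E \<delta>)) / ln (1/\<delta>)))"

lemma cover_limsup_le: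
  assumes E: "E \<subseteq> {1..2}" "E \<noteq> {}" and c: "c > 0" "d > 0"
    and N: "\<And>\<delta>. 0 < \<delta> \<Longrightarrow> \<delta> < d \<Longrightarrow> real (cover_num E \<delta>) \<le> c * \<delta> powr (-a)"
  shows "cover_limsup E \<le> ereal a"
proof (rule ereal_le_epsilon2)
  fix e :: real assume e: "0 < e"
  have "\<forall>\<^sub>F \<delta> in at_right 0. \<delta> < d" 
    using c by (auto simp: eventually_at_right_field)
  with eventually_abs_ln_le[OF e, of c]
  have "\<forall>\<^sub>F \<delta> in at_right 0. ereal (ln (real (cover_num E \<delta>)) / ln (1/\<delta>)) \<le> ereal (a + e)"
  proof eventually_elim
    case (elim \<delta>)
    then have l: "ln (1/\<delta>) > 0" by simp
    have "1 \<le> cover_num E \<delta>" using elim E by (intro cover_num_pos bounded_subset_12) auto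
    then have "ln (real (cover_num E \<delta>)) \<le> ln (c * \<delta> powr (-a))"
      using N[of \<delta>] elim c by (subst ln_le_cancel_iff) auto
    also have "\<dots> = ln c + a * ln (1/\<delta>)"
      using elim c by (simp add: ln_mult ln_powr ln_div)
    also have "\<dots> \<le> (a + e) * ln (1/\<delta>)"
      unfolding distrib_right using elim by linarith
    finally show ?case using l by (simp add: divide_le_eq)
  qed
  then have "cover_limsup E \<le> ereal (a + e)"
    unfolding cover_limsup_def by (rule Limsup_bounded)
  then show "cover_limsup E \<le> ereal a + ereal e" by simp
qed

lemma cover_limsup_nonneg:
  assumes E: "E \<subseteq> {1..2}" "E \<noteq> {}"
  shows "0 \<le> cover_limsup E"
proof -
  have "\<forall>\<^sub>F \<delta> in at_right 0. \<delta> < 1 \<and> \<delta> > (0::real)"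
    unfolding eventually_at_right_field by (intro exI[of _ 1]) auto
  then have "\<forall>\<^sub>F \<delta> in at_right 0. 0 \<le> ereal (ln (real (cover_num E \<delta>)) / ln (1/\<delta>))"
  proof eventually_elim
    case (elim \<delta>)
    have "1 \<le> cover_num E \<delta>" using elim E by (intro cover_num_pos bounded_subset_12) auto
    then show ?case using elim by auto
  qed
  then show ?thesis
    unfolding cover_limsup_def by (intro le_Limsup) auto
qed

lemma cover_limsup_eq:
  assumes E: "E \<subseteq> {1..2}" "E \<noteq> {}"
  shows "cover_limsup E = ereal (minkowski_dim E)"
proof -
  have "cover_limsup E \<le> ereal 1"
    using cover_num_12_le[OF E(1)] by (intro cover_limsup_le[where c = 2 and d = 1] E) (auto simp: powr_minus divide_inverse)
  with cover_limsup_nonneg[OF E] have "\<bar>cover_limsup E\<bar> \<noteq> \<infinity>" by auto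
  then show ?thesis
    unfolding minkowski_dim_def cover_limsup_def[symmetric] by (simp add: ereal_real)
qed

lemma minkowski_dim_le:
  assumes E: "E \<subseteq> {1..2}" "E \<noteq> {}" and c: "c > 0" "d > 0"
    and N: "\<And>\<delta>. 0 < \<delta> \<Longrightarrow> \<delta> < d \<Longrightarrow> real (cover_num E \<delta>) \<le> c * \<delta> powr (-a)"
  shows "minkowski_dim E \<le> a"
  using cover_limsup_le[OF assms] cover_limsup_eq[OF E] by simp

lemma minkowski_dim_nonneg: "E \<subseteq> {1..2} \<Longrightarrow> E \<noteq> {} \<Longrightarrow> 0 \<le> minkowski_dim E"
  using cover_limsup_nonneg cover_limsup_eq by (metis ereal_less_eq(5))

lemma minkowski_dim_le_1: "E \<subseteq> {1..2} \<Longrightarrow> E \<noteq> {} \<Longrightarrow> minkowski_dim E \<le> 1"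
  using cover_num_12_le[of E] by (intro minkowski_dim_le[where c = 2 and d = 1]) (auto simp: powr_minus divide_inverse)

lemma minkowski_dim_ge:
  assumes E: "E \<subseteq> {1..2}" "E \<noteq> {}" and c: "c > 0" "d > 0"
    and N: "\<And>\<delta>. 0 < \<delta> \<Longrightarrow> \<delta> < d \<Longrightarrow> real (cover_num E \<delta>) \<ge> c * \<delta> powr (-a)"
  shows "a \<le> minkowski_dim E"
proof (rule field_le_epsilon)
  fix e :: real assume e: "0 < e"
  have "\<forall>\<^sub>F \<delta> in at_right 0. \<delta> < d" 
    using c by (auto simp: eventually_at_right_field)
  with eventually_abs_ln_le[OF e, of c]
  have "\<forall>\<^sub>F \<delta> in at_right 0. ereal (a - e) \<le> ereal (ln (real (cover_num E \<delta>)) / ln (1/\<delta>))"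
  proof eventually_elim
    case (elim \<delta>)
    then have l: "ln (1/\<delta>) > 0" by simp
    have "(a - e) * ln (1/\<delta>) \<le> ln c + a * ln (1/\<delta>)"
      unfolding left_diff_distrib using elim by linarith
    also have "\<dots> = ln (c * \<delta> powr (-a))"
      using elim c by (simp add: ln_mult ln_powr ln_div)
    also have "\<dots> \<le> ln (real (cover_num E \<delta>))"
      using N[of \<delta>] elim c by (intro ln_mono) auto
    finally show ?case using l by (simp add: le_divide_eq)
  qed
  then have "ereal (a - e) \<le> cover_limsup E"
    unfolding cover_limsup_def by (intro le_Limsup) auto
  then show "a \<le> minkowski_dim E + e"
    unfolding cover_limsup_eq[OF E] by simp
qed

text \<open>The limit superior controls small \<delta> only. From \<open>d'\<close> on, the trivial
  bound 2 / \<delta> is at most 2 / d', which \<open>C\<close> absorbs since \<delta>^(-\<beta>)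
  \<ge> 1.\<close>

lemma cover_num_le_minkowski:
  assumes E: "E \<subseteq> {1..2}" "E \<noteq> {}" and b: "\<beta> > minkowski_dim E"
  obtains C where "C > 0" "\<And>\<delta>. 0 < \<delta> \<Longrightarrow> \<delta> \<le> 1 \<Longrightarrow> real (cover_num E \<delta>) \<le> C * \<delta> powr (-\<beta>)"
proof -
  have b0: "\<beta> > 0" using b minkowski_dim_nonneg[OF E] by simp
  have "cover_limsup E < ereal \<beta>"
    using b cover_limsup_eq[OF E] by simp
  then have "\<forall>\<^sub>F \<delta> in at_right 0. ereal (ln (real (cover_num E \<delta>)) / ln (1/\<delta>)) < ereal \<beta>"
    unfolding cover_limsup_def by (rule Limsup_lessD)
  then obtain d where d: "d > 0" "\<And>\<delta>. 0 < \<delta> \<Longrightarrow> \<delta> < d \<Longrightarrow> ln (real (cover_num E \<delta>)) / ln (1/\<delta>) < \<beta>"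
    unfolding eventually_at_right_field by auto
  define d' where "d' = min d 1"
  have d': "d' > 0" "d' \<le> 1" using d by (auto simp: d'_def)
  define C where "C = max 1 (2 / d')"
  show ?thesis
  proof (rule that[of C])
    show "C > 0" by (simp add: C_def)
    fix \<delta> :: real assume \<delta>: "0 < \<delta>" "\<delta> \<le> 1"
    have N1: "1 \<le> cover_num E \<delta>" using \<delta> E by (intro cover_num_pos bounded_subset_12) auto
    show "real (cover_num E \<delta>) \<le> C * \<delta> powr (-\<beta>)"
    proof (cases "\<delta> < d'")
      case True
      then have "ln (1/\<delta>) > 0" by (simp add: \<delta> d'_def)
      moreover have "ln (real (cover_num E \<delta>)) / ln (1/\<delta>) < \<beta>"
        using True \<delta> by (intro d(2)) (auto simp: d'_def)
      ultimately have "ln (real (cover_num E \<delta>)) < \<beta> * ln (1/\<delta>)"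
        by (simp add: divide_less_eq)
      also have "\<dots> = ln (\<delta> powr (-\<beta>))" using \<delta> by (simp add: ln_powr ln_div)
      finally have "real (cover_num E \<delta>) < \<delta> powr (-\<beta>)"
        using N1 \<delta> by (subst (asm) ln_less_cancel_iff) auto
      also have "\<dots> \<le> C * \<delta> powr (-\<beta>)"
        using mult_right_mono[of 1 C "\<delta> powr (-\<beta>)"] by (simp add: C_def)
      finally show ?thesis by simp
    next
      case False
      have "real (cover_num E \<delta>) \<le> 2 / \<delta>" by (rule cover_num_12_le) fact+
      also have "\<dots> \<le> 2 / d'" using False d' by (intro divide_left_mono) auto
      also have "\<dots> \<le> C * 1" by (simp add: C_def)
      also have "\<dots> \<le> C * \<delta> powr (-\<beta>)"
        using \<delta> b0 powr_mono2'[of "-\<beta>" \<delta> 1] by (intro mult_left_mono) (auto simp: C_def)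
      finally show ?thesis .
    qed
  qed
qed

section \<open>Assouad spectrum and quasi-Assouad dimension\<close>

definition assouad_exponents :: "real \<Rightarrow> real set \<Rightarrow> real set" where
  "assouad_exponents \<theta> E = {a. a > 0 \<and> (\<exists>c>0. \<forall>\<delta>\<in>{0<..<1}. \<forall>u v.
            1 \<le> u \<and> u \<le> v \<and> v \<le> 2 \<and> v - u \<ge> \<delta> powr \<theta> \<longrightarrow>
            real (cover_num (E \<inter> {u..v}) \<delta>) \<le> c * ((v - u) / \<delta>) powr a)}"

lemma upper_assouad_spectrum_eq: "upper_assouad_spectrum \<theta> E = Inf (assouad_exponents \<theta> E)"
  by (simp add: upper_assouad_spectrum_def assouad_exponents_def)

lemma assouad_exponents_pos: "a \<in> assouad_exponents \<theta> E \<Longrightarrow> a > 0"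
  by (simp add: assouad_exponents_def)

lemma bdd_below_assouad_exponents: "bdd_below (assouad_exponents \<theta> E)"
  by (rule bdd_belowI[of _ 0]) (auto dest: assouad_exponents_pos)

text \<open>For \<open>\<theta> \<le> 1\<close> admissible intervals are no shorter than \<delta>,
  so the trivial count 1 + |J|/\<delta> is at most 2 |J|/\<delta>. This keeps the set nonempty whose
  infimum is the spectrum.\<close>

lemma assouad_exponents_1: "\<theta> \<le> 1 \<Longrightarrow> 1 \<in> assouad_exponents \<theta> E"
  unfolding assouad_exponents_def
proof (intro CollectI conjI exI[of _ 2] ballI allI impI)
  fix \<delta> u v :: real assume "\<theta> \<le> 1" and \<delta>: "\<delta> \<in> {0<..<1}" and uv: "1 \<le> u \<and> u \<le> v \<and> v \<le> 2 \<and> v - u \<ge> \<delta> powr \<theta>"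
  then have "\<delta> powr 1 \<le> \<delta> powr \<theta>" by (intro powr_mono') auto
  with uv \<delta> have d: "\<delta> \<le> v - u" by simp
  have "real (cover_num (E \<inter> {u..v}) \<delta>) \<le> 1 + (v - u) / \<delta>"
    using \<delta> uv by (intro cover_num_le[where u = u]) auto
  also have "\<dots> \<le> 2 * ((v - u) / \<delta>) powr 1"
  proof -
    have "1 \<le> (v - u) / \<delta>" using d \<delta> by (simp add: le_divide_eq)
    then show ?thesis using powr_one[of "(v - u) / \<delta>"] by linarith
  qed
  finally show "real (cover_num (E \<inter> {u..v}) \<delta>) \<le> 2 * ((v - u) / \<delta>) powr 1" .
qed auto

text \<open>Raising \<theta> lowers \<delta>^\<theta>, so more intervals have to be covered
  efficiently and fewer exponents qualify.\<close>

lemma assouad_exponents_antimono: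
  assumes "\<theta> \<le> \<theta>'"
  shows "assouad_exponents \<theta>' E \<subseteq> assouad_exponents \<theta> E"
proof
  fix a assume "a \<in> assouad_exponents \<theta>' E"
  then obtain c where c: "a > 0" "c > 0" "\<And>\<delta> u v. \<delta> \<in> {0<..<1} \<Longrightarrow> 1 \<le> u \<Longrightarrow> u \<le> v \<Longrightarrow> v \<le> 2 \<Longrightarrow> v - u \<ge> \<delta> powr \<theta>' \<Longrightarrow>
    real (cover_num (E \<inter> {u..v}) \<delta>) \<le> c * ((v - u) / \<delta>) powr a"
    unfolding assouad_exponents_def by blast
  have "\<delta> powr \<theta>' \<le> \<delta> powr \<theta>" if "\<delta> \<in> {0<..<1}" for \<delta> :: real
    using that assms by (intro powr_mono') auto
  with c have "\<forall>\<delta>\<in>{0<..<1}. \<forall>u v. 1 \<le> u \<and> u \<le> v \<and> v \<le> 2 \<and> v - u \<ge> \<delta> powr \<theta> \<longrightarrow>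
            real (cover_num (E \<inter> {u..v}) \<delta>) \<le> c * ((v - u) / \<delta>) powr a"
    by (meson order.trans)
  with c(1,2) show "a \<in> assouad_exponents \<theta> E"
    unfolding assouad_exponents_def by blast
qed

lemma upper_assouad_spectrum_mono:
  "\<theta> \<le> \<theta>' \<Longrightarrow> \<theta>' \<le> 1 \<Longrightarrow> upper_assouad_spectrum \<theta> E \<le> upper_assouad_spectrum \<theta>' E"
  unfolding upper_assouad_spectrum_eq
  using assouad_exponents_1 by (intro cInf_superset_mono bdd_below_assouad_exponents assouad_exponents_antimono) auto

lemma upper_assouad_spectrum_le_1: "\<theta> \<le> 1 \<Longrightarrow> upper_assouad_spectrum \<theta> E \<le> 1"
  unfolding upper_assouad_spectrum_eq by (intro cInf_lower assouad_exponents_1 bdd_below_assouad_exponents)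

text \<open>The spectrum is nondecreasing in \<theta> and at most 1, so the left limit exists and is
  the supremum. Convergence gives \<open>Lim\<close> in the definition its meaning, and the supremum
  yields bounds from a single \<theta>.\<close>

lemma quasi_assouad_dim_tendsto:
  "((\<lambda>\<theta>. upper_assouad_spectrum \<theta> E) \<longlongrightarrow> quasi_assouad_dim E) (at_left 1)"
  and upper_assouad_spectrum_le_quasi_assouad_dim:
  "\<And>\<theta>. \<theta> < 1 \<Longrightarrow> upper_assouad_spectrum \<theta> E \<le> quasi_assouad_dim E"
proof -
  let ?U = "\<lambda>\<theta>. upper_assouad_spectrum \<theta> E"
  define s where "s = (SUP \<theta>\<in>{..<1}. ?U \<theta>)"
  have bdd: "bdd_above (?U ` {..<1})"
    by (rule bdd_aboveI[of _ 1]) (auto intro: upper_assouad_spectrum_le_1)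
  have le: "?U \<theta> \<le> s" if "\<theta> < 1" for \<theta>
    unfolding s_def using that by (intro cSUP_upper bdd) auto
  have lim: "(?U \<longlongrightarrow> s) (at_left 1)"
  proof (rule order_tendstoI)
    fix a assume "a < s"
    then obtain \<theta>0 where "\<theta>0 < 1" "a < ?U \<theta>0"
      unfolding s_def using less_cSUP_iff[OF _ bdd, of a] by auto
    then have "\<forall>\<theta>>\<theta>0. \<theta> < 1 \<longrightarrow> a < ?U \<theta>"
      using upper_assouad_spectrum_mono[of \<theta>0] by (meson less_imp_le less_le_trans)
    with \<open>\<theta>0 < 1\<close> show "\<forall>\<^sub>F \<theta> in at_left 1. a < ?U \<theta>"
      unfolding eventually_at_left_field by blast
  next
    fix a assume "s < a"
    then have "\<forall>\<theta>>0. \<theta> < 1 \<longrightarrow> ?U \<theta> < a"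
      using le by (meson le_less_trans)
    then show "\<forall>\<^sub>F \<theta> in at_left 1. ?U \<theta> < a"
      unfolding eventually_at_left_field by (intro exI[of _ 0]) auto
  qed
  then have "quasi_assouad_dim E = s"
    unfolding quasi_assouad_dim_def by (intro tendsto_Lim) auto
  with lim le show "(?U \<longlongrightarrow> quasi_assouad_dim E) (at_left 1)"
    "\<And>\<theta>. \<theta> < 1 \<Longrightarrow> ?U \<theta> \<le> quasi_assouad_dim E" by auto
qed

lemma quasi_assouad_dim_le_1: "quasi_assouad_dim E \<le> 1"
proof (rule tendsto_upperbound[OF quasi_assouad_dim_tendsto])
  show "\<forall>\<^sub>F \<theta> in at_left 1. upper_assouad_spectrum \<theta> E \<le> 1"
    unfolding eventually_at_left_field by (intro exI[of _ 0]) (auto intro: upper_assouad_spectrum_le_1)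
qed auto

text \<open>At \<theta> = 0 an admissible interval has length at least 1, so it is [1,2] itself and
  the exponents are Minkowski exponents.\<close>

lemma minkowski_dim_le_quasi_assouad_dim:
  assumes E: "E \<subseteq> {1..2}" "E \<noteq> {}"
  shows "minkowski_dim E \<le> quasi_assouad_dim E"
proof -
  have "minkowski_dim E \<le> upper_assouad_spectrum 0 E"
    unfolding upper_assouad_spectrum_eq
  proof (rule cInf_greatest)
    show "assouad_exponents 0 E \<noteq> {}" using assouad_exponents_1[of 0 E] by auto
    fix a assume "a \<in> assouad_exponents 0 E"
    then obtain c where c: "c > 0" "\<And>\<delta> u v. \<delta> \<in> {0<..<1} \<Longrightarrow> 1 \<le> u \<Longrightarrow> u \<le> v \<Longrightarrow> v \<le> 2 \<Longrightarrow> v - u \<ge> \<delta> powr 0 \<Longrightarrow>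
      real (cover_num (E \<inter> {u..v}) \<delta>) \<le> c * ((v - u) / \<delta>) powr a"
      unfolding assouad_exponents_def by blast
    show "minkowski_dim E \<le> a"
    proof (rule minkowski_dim_le[OF E c(1), of 1])
      fix \<delta> :: real assume \<delta>: "0 < \<delta>" "\<delta> < 1"
      have "E \<inter> {1..2} = E" using E by auto
      then show "real (cover_num E \<delta>) \<le> c * \<delta> powr (-a)"
        using c(2)[of \<delta> 1 2] \<delta> by (simp add: powr_divide powr_minus_divide)
    qed simp
  qed
  also have "\<dots> \<le> quasi_assouad_dim E"
    by (rule upper_assouad_spectrum_le_quasi_assouad_dim) simp
  finally show ?thesis .
qed

text \<open>For intervals shorter than \<open>\<delta> powr (1 - \<epsilon>)\<close>, which the spectrum does not see, the trivial bound loses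
  only a factor \<open>\<delta> powr (-\<epsilon>)\<close>.\<close>
lemma cover_num_le_quasi_assouad:
  assumes E: "E \<subseteq> {1..2}" "E \<noteq> {}" and g: "\<gamma> > quasi_assouad_dim E" and e: "0 < \<epsilon>" "\<epsilon> < 1"
  obtains C where "C > 0" "\<And>\<delta> l u v. 0 < \<delta> \<Longrightarrow> \<delta> \<le> 1 \<Longrightarrow> \<delta> \<le> l \<Longrightarrow> v - u \<le> l \<Longrightarrow>
    real (cover_num (E \<inter> {u..v}) \<delta>) \<le> C * \<delta> powr (-\<epsilon>) * (l / \<delta>) powr \<gamma>"
proof -
  have g0: "\<gamma> > 0" using g minkowski_dim_nonneg[OF E] minkowski_dim_le_quasi_assouad_dim[OF E] by simp
  have "upper_assouad_spectrum (1 - \<epsilon>) E < \<gamma>"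
    using upper_assouad_spectrum_le_quasi_assouad_dim[of "1 - \<epsilon>" E] g e by simp
  then obtain a where a: "a \<in> assouad_exponents (1 - \<epsilon>) E" "a < \<gamma>"
    unfolding upper_assouad_spectrum_eq using assouad_exponents_1[of "1 - \<epsilon>" E] e
    by (subst (asm) cInf_less_iff) (auto intro: bdd_below_assouad_exponents)
  then obtain c where c: "c > 0" "\<And>\<delta> u v. \<delta> \<in> {0<..<1} \<Longrightarrow> 1 \<le> u \<Longrightarrow> u \<le> v \<Longrightarrow> v \<le> 2 \<Longrightarrow> v - u \<ge> \<delta> powr (1 - \<epsilon>) \<Longrightarrow>
      real (cover_num (E \<inter> {u..v}) \<delta>) \<le> c * ((v - u) / \<delta>) powr a"
    unfolding assouad_exponents_def by blast
  show ?thesis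
  proof (rule that[of "max c 2"])
    show "max c 2 > 0" by simp
    fix \<delta> l u v :: real assume \<delta>: "0 < \<delta>" "\<delta> \<le> 1" and l: "\<delta> \<le> l" "v - u \<le> l"
    \<comment> \<open>The spectrum speaks of intervals inside [1,2] only; clipping loses nothing of
      \<open>E\<close>.\<close>
    define u' v' where "u' = max 1 u" and "v' = min 2 v"
    have eq: "E \<inter> {u..v} = E \<inter> {u'..v'}" using E by (auto simp: u'_def v'_def)
    have l': "v' - u' \<le> l" using l by (auto simp: u'_def v'_def)
    have one: "1 \<le> \<delta> powr (-\<epsilon>)" using \<delta> e powr_mono2'[of "-\<epsilon>" \<delta> 1] by simp
    have one': "1 \<le> (l / \<delta>) powr \<gamma>" using \<delta> l g0 by (intro ge_one_powr_ge_zero) auto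
    show "real (cover_num (E \<inter> {u..v}) \<delta>) \<le> max c 2 * \<delta> powr (-\<epsilon>) * (l / \<delta>) powr \<gamma>"
    proof (cases "u' \<le> v'")
      case False
      then have "E \<inter> {u'..v'} = {}" by auto
      then show ?thesis unfolding eq by (simp add: cover_num_empty)
    next
      case uv: True
      show ?thesis
      proof (cases "\<delta> < 1 \<and> v' - u' \<ge> \<delta> powr (1 - \<epsilon>)")
        case True
        have "\<delta> powr 1 \<le> \<delta> powr (1 - \<epsilon>)" using \<delta> e by (intro powr_mono') auto
        then have d: "\<delta> \<le> v' - u'" using True \<delta> by simp
        have "real (cover_num (E \<inter> {u'..v'}) \<delta>) \<le> c * ((v' - u') / \<delta>) powr a"
          using True uv \<delta> by (intro c(2)) (auto simp: u'_def v'_def)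
        also have "\<dots> \<le> c * (l / \<delta>) powr \<gamma>"
        proof (intro mult_left_mono)
          have "((v' - u') / \<delta>) powr a \<le> ((v' - u') / \<delta>) powr \<gamma>"
            using d a \<delta> by (intro powr_mono) auto
          also have "\<dots> \<le> (l / \<delta>) powr \<gamma>"
            using d l' g0 \<delta> by (intro powr_mono2 divide_right_mono) auto
          finally show "((v' - u') / \<delta>) powr a \<le> (l / \<delta>) powr \<gamma>" .
        qed (use c in simp)
        also have "c * (l / \<delta>) powr \<gamma> \<le> (max c 2 * \<delta> powr (-\<epsilon>)) * (l / \<delta>) powr \<gamma>"
          using one c mult_mono[of c "max c 2" 1 "\<delta> powr (-\<epsilon>)"] by (intro mult_right_mono) auto
        finally show ?thesis unfolding eq .
      next
        case False
        have "real (cover_num (E \<inter> {u'..v'}) \<delta>) \<le> 2 * \<delta> powr (-\<epsilon>)"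
        proof (cases "\<delta> = 1")
          case True
          have "v' - u' \<le> 1" by (simp add: u'_def v'_def)
          then have "real (cover_num (E \<inter> {u'..v'}) \<delta>) \<le> 1 + 1 / \<delta>"
            using \<delta> by (intro cover_num_le[where u = u']) auto
          then show ?thesis using True by simp
        next
          case neq: False
          have "real (cover_num (E \<inter> {u'..v'}) \<delta>) \<le> 1 + \<delta> powr (1 - \<epsilon>) / \<delta>"
            using \<delta> False neq by (intro cover_num_le[where u = u']) auto
          also have "\<delta> powr (1 - \<epsilon>) / \<delta> = \<delta> powr (-\<epsilon>)"
            using \<delta> by (simp add: powr_diff powr_minus_divide)
          finally show ?thesis using one by simp
        qed
        also have "\<dots> \<le> max c 2 * \<delta> powr (-\<epsilon>)" by (intro mult_right_mono) auto
        also have "\<dots> \<le> (max c 2 * \<delta> powr (-\<epsilon>)) * (l / \<delta>) powr \<gamma>"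
          using one' mult_left_mono[of 1 "(l / \<delta>) powr \<gamma>" "max c 2 * \<delta> powr (-\<epsilon>)"] by simp
        finally show ?thesis unfolding eq .
      qed
    qed
  qed
qed

section \<open>Bounds in the interior of the region\<close>

lemma near_set_section_borel [measurable]: "{x. y \<in> near_set E j x} \<in> sets borel"
proof -
  have "(\<lambda>x. (x, y)) -` {(x, y). y \<in> near_set E j x} \<in> sets borel"
    using near_pairs_borel by (rule sets_Pair2)
  then show ?thesis by (simp add: vimage_def)
qed

section \<open>From squared norms to distances\<close>

text \<open>s^2 - u^2 = (s + u)(s - u), and a lower bound for u gives one for the first factor, so
  the distance is controlled linearly.\<close>

lemma abs_diff_le_if_power2:
  assumes "u \<ge> k" "k > 0" "s \<ge> 0" "\<bar>s\<^sup>2 - u\<^sup>2\<bar> < k * w"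
  shows "\<bar>u - s\<bar> \<le> (w::real)"
proof -
  have "k * \<bar>u - s\<bar> \<le> (s + u) * \<bar>u - s\<bar>"
    using assms by (intro mult_right_mono) auto
  also have "\<dots> = \<bar>s\<^sup>2 - u\<^sup>2\<bar>"
    using assms by (simp add: power2_eq_square square_diff_square_factored abs_mult abs_minus_commute)
  finally have "k * \<bar>u - s\<bar> \<le> k * w" using assms(4) by linarith
  then show ?thesis using assms(2) by (simp only: mult_le_cancel_left_pos)
qed

text \<open>Without a lower bound for u there is only |u - s| \<le> u + s, hence a square root. This
  is the origin of the scale 2^(-j/2) for |x| of order one, where |x| = t is possible.\<close>

lemma abs_diff_le_if_power2':
  assumes "u \<ge> 0" "s \<ge> 0" "w \<ge> 0" "\<bar>s\<^sup>2 - u\<^sup>2\<bar> \<le> w\<^sup>2"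
  shows "\<bar>u - s\<bar> \<le> (w::real)"
proof -
  have "\<bar>u - s\<bar> * \<bar>u - s\<bar> \<le> (s + u) * \<bar>u - s\<bar>"
    using assms by (intro mult_right_mono) auto
  also have "\<dots> = \<bar>s\<^sup>2 - u\<^sup>2\<bar>"
    using assms by (simp add: power2_eq_square square_diff_square_factored abs_mult abs_minus_commute)
  finally have "\<bar>u - s\<bar>\<^sup>2 \<le> w\<^sup>2" using assms by (simp add: power2_eq_square)
  then show ?thesis using assms by (simp add: power2_le_iff_abs_le)
qed

text \<open>With r = |x| \<le> 1/2 one has |r - t| \<ge> t/2, so squares are undone linearly, with
  width at most 8 r 2^(-j) \<le> 16 \<rho> 2^(-j). Then t differs from |y| by at most r + 16 \<rho>
  \<le> 18 \<rho>. This window of length 36 \<rho> is what lets the Assouad bound enter.\<close>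

lemma near_set_small:
  assumes E: "E \<subseteq> {1..2}" and x: "0 < norm x" "norm x \<le> 2 * \<rho>" "\<rho> \<le> 1/4" and y: "y \<in> near_set E j x"
  shows "\<exists>t\<in>E \<inter> {norm y - 18*\<rho>..norm y + 18*\<rho>}.
    \<bar>norm x + t - norm y\<bar> \<le> 16 * (\<rho> * (1/2)^j) \<or> \<bar>\<bar>norm x - t\<bar> - norm y\<bar> \<le> 16 * (\<rho> * (1/2)^j)"
proof -
  define \<eta> :: real where "\<eta> = (1/2)^j"
  define r where "r = norm x"
  define s where "s = norm y"
  have \<eta>: "\<eta> > 0" "\<eta> \<le> 1" by (simp_all add: \<eta>_def power_le_one)
  have r: "0 < r" "r \<le> 2 * \<rho>" using x by (simp_all add: r_def)
  from y obtain t where t: "t \<in> E" "\<bar>s\<^sup>2 - (r + t)\<^sup>2\<bar> < 4 * r * t * \<eta> \<or> \<bar>s\<^sup>2 - (r - t)\<^sup>2\<bar> < 4 * r * t * \<eta>"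
    by (auto simp: near_set_def annuli_def \<eta>_def r_def s_def)
  have t12: "1 \<le> t" "t \<le> 2" using t E by auto
  have r\<eta>: "8 * (r * \<eta>) \<le> 16 * (\<rho> * \<eta>)" using mult_right_mono[of r "2*\<rho>" \<eta>] r \<eta> by simp
  have \<rho>\<eta>: "\<rho> * \<eta> \<le> \<rho>" using mult_left_mono[of \<eta> 1 \<rho>] r \<eta> by simp
  have near: "\<bar>r + t - s\<bar> \<le> 16 * (\<rho> * \<eta>) \<or> \<bar>\<bar>r - t\<bar> - s\<bar> \<le> 16 * (\<rho> * \<eta>)"
    using t(2)
  proof
    assume a: "\<bar>s\<^sup>2 - (r + t)\<^sup>2\<bar> < 4 * r * t * \<eta>"
    have "\<bar>r + t - s\<bar> \<le> 4 * (r * \<eta>)"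
    proof (rule abs_diff_le_if_power2[where k = t])
      have "4 * r * t * \<eta> = t * (4 * (r * \<eta>))" by simp
      then show "\<bar>s\<^sup>2 - (r + t)\<^sup>2\<bar> < t * (4 * (r * \<eta>))" using a by linarith
    qed (use r t12 in \<open>auto simp: s_def\<close>)
    then show ?thesis using r\<eta> r \<eta> mult_pos_pos[of r \<eta>] by linarith
  next
    assume a: "\<bar>s\<^sup>2 - (r - t)\<^sup>2\<bar> < 4 * r * t * \<eta>"
    have "\<bar>\<bar>r - t\<bar> - s\<bar> \<le> 8 * (r * \<eta>)"
    proof (rule abs_diff_le_if_power2[where k = "t / 2"])
      have "4 * r * t * \<eta> = t / 2 * (8 * (r * \<eta>))" by simp
      then show "\<bar>s\<^sup>2 - \<bar>r - t\<bar>\<^sup>2\<bar> < t / 2 * (8 * (r * \<eta>))" unfolding power2_abs using a by linarith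
    qed (use r t12 x in \<open>auto simp: s_def\<close>)
    then show ?thesis using r\<eta> by linarith
  qed
  have "r \<le> t" using r x t12 by linarith
  with near have "\<bar>t - s\<bar> \<le> r + 16 * (\<rho> * \<eta>)" using r by linarith
  then have "t \<in> {s - 18*\<rho>..s + 18*\<rho>}" using r \<rho>\<eta> unfolding atLeastAtMost_iff by linarith
  with near t show ?thesis unfolding \<eta>_def r_def s_def by blast
qed

text \<open>Since |x| may equal t, only the square root estimate applies; with r = |x|, the product
  4 r t is at most 32, rounded up to 36 = 6^2.\<close>

lemma near_set_middle:
  assumes E: "E \<subseteq> {1..2}" and x: "norm x \<le> 4" and y: "y \<in> near_set E j x"
  shows "\<exists>t\<in>E. \<bar>norm x + t - norm y\<bar> \<le> 6 * sqrt ((1/2)^j) \<or> \<bar>\<bar>norm x - t\<bar> - norm y\<bar> \<le> 6 * sqrt ((1/2)^j)"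
proof -
  define \<eta> :: real where "\<eta> = (1/2)^j"
  define r where "r = norm x"
  define s where "s = norm y"
  have \<eta>: "\<eta> > 0" by (simp add: \<eta>_def)
  from y obtain t where t: "t \<in> E" "\<bar>s\<^sup>2 - (r + t)\<^sup>2\<bar> < 4 * r * t * \<eta> \<or> \<bar>s\<^sup>2 - (r - t)\<^sup>2\<bar> < 4 * r * t * \<eta>"
    by (auto simp: near_set_def annuli_def \<eta>_def r_def s_def)
  have t12: "1 \<le> t" "t \<le> 2" using t E by auto
  have r: "0 \<le> r" "r \<le> 4" using x by (simp_all add: r_def)
  have "r * t \<le> 4 * 2" using r t12 by (intro mult_mono) auto
  then have "4 * r * t * \<eta> \<le> 36 * \<eta>" using \<eta> by (intro mult_right_mono) auto
  also have "\<dots> = (6 * sqrt \<eta>)\<^sup>2" using \<eta> by (simp add: power_mult_distrib)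
  finally have le: "4 * r * t * \<eta> \<le> (6 * sqrt \<eta>)\<^sup>2" .
  from t(2) have "\<bar>r + t - s\<bar> \<le> 6 * sqrt \<eta> \<or> \<bar>\<bar>r - t\<bar> - s\<bar> \<le> 6 * sqrt \<eta>"
  proof
    assume a: "\<bar>s\<^sup>2 - (r + t)\<^sup>2\<bar> < 4 * r * t * \<eta>"
    have "\<bar>r + t - s\<bar> \<le> 6 * sqrt \<eta>"
    proof (rule abs_diff_le_if_power2')
      show "\<bar>s\<^sup>2 - (r + t)\<^sup>2\<bar> \<le> (6 * sqrt \<eta>)\<^sup>2" using a le by linarith
    qed (use r t12 \<eta> in \<open>auto simp: s_def\<close>)
    then show ?thesis ..
  next
    assume a: "\<bar>s\<^sup>2 - (r - t)\<^sup>2\<bar> < 4 * r * t * \<eta>"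
    have "\<bar>\<bar>r - t\<bar> - s\<bar> \<le> 6 * sqrt \<eta>"
    proof (rule abs_diff_le_if_power2')
      show "\<bar>s\<^sup>2 - \<bar>r - t\<bar>\<^sup>2\<bar> \<le> (6 * sqrt \<eta>)\<^sup>2" unfolding power2_abs using a le by linarith
    qed (use \<eta> in \<open>auto simp: s_def\<close>)
    then show ?thesis ..
  qed
  with t show ?thesis unfolding \<eta>_def r_def s_def by blast
qed

text \<open>With r = |x| \<ge> 4 and t \<le> 2 one has |r - t| \<ge> r/2. Dividing 4 r t 2^(-j)
  \<le> 8 r 2^(-j) by r/2 leaves a width independent of r.\<close>

lemma near_set_large:
  assumes E: "E \<subseteq> {1..2}" and x: "norm x \<ge> 4" and y: "y \<in> near_set E j x"
  shows "\<exists>t\<in>E. \<bar>norm x + t - norm y\<bar> \<le> 16 * (1/2)^j \<or> \<bar>\<bar>norm x - t\<bar> - norm y\<bar> \<le> 16 * (1/2)^j"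
proof -
  define \<eta> :: real where "\<eta> = (1/2)^j"
  define r where "r = norm x"
  define s where "s = norm y"
  have \<eta>: "\<eta> > 0" by (simp add: \<eta>_def)
  from y obtain t where t: "t \<in> E" "\<bar>s\<^sup>2 - (r + t)\<^sup>2\<bar> < 4 * r * t * \<eta> \<or> \<bar>s\<^sup>2 - (r - t)\<^sup>2\<bar> < 4 * r * t * \<eta>"
    by (auto simp: near_set_def annuli_def \<eta>_def r_def s_def)
  have t12: "1 \<le> t" "t \<le> 2" using t E by auto
  have r: "r \<ge> 4" using x by (simp add: r_def)
  have "4 * r * t * \<eta> = (4 * r * \<eta>) * t" by simp
  also have "\<dots> \<le> (4 * r * \<eta>) * 2" using r \<eta> t12 by (intro mult_left_mono) auto
  finally have le: "4 * r * t * \<eta> \<le> r / 2 * (16 * \<eta>)" by simp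
  from t(2) have "\<bar>r + t - s\<bar> \<le> 16 * \<eta> \<or> \<bar>\<bar>r - t\<bar> - s\<bar> \<le> 16 * \<eta>"
  proof
    assume a: "\<bar>s\<^sup>2 - (r + t)\<^sup>2\<bar> < 4 * r * t * \<eta>"
    have "\<bar>r + t - s\<bar> \<le> 16 * \<eta>"
    proof (rule abs_diff_le_if_power2[where k = "r / 2"])
      show "\<bar>s\<^sup>2 - (r + t)\<^sup>2\<bar> < r / 2 * (16 * \<eta>)" using a le by linarith
    qed (use r t12 in \<open>auto simp: s_def\<close>)
    then show ?thesis ..
  next
    assume a: "\<bar>s\<^sup>2 - (r - t)\<^sup>2\<bar> < 4 * r * t * \<eta>"
    have "\<bar>\<bar>r - t\<bar> - s\<bar> \<le> 16 * \<eta>"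
    proof (rule abs_diff_le_if_power2[where k = "r / 2"])
      show "\<bar>s\<^sup>2 - \<bar>r - t\<bar>\<^sup>2\<bar> < r / 2 * (16 * \<eta>)" unfolding power2_abs using a le by linarith
    qed (use r t12 in \<open>auto simp: s_def\<close>)
    then show ?thesis ..
  qed
  with t show ?thesis unfolding \<eta>_def r_def s_def by blast
qed

section \<open>Summation over dyadic shells\<close>

lemma suminf_half_power_powr_finite:
  assumes "c \<ge> 0" "e > 0"
  shows "\<exists>B\<ge>0. (\<Sum>m. ennreal (c * ((1/2)^m) powr e)) = ennreal B"
proof (intro exI conjI)
  have s: "summable (\<lambda>m. c * ((1/2::real)^m) powr e)"
    using assms by (intro summable_mult summable_half_power_powr)
  show "(\<Sum>m. ennreal (c * ((1/2)^m) powr e)) = ennreal (\<Sum>m. c * ((1/2)^m) powr e)"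
    using assms by (intro suminf_ennreal2 s) auto
  show "0 \<le> (\<Sum>m. c * ((1/2::real)^m) powr e)"
    using assms by (intro suminf_nonneg s) auto
qed

text \<open>Dyadic shells fill both sides of the middle range. The sum over shells converges at 0
  because \<open>e - \<nu> > 0\<close> and at infinity because \<open>\<nu> > 1\<close>, which is q
  > p in the application; the other three exponents sum over j.\<close>

lemma kernel_bound_from_areas:
  fixes \<kappa> \<nu> :: real
  assumes K: "K \<ge> 0" and \<nu>: "\<nu> > 1"
    and ex: "e - \<nu> > 0" "\<kappa> + f > 0" "\<kappa> + h > 0" "\<kappa> + k > 0"
    and small: "\<And>y \<rho> j. 0 < \<rho> \<Longrightarrow> \<rho> \<le> 1/4 \<Longrightarrow>
      emeasure lborel {x. \<rho> \<le> norm x \<and> norm x \<le> 2*\<rho> \<and> y \<in> near_set E j x} \<le> ennreal (K * \<rho> powr e * ((1/2)^j) powr f)"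
    and middle: "\<And>y j. emeasure lborel {x. 1/4 \<le> norm x \<and> norm x \<le> 4 \<and> y \<in> near_set E j x} \<le> ennreal (K * ((1/2)^j) powr h)"
    and large: "\<And>y \<rho> j. 0 < \<rho> \<Longrightarrow>
      emeasure lborel {x. 4 \<le> norm x \<and> \<rho> \<le> norm x \<and> norm x \<le> 2*\<rho> \<and> y \<in> near_set E j x} \<le> ennreal (K * \<rho> * ((1/2)^j) powr k)"
  obtains B where "B \<ge> 0"
    "\<And>y. (\<Sum>j. \<integral>\<^sup>+x. ennreal (((1/2)^j) powr \<kappa> * norm x powr (-\<nu>)) * indicator (near_set E j x) y \<partial>lborel) \<le> ennreal B"
proof -
  have pos: "K * (1/4) powr (e-\<nu>) \<ge> 0" "K * 2 powr (1-\<nu>) \<ge> 0" "K * 4 powr \<nu> \<ge> 0"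
    using K by auto
  have \<nu>': "\<nu> - 1 > 0" using \<nu> by simp
  obtain BS where BS: "BS \<ge> 0" "(\<Sum>m. ennreal (K * (1/4) powr (e-\<nu>) * ((1/2)^m) powr (e-\<nu>))) = ennreal BS"
    using suminf_half_power_powr_finite[OF pos(1) ex(1)] by blast
  obtain BL where BL: "BL \<ge> 0" "(\<Sum>m. ennreal (K * 2 powr (1-\<nu>) * ((1/2)^m) powr (\<nu>-1))) = ennreal BL"
    using suminf_half_power_powr_finite[OF pos(2) \<nu>'] by blast
  obtain S1 where S1: "S1 \<ge> 0" "(\<Sum>j. ennreal (BS * ((1/2)^j) powr (\<kappa>+f))) = ennreal S1"
    using suminf_half_power_powr_finite[OF BS(1) ex(2)] by blast
  obtain S2 where S2: "S2 \<ge> 0" "(\<Sum>j. ennreal (K * 4 powr \<nu> * ((1/2)^j) powr (\<kappa>+h))) = ennreal S2"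
    using suminf_half_power_powr_finite[OF pos(3) ex(3)] by blast
  obtain S3 where S3: "S3 \<ge> 0" "(\<Sum>j. ennreal (BL * ((1/2)^j) powr (\<kappa>+k))) = ennreal S3"
    using suminf_half_power_powr_finite[OF BL(1) ex(4)] by blast
  show ?thesis
  proof (rule that[of "S1 + (S2 + S3)"])
    show "S1 + (S2 + S3) \<ge> 0" using S1 S2 S3 by simp
    fix y :: "real^2"
    have J: "(\<integral>\<^sup>+x. ennreal (((1/2)^j) powr \<kappa> * norm x powr (-\<nu>)) * indicator (near_set E j x) y \<partial>lborel)
      \<le> ennreal (BS * ((1/2)^j) powr (\<kappa>+f)) + (ennreal (K * 4 powr \<nu> * ((1/2)^j) powr (\<kappa>+h)) + ennreal (BL * ((1/2)^j) powr (\<kappa>+k)))" for j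
    proof -
      define \<eta> :: real where "\<eta> = (1/2)^j"
      have \<eta>: "\<eta> > 0" by (simp add: \<eta>_def)
      define \<rho>S where "\<rho>S m = (1/4) * (1/2::real)^m" for m :: nat
      \<comment> \<open>A large x is placed by 2^(-m) \<le> 4/|x| < 2 * 2^(-m), so |x| lies between
        2 * 2^m and 4 * 2^m.\<close>
      define \<rho>L where "\<rho>L m = 2 * inverse ((1/2::real)^m)" for m :: nat
      let ?F = "\<lambda>x. ennreal (\<eta> powr \<kappa> * norm x powr (-\<nu>)) * indicator (near_set E j x) y"
      let ?cS = "\<lambda>m. ennreal (\<eta> powr \<kappa> * \<rho>S m powr (-\<nu>))" and ?cL = "\<lambda>m. ennreal (\<eta> powr \<kappa> * \<rho>L m powr (-\<nu>))"
      let ?cM = "ennreal (\<eta> powr \<kappa> * (1/4) powr (-\<nu>))"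
      let ?gS = "\<lambda>m. ennreal (\<eta> powr (\<kappa>+f)) * ennreal (K * (1/4) powr (e-\<nu>) * ((1/2)^m) powr (e-\<nu>))"
      let ?gL = "\<lambda>m. ennreal (\<eta> powr (\<kappa>+k)) * ennreal (K * 2 powr (1-\<nu>) * ((1/2)^m) powr (\<nu>-1))"
      define AS where "AS m = {x. \<rho>S m \<le> norm x \<and> norm x \<le> 2*\<rho>S m \<and> y \<in> near_set E j x}" for m
      define AM where "AM = {x. 1/4 \<le> norm x \<and> norm x \<le> 4 \<and> y \<in> near_set E j x}"
      define AL where "AL m = {x. 4 \<le> norm x \<and> \<rho>L m \<le> norm x \<and> norm x \<le> 2*\<rho>L m \<and> y \<in> near_set E j x}" for m
      have \<rho>: "\<rho>S m > 0" "\<rho>S m \<le> 1/4" "\<rho>L m > 0" for m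
        by (simp_all add: \<rho>S_def \<rho>L_def power_le_one)
      have [measurable]: "Measurable.pred borel (\<lambda>x. y \<in> near_set E j x)"
        using near_set_section_borel[of y E j] by (simp add: pred_def)
      have [measurable]: "AS m \<in> sets borel" for m unfolding AS_def by measurable
      have [measurable]: "AM \<in> sets borel" unfolding AM_def by measurable
      have [measurable]: "AL m \<in> sets borel" for m unfolding AL_def by measurable
      have pow: "norm x powr (-\<nu>) \<le> c powr (-\<nu>)" if "0 < c" "c \<le> norm x" for c and x :: "real^2"
        using that \<nu> by (intro powr_mono2') auto
      have W: "ennreal (\<eta> powr \<kappa> * norm x powr (-\<nu>)) \<le> ennreal (\<eta> powr \<kappa> * c powr (-\<nu>))"
        if "0 < c" "c \<le> norm x" for c and x :: "real^2"
        using pow[OF that] by (intro ennreal_leI mult_left_mono) auto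
      have "(\<integral>\<^sup>+x. ?F x \<partial>lborel)
        \<le> (\<integral>\<^sup>+x. (\<Sum>m. ?cS m * indicator (AS m) x) +
            (?cM * indicator AM x +
            (\<Sum>m. ?cL m * indicator (AL m) x)) \<partial>lborel)"
      proof (rule nn_integral_mono_AE)
        have sS: "z \<le> (\<Sum>m. F m)" if "z \<le> F m" for z and F :: "nat \<Rightarrow> ennreal" and m
          using order.trans[OF that, of "\<Sum>m. F m"] sum_le_suminf[of F "{m}"] by simp
        have "AE x in lborel. x \<noteq> (0 :: real^2)" by (rule AE_lborel_singleton)
        then show "AE x in lborel. ?F x \<le>
            (\<Sum>m. ?cS m * indicator (AS m) x) +
            (?cM * indicator AM x +
            (\<Sum>m. ?cL m * indicator (AL m) x))"
        proof eventually_elim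
          case (elim x)
          show ?case
          proof (cases "y \<in> near_set E j x")
            case y: True
            consider "norm x \<le> 1/4" | "1/4 \<le> norm x" "norm x \<le> 4" | "4 \<le> norm x" by linarith
            then show ?thesis
            proof cases
              case 1
              obtain m where "(1/2)^m \<le> 4 * norm x" "4 * norm x < 2 * (1/2)^m"
              proof (rule ex_dyadic)
                show "0 < 4 * norm x" "4 * norm x \<le> 1" using 1 elim by auto
              qed
              then have "x \<in> AS m" "\<rho>S m \<le> norm x" using y by (auto simp: AS_def \<rho>S_def)
              then have "?F x \<le> ?cS m * indicator (AS m) x"
                using y W[OF \<rho>(1)] by simp
              from sS[where F = "\<lambda>m. ?cS m * indicator (AS m) x", OF this]
              show ?thesis by (rule add_increasing2[rotated]) simp
            next
              case 2
              then have "x \<in> AM" using y by (auto simp: AM_def)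
              then have "?F x \<le> ?cM * indicator AM x"
                using y W[of "1/4" x] 2 by simp
              then show ?thesis by (intro add_increasing add_increasing2) auto
            next
              case 3
              obtain m where m: "(1/2)^m \<le> 4 / norm x" "4 / norm x < 2 * (1/2)^m"
              proof (rule ex_dyadic)
                show "0 < 4 / norm x" "4 / norm x \<le> 1" using 3 elim by (auto simp: divide_le_eq)
              qed
              have nx: "norm x > 0" using 3 by linarith
              have "norm x * (1/2)^m \<le> 4" "4 < norm x * (2 * (1/2)^m)"
                using m nx by (simp_all add: le_divide_eq divide_less_eq mult.commute)
              then have "norm x \<le> 4 * inverse ((1/2)^m)" "2 * inverse ((1/2)^m) < norm x"
                by (simp_all add: field_simps)
              then have "x \<in> AL m" "\<rho>L m \<le> norm x" using y 3 by (auto simp: AL_def \<rho>L_def)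
              then have "?F x \<le> ?cL m * indicator (AL m) x"
                using y W[OF \<rho>(3)] by simp
              from sS[where F = "\<lambda>m. ?cL m * indicator (AL m) x", OF this]
              show ?thesis by (intro add_increasing) auto
            qed
          qed simp
        qed
      qed
      also have "\<dots> = (\<Sum>m. ?cS m * emeasure lborel (AS m)) +
            (?cM * emeasure lborel AM +
            (\<Sum>m. ?cL m * emeasure lborel (AL m)))"
        by (subst nn_integral_add, measurable, subst nn_integral_add, measurable)
          (simp add: nn_integral_suminf nn_integral_cmult_indicator)
      also have "\<dots> \<le> ennreal (BS * \<eta> powr (\<kappa>+f)) + (ennreal (K * 4 powr \<nu> * \<eta> powr (\<kappa>+h)) + ennreal (BL * \<eta> powr (\<kappa>+k)))"
      proof (intro add_mono)
        have "(\<Sum>m. ?cS m * emeasure lborel (AS m)) \<le>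
          (\<Sum>m. ?gS m)"
        proof (intro suminf_le)
          fix m
          have "?cS m * emeasure lborel (AS m) \<le> ?cS m * ennreal (K * \<rho>S m powr e * \<eta> powr f)"
            unfolding AS_def \<eta>_def by (intro mult_left_mono small \<rho>) auto
          also have "\<dots> = ennreal ((\<eta> powr \<kappa> * \<eta> powr f) * (K * (\<rho>S m powr e * \<rho>S m powr (-\<nu>))))"
            using K by (subst ennreal_mult[symmetric]) (auto simp: mult_ac)
          also have "\<eta> powr \<kappa> * \<eta> powr f = \<eta> powr (\<kappa>+f)" by (simp add: powr_add)
          also have "\<rho>S m powr e * \<rho>S m powr (-\<nu>) = \<rho>S m powr (e-\<nu>)" by (simp add: powr_add[symmetric])
          also have "\<rho>S m powr (e-\<nu>) = (1/4) powr (e-\<nu>) * ((1/2)^m) powr (e-\<nu>)" unfolding \<rho>S_def by (rule powr_mult)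
          also have "ennreal (\<eta> powr (\<kappa>+f) * (K * ((1/4) powr (e-\<nu>) * ((1/2)^m) powr (e-\<nu>)))) = ?gS m"
            by (subst ennreal_mult'[symmetric]) (auto simp: mult.assoc)
          finally show "?cS m * emeasure lborel (AS m) \<le> ?gS m" .
        qed auto
        also have "\<dots> = ennreal (BS * \<eta> powr (\<kappa>+f))"
          unfolding ennreal_suminf_cmult BS(2) using BS(1) by (simp add: ennreal_mult' mult.commute)
        finally show "(\<Sum>m. ?cS m * emeasure lborel (AS m)) \<le> ennreal (BS * \<eta> powr (\<kappa>+f))" .
      next
        have "?cM * emeasure lborel AM \<le> ?cM * ennreal (K * \<eta> powr h)"
          unfolding AM_def \<eta>_def by (intro mult_left_mono middle) auto
        also have "\<dots> = ennreal (\<eta> powr \<kappa> * (1/4) powr (-\<nu>) * (K * \<eta> powr h))"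
          by (rule ennreal_mult'[symmetric]) simp
        also have "\<eta> powr \<kappa> * (1/4) powr (-\<nu>) * (K * \<eta> powr h) = K * 4 powr \<nu> * \<eta> powr (\<kappa>+h)"
          by (simp add: powr_add powr_minus powr_divide)
        finally show "?cM * emeasure lborel AM \<le> ennreal (K * 4 powr \<nu> * \<eta> powr (\<kappa>+h))" .
      next
        have "(\<Sum>m. ?cL m * emeasure lborel (AL m)) \<le>
          (\<Sum>m. ?gL m)"
        proof (intro suminf_le)
          fix m
          have "?cL m * emeasure lborel (AL m) \<le> ?cL m * ennreal (K * \<rho>L m * \<eta> powr k)"
            unfolding AL_def \<eta>_def by (intro mult_left_mono large \<rho>) auto
          also have "\<dots> = ennreal ((\<eta> powr \<kappa> * \<eta> powr k) * (K * (\<rho>L m * \<rho>L m powr (-\<nu>))))"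
            by (subst ennreal_mult'[symmetric]) (auto simp: mult_ac)
          also have "\<eta> powr \<kappa> * \<eta> powr k = \<eta> powr (\<kappa>+k)" by (simp add: powr_add)
          also have "\<rho>L m * \<rho>L m powr (-\<nu>) = \<rho>L m powr (1-\<nu>)"
            using \<rho>(3)[of m] powr_add[of "\<rho>L m" 1 "-\<nu>"] by simp
          also have "\<rho>L m powr (1-\<nu>) = 2 powr (1-\<nu>) * ((1/2)^m) powr (\<nu>-1)"
          proof -
            have "\<rho>L m powr (1-\<nu>) = 2 powr (1-\<nu>) * inverse ((1/2)^m) powr (1-\<nu>)" unfolding \<rho>L_def by (rule powr_mult)
            also have "inverse ((1/2::real)^m) powr (1-\<nu>) = ((1/2)^m) powr (- (1-\<nu>))"
              by (simp only: powr_minus inverse_powr)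
            finally show ?thesis by simp
          qed
          also have "ennreal (\<eta> powr (\<kappa>+k) * (K * (2 powr (1-\<nu>) * ((1/2)^m) powr (\<nu>-1)))) = ?gL m"
            by (subst ennreal_mult'[symmetric]) (auto simp: mult.assoc)
          finally show "?cL m * emeasure lborel (AL m) \<le> ?gL m" .
        qed auto
        also have "\<dots> = ennreal (BL * \<eta> powr (\<kappa>+k))"
          unfolding ennreal_suminf_cmult BL(2) using BL(1) by (simp add: ennreal_mult' mult.commute)
        finally show "(\<Sum>m. ?cL m * emeasure lborel (AL m)) \<le> ennreal (BL * \<eta> powr (\<kappa>+k))" .
      qed
      finally show ?thesis unfolding \<eta>_def .
    qed
    have "(\<Sum>j. \<integral>\<^sup>+x. ennreal (((1/2)^j) powr \<kappa> * norm x powr (-\<nu>)) * indicator (near_set E j x) y \<partial>lborel)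
      \<le> (\<Sum>j. ennreal (BS * ((1/2)^j) powr (\<kappa>+f)) + (ennreal (K * 4 powr \<nu> * ((1/2)^j) powr (\<kappa>+h)) + ennreal (BL * ((1/2)^j) powr (\<kappa>+k))))"
      by (intro suminf_le J) auto
    also have "\<dots> = ennreal S1 + (ennreal S2 + ennreal S3)"
      unfolding S1(2)[symmetric] S2(2)[symmetric] S3(2)[symmetric]
      by (simp only: suminf_add[OF summableI summableI])
    also have "\<dots> = ennreal (S1 + (S2 + S3))"
      using S1 S2 S3 by simp
    finally show "(\<Sum>j. \<integral>\<^sup>+x. ennreal (((1/2)^j) powr \<kappa> * norm x powr (-\<nu>)) * indicator (near_set E j x) y \<partial>lborel) \<le> ennreal (S1 + (S2 + S3))" .
  qed
qed

lemma le_geometric_mean: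
  fixes N :: real
  assumes "0 \<le> N" "N \<le> A" "N \<le> B" "0 \<le> \<theta>" "\<theta> \<le> 1"
  shows "N \<le> A powr \<theta> * B powr (1 - \<theta>)"
proof (cases "N = 0")
  case False
  then have "N = N powr \<theta> * N powr (1 - \<theta>)" using assms by (simp add: powr_add[symmetric])
  also have "\<dots> \<le> A powr \<theta> * B powr (1 - \<theta>)"
    using assms by (intro mult_mono powr_mono2) auto
  finally show ?thesis .
qed (use assms in auto)

text \<open>Each of the last three hypotheses is the convergence of one geometric series:
  \<open>c1\<close> over small radii, \<open>c2\<close> over j for radii of order one,
  \<open>c3\<close> over j for small radii. The sum over j for large radii follows from
  \<open>c3\<close>, since (g - \<beta>)(b - \<mu>) \<ge> 0, and \<open>b < a\<close> is the q > p
  of the Schur test. Allowing \<open>g\<close> above the quasi-Assouad dimension is what the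
  triangle case exploits.\<close>

lemma radial_type_set_interior:
  assumes E: "E \<subseteq> {1..2}" "E \<noteq> {}" and \<beta>: "\<beta> = minkowski_dim E" and g: "g \<ge> quasi_assouad_dim E" "g \<le> 1"
    and \<mu>: "0 \<le> \<mu>" "\<mu> \<le> b" and ba: "b < a"
    and c1: "\<beta> * \<mu> < 2*b - a" and c2: "2*a < 1 + (1 - \<beta>) * b"
    and c3: "0 < 1/2 - a + b - g*b + (g - \<beta>)*\<mu>"
  shows "(a, b) \<in> radial_type_set E"
proof -
  have \<beta>01: "0 \<le> \<beta>" "\<beta> \<le> 1" unfolding \<beta> using minkowski_dim_nonneg[OF E] minkowski_dim_le_1[OF E] by auto
  have \<beta>g: "\<beta> \<le> g" unfolding \<beta> using minkowski_dim_le_quasi_assouad_dim[OF E] g by linarith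
  have "\<beta> * \<mu> \<ge> 0" using \<beta>01 \<mu> by simp
  then have b: "b > 0" using c1 ba by linarith
  have "(1 - \<beta>) * b \<le> b" using \<beta>01 b by (simp add: mult_left_le_one_le)
  then have a1: "a < 1" using c2 ba by linarith
  have b1: "b < 1" using a1 ba by simp
  have a: "a > 0" using b ba by simp
  \<comment> \<open>The smallest slack. Each exponent computed below loses at most 3 \<tau>, and 4
    \<tau> \<le> d.\<close>
  define d where "d = Min {2*b - a - \<beta> * \<mu>, 1/2 - a + b - g*b + (g - \<beta>)*\<mu>, (1 + (1 - \<beta>) * b - 2*a) / 2}"
  have d: "d > 0"
    unfolding d_def using c1 c2 c3 by (subst Min_gr_iff) auto
  have d2: "d \<le> 2*b - a - \<beta> * \<mu>" "d \<le> 1/2 - a + b - g*b + (g - \<beta>)*\<mu>" "d \<le> (1 + (1 - \<beta>) * b - 2*a) / 2"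
    unfolding d_def by (rule Min_le; simp)+
  define \<tau> where "\<tau> = min (1/2) (d / 4)"
  have \<tau>: "0 < \<tau>" "\<tau> < 1" "4 * \<tau> \<le> d" using d by (auto simp: \<tau>_def)
  \<comment> \<open>The covering bounds are available only for exponents strictly above the
    dimensions.\<close>
  define \<beta>' g' where "\<beta>' = \<beta> + \<tau>" and "g' = g + \<tau>"
  have g'0: "g' > 0" using \<beta>01 \<beta>g \<tau> by (simp add: g'_def)
  have "\<beta>' > minkowski_dim E" using \<tau> \<beta> by (simp add: \<beta>'_def)
  then obtain C1 where C1: "C1 > 0" "\<And>\<delta>. 0 < \<delta> \<Longrightarrow> \<delta> \<le> 1 \<Longrightarrow> real (cover_num E \<delta>) \<le> C1 * \<delta> powr (-\<beta>')"
    using cover_num_le_minkowski[OF E] by metis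
  have "g' > quasi_assouad_dim E" using \<tau> g by (simp add: g'_def)
  then obtain C2 where C2: "C2 > 0" "\<And>\<delta> l u v. 0 < \<delta> \<Longrightarrow> \<delta> \<le> 1 \<Longrightarrow> \<delta> \<le> l \<Longrightarrow> v - u \<le> l \<Longrightarrow>
    real (cover_num (E \<inter> {u..v}) \<delta>) \<le> C2 * \<delta> powr (-\<tau>) * (l / \<delta>) powr g'"
    using cover_num_le_quasi_assouad[OF E _ \<tau>(1,2)] by metis
  define \<theta> where "\<theta> = \<mu> / b"
  have \<theta>: "0 \<le> \<theta>" "\<theta> \<le> 1" using \<mu> b by (simp_all add: \<theta>_def)
  define C3 where "C3 = C1 powr \<theta> * (C2 * 36 powr g') powr (1 - \<theta>)"
  have C3: "C3 \<ge> 0" by (simp add: C3_def)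
  define e f h k where "e = 2 - \<tau> - \<beta>' * \<theta>" and "f = 1 - \<tau> - \<beta>' * \<theta> - g' * (1 - \<theta>)"
    and "h = (1 - \<beta>') / 2" and "k = 1 - \<beta>'"
  \<comment> \<open>408 = 12 * 2 * 17 is the constant of the area bound for small and large radii;
    the 336 = 12 * 4 * 7 of the middle range fits below it.\<close>
  define K where "K = 408 * pi * (C3 + C1)"
  have K: "K \<ge> 0" using C3 C1 by (simp add: K_def)
  have bdE: "bounded E" by (rule bounded_subset_12[OF E(1)])

  have small: "emeasure lborel {x. \<rho> \<le> norm x \<and> norm x \<le> 2*\<rho> \<and> y \<in> near_set E j x} \<le> ennreal (K * \<rho> powr e * ((1/2)^j) powr f)"
    if \<rho>: "0 < \<rho>" "\<rho> \<le> 1/4" for y \<rho> j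
  proof -
    define \<eta> :: real where "\<eta> = (1/2)^j"
    have \<eta>: "\<eta> > 0" "\<eta> \<le> 1" by (simp_all add: \<eta>_def power_le_one)
    define \<delta> where "\<delta> = \<rho> * \<eta>"
    have "\<rho> * \<eta> \<le> \<rho> * 1" using \<eta> \<rho> by (intro mult_left_mono) auto
    then have \<delta>2: "\<delta> \<le> \<rho>" by (simp add: \<delta>_def)
    moreover have "\<delta> > 0" using \<rho> \<eta> by (simp add: \<delta>_def)
    ultimately have \<delta>: "\<delta> > 0" "\<delta> \<le> \<rho>" "\<delta> \<le> 1" using \<rho> by linarith+
    define F where "F = E \<inter> {norm y - 18*\<rho>..norm y + 18*\<rho>}"
    define N where "N = real (cover_num F \<delta>)"
    have "emeasure lborel {x. \<rho> \<le> norm x \<and> norm x \<le> 2*\<rho> \<and> y \<in> near_set E j x} \<le> ennreal (12 * pi * (2*\<rho>) * (16 * \<delta> + \<delta>) * cover_num F \<delta>)"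
    proof (rule emeasure_near_circles_le)
      show "bounded F" unfolding F_def using bdE by (rule bounded_subset) auto
      show "{x. \<rho> \<le> norm x \<and> norm x \<le> 2*\<rho> \<and> y \<in> near_set E j x}
        \<subseteq> {x. norm x \<le> 2*\<rho> \<and> (\<exists>t\<in>F. \<bar>norm x + t - norm y\<bar> \<le> 16 * \<delta> \<or> \<bar>\<bar>norm x - t\<bar> - norm y\<bar> \<le> 16 * \<delta>)}"
      proof
        fix x assume x: "x \<in> {x. \<rho> \<le> norm x \<and> norm x \<le> 2*\<rho> \<and> y \<in> near_set E j x}"
        then have "0 < norm x" "norm x \<le> 2*\<rho>" "y \<in> near_set E j x" using \<rho>(1) by auto
        from near_set_small[OF E(1) this(1,2) \<rho>(2) this(3)] this(2)
        show "x \<in> {x. norm x \<le> 2*\<rho> \<and> (\<exists>t\<in>F. \<bar>norm x + t - norm y\<bar> \<le> 16 * \<delta> \<or> \<bar>\<bar>norm x - t\<bar> - norm y\<bar> \<le> 16 * \<delta>)}"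
          unfolding F_def \<delta>_def \<eta>_def by blast
      qed
    qed (use \<rho> \<delta> in auto)
    also have "\<dots> = ennreal (408 * pi * (\<rho> * \<delta>) * N)" by (simp add: N_def algebra_simps)
    also have "\<dots> \<le> ennreal (K * \<rho> powr e * \<eta> powr f)"
    proof (rule ennreal_leI)
      have "F \<subseteq> E" by (auto simp: F_def)
      then have "N \<le> real (cover_num E \<delta>)"
        unfolding N_def using cover_num_mono[OF \<delta>(1) bdE] by simp
      then have N1: "N \<le> C1 * \<delta> powr (-\<beta>')" using C1(2)[of \<delta>] \<delta> by linarith
      have "N \<le> C2 * \<delta> powr (-\<tau>) * ((36*\<rho>) / \<delta>) powr g'"
        unfolding N_def F_def using \<delta> \<rho> by (intro C2(2)) auto
      \<comment> \<open>The ratio of window to scale is independent of \<rho>: apart from the \<tau>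
        loss the Assouad bound stays bounded as \<rho> tends to 0, whereas the Minkowski bound grows
        but has the smaller power of 1/\<eta>. The geometric mean balances the two.\<close>
      also have "(36*\<rho>) / \<delta> = 36 * inverse \<eta>" using \<rho> by (simp add: \<delta>_def field_simps)
      also have "(36 * inverse \<eta>) powr g' = 36 powr g' * \<eta> powr (-g')"
        by (simp only: powr_mult powr_minus inverse_powr)
      finally have N2: "N \<le> C2 * 36 powr g' * (\<delta> powr (-\<tau>) * \<eta> powr (-g'))" by (simp add: mult_ac)
      have "N \<le> (C1 * \<delta> powr (-\<beta>')) powr \<theta> * (C2 * 36 powr g' * (\<delta> powr (-\<tau>) * \<eta> powr (-g'))) powr (1 - \<theta>)"
        using N1 N2 \<theta> by (intro le_geometric_mean) (auto simp: N_def)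
      also have "\<dots> = C3 * (\<delta> powr (-\<beta>' * \<theta>) * \<delta> powr (-\<tau> * (1 - \<theta>))) * \<eta> powr (-g' * (1 - \<theta>))"
        unfolding C3_def powr_mult[of _ _ "\<theta>"] powr_mult[of _ _ "1 - \<theta>"] powr_powr by (simp add: mult_ac)
      also have "\<dots> \<le> C3 * (\<delta> powr (-\<beta>' * \<theta>) * \<delta> powr (-\<tau>)) * \<eta> powr (-g' * (1 - \<theta>))"
      proof (intro mult_right_mono mult_left_mono)
        show "\<delta> powr (-\<tau> * (1 - \<theta>)) \<le> \<delta> powr (-\<tau>)"
          using \<delta> \<tau> \<theta> by (intro powr_mono') (auto simp: mult_left_le)
      qed (use C3 in auto)
      also have "\<delta> powr (-\<beta>' * \<theta>) * \<delta> powr (-\<tau>) = \<delta> powr (-\<tau> - \<beta>' * \<theta>)"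
        using powr_add[of \<delta> "-\<beta>' * \<theta>" "-\<tau>"] by (simp add: algebra_simps)
      finally have N3: "N \<le> C3 * \<delta> powr (-\<tau> - \<beta>' * \<theta>) * \<eta> powr (-g' * (1 - \<theta>))" .
      have "408 * pi * (\<rho> * \<delta>) * N \<le> 408 * pi * (\<rho> * \<delta>) * (C3 * \<delta> powr (-\<tau> - \<beta>' * \<theta>) * \<eta> powr (-g' * (1 - \<theta>)))"
        using \<rho> \<delta> by (intro mult_left_mono N3) auto
      also have "\<dots> = (408 * pi * C3) * (\<rho> * (\<delta> * \<delta> powr (-\<tau> - \<beta>' * \<theta>)) * \<eta> powr (-g' * (1 - \<theta>)))" by (simp add: mult_ac)
      also have "\<delta> * \<delta> powr (-\<tau> - \<beta>' * \<theta>) = \<delta> powr (1 - \<tau> - \<beta>' * \<theta>)"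
        using \<delta> powr_add[of \<delta> 1 "-\<tau> - \<beta>' * \<theta>"] by (simp add: algebra_simps)
      also have "\<delta> powr (1 - \<tau> - \<beta>' * \<theta>) = \<rho> powr (1 - \<tau> - \<beta>' * \<theta>) * \<eta> powr (1 - \<tau> - \<beta>' * \<theta>)"
        unfolding \<delta>_def by (rule powr_mult)
      also have "\<rho> * (\<rho> powr (1 - \<tau> - \<beta>' * \<theta>) * \<eta> powr (1 - \<tau> - \<beta>' * \<theta>)) * \<eta> powr (-g' * (1 - \<theta>)) =
        (\<rho> * \<rho> powr (1 - \<tau> - \<beta>' * \<theta>)) * (\<eta> powr (1 - \<tau> - \<beta>' * \<theta>) * \<eta> powr (-g' * (1 - \<theta>)))" by (simp only: mult_ac)
      also have "\<rho> * \<rho> powr (1 - \<tau> - \<beta>' * \<theta>) = \<rho> powr e"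
        using \<rho> powr_add[of \<rho> 1 "1 - \<tau> - \<beta>' * \<theta>"] by (simp add: e_def algebra_simps)
      also have "\<eta> powr (1 - \<tau> - \<beta>' * \<theta>) * \<eta> powr (-g' * (1 - \<theta>)) = \<eta> powr f"
        by (simp add: powr_add[symmetric] f_def)
      also have "(408 * pi * C3) * (\<rho> powr e * \<eta> powr f) \<le> K * (\<rho> powr e * \<eta> powr f)"
        unfolding K_def using C1 C3 by (intro mult_right_mono mult_left_mono) auto
      finally show "408 * pi * (\<rho> * \<delta>) * N \<le> K * \<rho> powr e * \<eta> powr f" by (simp only: mult.assoc)
    qed
    finally show ?thesis unfolding \<eta>_def .
  qed

  have middle: "emeasure lborel {x. 1/4 \<le> norm x \<and> norm x \<le> 4 \<and> y \<in> near_set E j x} \<le> ennreal (K * ((1/2)^j) powr h)" for y j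
  proof -
    define \<eta> :: real where "\<eta> = (1/2)^j"
    have \<eta>: "\<eta> > 0" "\<eta> \<le> 1" by (simp_all add: \<eta>_def power_le_one)
    have "emeasure lborel {x. 1/4 \<le> norm x \<and> norm x \<le> 4 \<and> y \<in> near_set E j x} \<le> ennreal (12 * pi * 4 * (6 * sqrt \<eta> + sqrt \<eta>) * cover_num E (sqrt \<eta>))"
    proof (rule emeasure_near_circles_le)
      show "{x. 1/4 \<le> norm x \<and> norm x \<le> 4 \<and> y \<in> near_set E j x}
        \<subseteq> {x. norm x \<le> 4 \<and> (\<exists>t\<in>E. \<bar>norm x + t - norm y\<bar> \<le> 6 * sqrt \<eta> \<or> \<bar>\<bar>norm x - t\<bar> - norm y\<bar> \<le> 6 * sqrt \<eta>)}"
        using near_set_middle[OF E(1)] unfolding \<eta>_def by blast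
    qed (use \<eta> bdE in auto)
    also have "\<dots> \<le> ennreal (K * \<eta> powr h)"
    proof (rule ennreal_leI)
      have "12 * pi * 4 * (6 * sqrt \<eta> + sqrt \<eta>) * cover_num E (sqrt \<eta>) = 336 * pi * sqrt \<eta> * cover_num E (sqrt \<eta>)" by simp
      also have "\<dots> \<le> 336 * pi * sqrt \<eta> * (C1 * sqrt \<eta> powr (-\<beta>'))"
        using \<eta> by (intro mult_left_mono C1) auto
      also have "\<dots> = 336 * pi * C1 * (sqrt \<eta> * sqrt \<eta> powr (-\<beta>'))" by simp
      also have "sqrt \<eta> * sqrt \<eta> powr (-\<beta>') = sqrt \<eta> powr (1 - \<beta>')"
        using \<eta> powr_add[of "sqrt \<eta>" 1 "-\<beta>'"] by simp
      also have "sqrt \<eta> powr (1 - \<beta>') = \<eta> powr h"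
        using \<eta> by (simp add: powr_half_sqrt[symmetric] powr_powr h_def)
      also have "336 * pi * C1 * \<eta> powr h \<le> K * \<eta> powr h"
        unfolding K_def using C1 C3 by (intro mult_right_mono mult_mono) auto
      finally show "12 * pi * 4 * (6 * sqrt \<eta> + sqrt \<eta>) * cover_num E (sqrt \<eta>) \<le> K * \<eta> powr h" .
    qed
    finally show ?thesis unfolding \<eta>_def .
  qed

  have large: "emeasure lborel {x. 4 \<le> norm x \<and> \<rho> \<le> norm x \<and> norm x \<le> 2*\<rho> \<and> y \<in> near_set E j x} \<le> ennreal (K * \<rho> * ((1/2)^j) powr k)"
    if \<rho>: "0 < \<rho>" for y \<rho> j
  proof -
    define \<eta> :: real where "\<eta> = (1/2)^j"
    have \<eta>: "\<eta> > 0" "\<eta> \<le> 1" by (simp_all add: \<eta>_def power_le_one)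
    have "emeasure lborel {x. 4 \<le> norm x \<and> \<rho> \<le> norm x \<and> norm x \<le> 2*\<rho> \<and> y \<in> near_set E j x} \<le> ennreal (12 * pi * (2*\<rho>) * (16 * \<eta> + \<eta>) * cover_num E \<eta>)"
    proof (rule emeasure_near_circles_le)
      show "{x. 4 \<le> norm x \<and> \<rho> \<le> norm x \<and> norm x \<le> 2*\<rho> \<and> y \<in> near_set E j x}
        \<subseteq> {x. norm x \<le> 2*\<rho> \<and> (\<exists>t\<in>E. \<bar>norm x + t - norm y\<bar> \<le> 16 * \<eta> \<or> \<bar>\<bar>norm x - t\<bar> - norm y\<bar> \<le> 16 * \<eta>)}"
        using near_set_large[OF E(1)] unfolding \<eta>_def by blast
    qed (use \<eta> \<rho> bdE in auto)
    also have "\<dots> \<le> ennreal (K * \<rho> * \<eta> powr k)"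
    proof (rule ennreal_leI)
      have "12 * pi * (2*\<rho>) * (16 * \<eta> + \<eta>) * cover_num E \<eta> = 408 * pi * (\<rho> * \<eta>) * cover_num E \<eta>" by simp
      also have "\<dots> \<le> 408 * pi * (\<rho> * \<eta>) * (C1 * \<eta> powr (-\<beta>'))"
        using \<eta> \<rho> by (intro mult_left_mono C1) auto
      also have "\<dots> = 408 * pi * C1 * (\<rho> * (\<eta> * \<eta> powr (-\<beta>')))" by simp
      also have "\<eta> * \<eta> powr (-\<beta>') = \<eta> powr k"
        using \<eta> powr_add[of \<eta> 1 "-\<beta>'"] by (simp add: k_def)
      also have "408 * pi * C1 * (\<rho> * \<eta> powr k) \<le> K * (\<rho> * \<eta> powr k)"
        unfolding K_def using C1 C3 \<rho> by (intro mult_right_mono mult_left_mono) auto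
      finally show "12 * pi * (2*\<rho>) * (16 * \<eta> + \<eta>) * cover_num E \<eta> \<le> K * \<rho> * \<eta> powr k" by (simp only: mult.assoc)
    qed
    finally show ?thesis unfolding \<eta>_def .
  qed

  define \<nu> where "\<nu> = a / b"
  \<comment> \<open>The total power of 2^(-j) in the Schur kernel for q = 1/b and q/p = \<nu>: q/2 -
    \<tau> q from the averages and the summation lemma, and - \<nu> from (r 2^(-j))^(-q/p).\<close>
  define \<kappa> where "\<kappa> = (1/b)/2 - \<tau> * (1/b) - \<nu>"
  have \<nu>1: "\<nu> > 1" using ba b by (simp add: \<nu>_def)
  have tb: "\<tau> * b \<le> \<tau>" using b1 \<tau> by (simp add: mult_left_le)
  have tm: "\<tau> * \<mu> \<le> \<tau>" using mult_left_mono[of \<mu> b \<tau>] tb \<mu> \<tau> by linarith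
  have tm0: "\<tau> * \<mu> \<ge> 0" "\<tau> * b \<ge> 0" using \<tau> \<mu> b by auto
  have ex1: "e - \<nu> > 0"
  proof -
    have "e - \<nu> = (2*b - a - \<beta> * \<mu> - \<tau> * b - \<tau> * \<mu>) / b"
      using b by (simp add: e_def \<nu>_def \<theta>_def \<beta>'_def field_simps)
    moreover have "2*b - a - \<beta> * \<mu> - \<tau> * b - \<tau> * \<mu> > 0" using d d2 \<tau> tb tm by linarith
    ultimately show ?thesis using b by simp
  qed
  have ex2: "\<kappa> + f > 0"
  proof -
    have "\<kappa> + f = ((1/2 - a + b - g*b + (g - \<beta>)*\<mu>) - \<tau> - 2 * (\<tau> * b)) / b"
      using b by (simp add: f_def \<kappa>_def \<nu>_def \<theta>_def \<beta>'_def g'_def field_simps)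
    moreover have "(1/2 - a + b - g*b + (g - \<beta>)*\<mu>) - \<tau> - 2 * (\<tau> * b) > 0" using d d2 \<tau> tb tm by linarith
    ultimately show ?thesis using b by simp
  qed
  have ex3: "\<kappa> + h > 0"
  proof -
    have "\<kappa> + h = ((1 + (1 - \<beta>) * b - 2*a) / 2 - \<tau> - \<tau> * b / 2) / b"
      using b by (simp add: h_def \<kappa>_def \<nu>_def \<beta>'_def field_simps)
    moreover have "(1 + (1 - \<beta>) * b - 2*a) / 2 - \<tau> - \<tau> * b / 2 > 0" using d d2 \<tau> tb tm0 by linarith
    ultimately show ?thesis using b by simp
  qed
  have ex4: "\<kappa> + k > 0"
  proof -
    have "(g - \<beta>) * (b - \<mu>) \<ge> 0" using \<beta>g \<mu> by simp
    then have "1/2 - a + b - \<beta> * b \<ge> 1/2 - a + b - g*b + (g - \<beta>)*\<mu>" by (simp add: algebra_simps)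
    moreover have "\<kappa> + k = (1/2 - a + b - \<beta> * b - \<tau> - \<tau> * b) / b"
      using b by (simp add: k_def \<kappa>_def \<nu>_def \<beta>'_def field_simps)
    moreover have "1/2 - a + b - g*b + (g - \<beta>)*\<mu> - \<tau> - \<tau> * b > 0" using d d2 \<tau> tb by linarith
    ultimately show ?thesis using b by (simp add: divide_pos_pos)
  qed
  obtain B where B: "B \<ge> 0"
    "\<And>y. (\<Sum>j. \<integral>\<^sup>+x. ennreal (((1/2)^j) powr \<kappa> * norm x powr (-\<nu>)) * indicator (near_set E j x) y \<partial>lborel) \<le> ennreal B"
    by (rule kernel_bound_from_areas[OF K \<nu>1 ex1 ex2 ex3 ex4 small middle large]) (assumption | (rule that; assumption))+
  have "max_bounded E (ennreal (1/a)) (ennreal (1/b))"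
  proof (rule max_bounded_if_kernel_bound[OF E(1) _ _ \<tau>(1) B(1)])
    show "1 \<le> 1/a" "1/a < 1/b" using a a1 b ba by (auto simp: field_simps)
    fix y :: "real^2"
    have "((1/2)^j) powr ((1/b)/2 - \<tau> * (1/b)) * (norm x * (1/2)^j) powr (- (1/b) / (1/a)) = ((1/2)^j) powr \<kappa> * norm x powr (-\<nu>)"
      for j and x :: "real^2"
    proof -
      have "- (1/b) / (1/a) = -\<nu>" by (simp add: \<nu>_def)
      then have "((1/2)^j) powr ((1/b)/2 - \<tau> * (1/b)) * (norm x * (1/2)^j) powr (- (1/b) / (1/a))
        = (((1/2)^j) powr ((1/b)/2 - \<tau> * (1/b)) * ((1/2)^j) powr (-\<nu>)) * norm x powr (-\<nu>)"
        by (simp only: powr_mult mult_ac)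
      also have "((1/2::real)^j) powr ((1/b)/2 - \<tau> * (1/b)) * ((1/2)^j) powr (-\<nu>) = ((1/2)^j) powr \<kappa>"
        unfolding \<kappa>_def by (simp only: powr_add[symmetric]) simp
      finally show ?thesis .
    qed
    then show "(\<Sum>j. \<integral>\<^sup>+x. ennreal (((1/2)^j) powr ((1/b)/2 - \<tau> * (1/b)) * (norm x * (1/2)^j) powr (- (1/b) / (1/a))) *
        indicator (near_set E j x) y \<partial>lborel) \<le> ennreal B"
      using B(2)[of y] by (simp only:)
  qed
  moreover have "1 \<le> ennreal (1/a)" "1 \<le> ennreal (1/b)"
    using a a1 b b1 by (auto simp: ennreal_ge_1)
  moreover have "enn2real (1 / ennreal (1/a)) = a" "enn2real (1 / ennreal (1/b)) = b"
    using a b divide_ennreal[of 1 "1/a"] divide_ennreal[of 1 "1/b"] by auto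
  ultimately show ?thesis
    unfolding radial_type_set_def by (intro CollectI exI[of _ "ennreal (1/a)"] exI[of _ "ennreal (1/b)"]) auto
qed

section \<open>Necessary conditions\<close>

abbreviation radial_ind :: "real set \<Rightarrow> real^2 \<Rightarrow> complex" where
  "radial_ind B \<equiv> (\<lambda>y. of_bool ((norm y)\<^sup>2 \<in> B))"

text \<open>u is the angle from the point of the circle closest to the origin, at \<phi> = pi after
  rotation, hence the minus sign before the cosine. The arc |u| \<le> \<psi> is the fraction \<psi>
  / pi of the circle. The indicator is integrable on the circle, so the value is a genuine average
  and not the \<infinity> of the convention.\<close>

lemma circle_avg_radial_ind_ge:
  assumes [measurable]: "B \<in> sets borel" and \<psi>: "0 \<le> \<psi>" "\<psi> \<le> pi"
    and B: "\<And>u. \<bar>u\<bar> \<le> \<psi> \<Longrightarrow> (norm x)\<^sup>2 + t\<^sup>2 - 2 * norm x * t * cos u \<in> B"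
  shows "ennreal (\<psi> / pi) \<le> abs_circ_avg (radial_ind B) t x"
proof -
  define A where "A = {\<phi>. (norm (circle_pt x t \<phi>))\<^sup>2 \<in> B}"
  have [measurable]: "A \<in> sets borel" unfolding A_def by measurable
  define M where "M = lebesgue_on {0..2*pi}"
  have fA: "(\<lambda>\<phi>. radial_ind B (circle_pt x t \<phi>)) = (\<lambda>\<phi>. complex_of_real (indicator A \<phi>))"
    by (auto simp: A_def indicator_def)
  have fin: "emeasure M (A \<inter> {0..2*pi}) = emeasure lborel (A \<inter> {0..2*pi})"
    unfolding M_def by (subst emeasure_restrict_space) auto
  have "emeasure lborel (A \<inter> {0..2*pi}) \<le> emeasure lborel {0..2*pi}"
    by (rule emeasure_mono) auto
  then have fin2: "emeasure lborel (A \<inter> {0..2*pi}) < \<infinity>"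
    by (rule le_less_trans) simp
  have spM: "space M = {0..2*pi}" by (simp add: M_def space_restrict_space)
  have "A \<inter> {0..2*pi} \<in> sets M"
    unfolding M_def by (subst sets_restrict_space_iff) auto
  then have intr: "integrable M (\<lambda>\<phi>. indicator (A \<inter> {0..2*pi}) \<phi> :: real)"
    using fin fin2 by (intro integrable_real_indicator) auto
  have "indicator A \<phi> = (indicator (A \<inter> {0..2*pi}) \<phi> :: real)" if "\<phi> \<in> space M" for \<phi>
    using that by (simp add: spM indicator_def)
  then have "integrable M (indicator A :: real \<Rightarrow> real) = integrable M (indicator (A \<inter> {0..2*pi}) :: real \<Rightarrow> real)"
    by (rule Bochner_Integration.integrable_cong[OF refl])
  then have intA: "integrable M (indicator A :: real \<Rightarrow> real)"
    using intr by (rule iffD2)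
  then have int: "integrable M (\<lambda>\<phi>. complex_of_real (indicator A \<phi>))"
    by (rule integrable_of_real)
  have "integral\<^sup>L M (\<lambda>\<phi>. complex_of_real (indicator A \<phi>)) = complex_of_real (integral\<^sup>L M (indicator A))"
    by (rule integral_of_real[OF intA])
  also have "integral\<^sup>L M (indicator A :: real \<Rightarrow> real) = integral\<^sup>L M (indicator (A \<inter> {0..2*pi}))"
    by (rule Bochner_Integration.integral_cong) (auto simp: spM indicator_def)
  also have "\<dots> = measure lborel (A \<inter> {0..2*pi})"
    using fin by (simp add: spM measure_def)
  finally have I: "integral\<^sup>L M (\<lambda>\<phi>. complex_of_real (indicator A \<phi>)) = complex_of_real (measure lborel (A \<inter> {0..2*pi}))" .
  have "ennreal (2 * \<psi>) = (\<integral>\<^sup>+\<phi>. indicator {pi - \<psi>..pi + \<psi>} \<phi> \<partial>lborel)"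
    using \<psi> by simp
  also have "\<dots> \<le> (\<integral>\<^sup>+\<phi>. indicator B ((norm x)\<^sup>2 + t\<^sup>2 + 2 * norm x * t * cos \<phi>) * indicator {0..2*pi} \<phi> \<partial>lborel)"
  proof (intro nn_integral_mono)
    fix \<phi> :: real
    show "indicator {pi - \<psi>..pi + \<psi>} \<phi> \<le> (indicator B ((norm x)\<^sup>2 + t\<^sup>2 + 2 * norm x * t * cos \<phi>) * indicator {0..2*pi} \<phi> :: ennreal)"
    proof (cases "\<phi> \<in> {pi - \<psi>..pi + \<psi>}")
      case True
      then have "\<bar>\<phi> - pi\<bar> \<le> \<psi>" by auto
      from B[OF this] have "(norm x)\<^sup>2 + t\<^sup>2 + 2 * norm x * t * cos \<phi> \<in> B"
        by (simp add: cos_diff)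
      moreover have "\<phi> \<in> {0..2*pi}" using True \<psi> by auto
      ultimately show ?thesis by (simp add: indicator_def)
    qed simp
  qed
  also have "\<dots> = (\<integral>\<^sup>+\<phi>. indicator B ((norm (circle_pt x t \<phi>))\<^sup>2) * indicator {0..2*pi} \<phi> \<partial>lborel)"
    by (rule nn_integral_circle_pt[symmetric]) measurable
  also have "\<dots> = (\<integral>\<^sup>+\<phi>. indicator (A \<inter> {0..2*pi}) \<phi> \<partial>lborel)"
    by (rule nn_integral_cong) (simp add: A_def indicator_def)
  also have "\<dots> = ennreal (measure lborel (A \<inter> {0..2*pi}))"
    using fin2 by (simp add: emeasure_eq_ennreal_measure)
  finally have "2 * \<psi> \<le> measure lborel (A \<inter> {0..2*pi})" by simp
  then have "\<psi> / pi \<le> 1 / (2*pi) * measure lborel (A \<inter> {0..2*pi})"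
    by (simp add: field_simps)
  also have "\<dots> = norm (circ_avg (radial_ind B) t x)"
    unfolding circ_avg_def fA M_def[symmetric] I by (simp add: norm_mult)
  finally show ?thesis
    using int unfolding abs_circ_avg_def circ_integrable_def fA M_def[symmetric] by (simp add: ennreal_leI)
qed

lemma enn2real_1_divide: "q > 0 \<Longrightarrow> enn2real (1 / ennreal q) = 1 / q"
  using divide_ennreal[of 1 q] by simp

text \<open>Chebyshev's inequality for finite q. For q = \<infinity> the power of m is m^0 = 1, and
  a set of positive measure on which G \<ge> c keeps the essential supremum at c or above.\<close>

lemma Lp_norm_ge:
  assumes q: "1 \<le> q" and T: "T \<in> sets borel" "emeasure lborel T = ennreal m" "m > 0" and c: "c \<ge> 0"
    and G: "\<And>x. x \<in> T \<Longrightarrow> ennreal c \<le> G x"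
  shows "ennreal (c * m powr enn2real (1/q)) \<le> Lp_norm q G"
proof (cases q)
  case (real r)
  then have r: "r \<ge> 1" using q by simp
  have "ennreal (c powr r * m) = (\<integral>\<^sup>+x. ennreal (c powr r) * indicator T x \<partial>lborel)"
    using T by (simp add: nn_integral_cmult_indicator ennreal_mult)
  also have "\<dots> \<le> (\<integral>\<^sup>+x. ennreal_powr (G x) r \<partial>lborel)"
  proof (rule nn_integral_mono)
    fix x
    show "ennreal (c powr r) * indicator T x \<le> ennreal_powr (G x) r"
      using ennreal_powr_mono[OF G[of x], of r] r c by (cases "x \<in> T") (auto simp: ennreal_powr_ennreal)
  qed
  finally have "ennreal_powr (ennreal (c powr r * m)) (1/r) \<le> ennreal_powr (\<integral>\<^sup>+x. ennreal_powr (G x) r \<partial>lebesgue) (1/r)"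
    unfolding nn_integral_completion using r by (intro ennreal_powr_mono) auto
  moreover have "(c powr r * m) powr (1/r) = c * m powr (1/r)"
    using r c T by (simp add: powr_mult powr_powr)
  ultimately show ?thesis
    using r T real by (simp add: Lp_norm_def ennreal_powr_ennreal enn2real_1_divide)
next
  case top
  have "ennreal c \<le> Limsup (ae_filter lebesgue) G"
  proof (rule ccontr)
    assume "\<not> ennreal c \<le> Limsup (ae_filter lebesgue) G"
    then have "AE x in lebesgue. G x < ennreal c"
      using Limsup_lessD[of "ae_filter lebesgue" G "ennreal c"] by (simp add: not_le)
    then have "AE x in lebesgue. x \<notin> T"
      by eventually_elim (use G in \<open>auto simp: not_le[symmetric]\<close>)
    then have "AE x in lborel. x \<notin> T"
      by (simp add: AE_completion_iff)
    then have "emeasure lborel T = 0"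
      using T(1) by (subst (asm) AE_iff_measurable[OF _ refl]) auto
    then show False using T by simp
  qed
  then show ?thesis using T(3) by (simp add: Lp_norm_def top)
qed

lemma Lp_norm_radial_ind_le:
  assumes p: "1 \<le> p" and B: "B \<in> sets borel" "emeasure lborel {y::real^2. (norm y)\<^sup>2 \<in> B} = ennreal m" "m > 0"
  shows "Lp_norm p (\<lambda>x. ennreal (norm (radial_ind B x))) \<le> ennreal (m powr enn2real (1/p))"
proof (cases p)
  case (real r)
  then have r: "r \<ge> 1" using p by simp
  have "(\<integral>\<^sup>+x. ennreal_powr (ennreal (norm (radial_ind B x))) r \<partial>lborel) = (\<integral>\<^sup>+x. indicator {y::real^2. (norm y)\<^sup>2 \<in> B} x \<partial>lborel)"
    using r by (intro nn_integral_cong) (auto simp: ennreal_powr_ennreal indicator_def ennreal_powr_def)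
  also have "\<dots> = ennreal m"
  proof -
    have "{y::real^2. (norm y)\<^sup>2 \<in> B} \<in> sets lborel" using B(1) by measurable
    then show ?thesis using B(2) by simp
  qed
  finally show ?thesis
    using r B real by (simp add: Lp_norm_def nn_integral_completion ennreal_powr_ennreal enn2real_1_divide)
next
  case top
  have "Limsup (ae_filter lebesgue) (\<lambda>x. ennreal (norm (radial_ind B x))) \<le> 1"
    by (rule Limsup_bounded) (auto intro!: always_eventually)
  then show ?thesis using B(3) by (simp add: Lp_norm_def top)
qed

text \<open>What boundedness says about indicators of radial sets, expressed through a = 1/p and b =
  1/q alone: an infinite p or q becomes a = 0 or b = 0, and only real powers of areas
  remain.\<close>

definition indicator_test :: "real set \<Rightarrow> real \<Rightarrow> real \<Rightarrow> real \<Rightarrow> bool" where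
  "indicator_test E a b C \<longleftrightarrow> (\<forall>B T s m c. B \<in> sets borel \<longrightarrow>
     emeasure lborel {y::real^2. (norm y)\<^sup>2 \<in> B} = ennreal s \<longrightarrow> s > 0 \<longrightarrow>
     T \<in> sets borel \<longrightarrow> emeasure lborel T = ennreal m \<longrightarrow> m > 0 \<longrightarrow> c \<ge> 0 \<longrightarrow>
     (\<forall>x\<in>T. \<exists>t\<in>E. ennreal c \<le> abs_circ_avg (radial_ind B) t x) \<longrightarrow>
     c * m powr b \<le> C * s powr a)"

lemma indicator_testD:
  assumes "indicator_test E a b C"
    and "B \<in> sets borel" "emeasure lborel {y::real^2. (norm y)\<^sup>2 \<in> B} = ennreal s" "s > 0"
    and "T \<in> sets borel" "emeasure lborel T = ennreal m" "m > 0" "c \<ge> 0"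
    and "\<And>x. x \<in> T \<Longrightarrow> \<exists>t\<in>E. ennreal c \<le> abs_circ_avg (radial_ind B) t x"
  shows "c * m powr b \<le> C * s powr a"
  using assms unfolding indicator_test_def by blast

lemma max_bounded_imp_indicator_test:
  assumes "max_bounded E p q" "1 \<le> p" "1 \<le> q"
  obtains C where "C > 0" "indicator_test E (enn2real (1/p)) (enn2real (1/q)) C"
proof -
  obtain C where C: "\<And>f. f \<in> Lp_rad p \<Longrightarrow> Lp_norm q (max_fun E f) \<le> ennreal C * Lp_norm p (\<lambda>x. ennreal (norm (f x)))"
    using assms(1) unfolding max_bounded_def by blast
  show ?thesis
  \<comment> \<open>\<open>C\<close> in \<open>max_bounded\<close> may be negative, where
    \<open>ennreal\<close> reads 0; the maximum makes it positive.\<close>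
  proof (rule that[of "max C 1"])
    show "indicator_test E (enn2real (1/p)) (enn2real (1/q)) (max C 1)"
      unfolding indicator_test_def
    proof (intro allI impI)
      fix B T s m c
      assume B: "B \<in> sets borel" "emeasure lborel {y::real^2. (norm y)\<^sup>2 \<in> B} = ennreal s" "s > 0"
        and T: "T \<in> sets borel" "emeasure lborel T = ennreal m" "m > 0" and c: "c \<ge> 0"
        and av: "\<forall>x\<in>T. \<exists>t\<in>E. ennreal c \<le> abs_circ_avg (radial_ind B) t x"
      have le: "Lp_norm p (\<lambda>x. ennreal (norm (radial_ind B x))) \<le> ennreal (s powr enn2real (1/p))"
        by (rule Lp_norm_radial_ind_le[OF assms(2) B])
      have meas: "radial_ind B \<in> borel_measurable lebesgue"
      proof -
        have "{y::real^2. (norm y)\<^sup>2 \<in> B} \<in> sets borel" using B(1) by measurable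
        then have "(indicator {y::real^2. (norm y)\<^sup>2 \<in> B} :: _ \<Rightarrow> complex) \<in> borel_measurable lebesgue"
          by (intro borel_measurable_indicator) auto
        also have "indicator {y::real^2. (norm y)\<^sup>2 \<in> B} = radial_ind B"
          by (auto simp: indicator_def fun_eq_iff)
        finally show ?thesis .
      qed
      have f: "radial_ind B \<in> Lp_rad p"
        unfolding Lp_rad_def using meas le by (auto simp: radial_def le_less_trans[OF _ ennreal_less_top])
      have "ennreal (c * m powr enn2real (1/q)) \<le> Lp_norm q (max_fun E (radial_ind B))"
      proof (rule Lp_norm_ge[OF assms(3) T c])
        fix x assume "x \<in> T"
        then show "ennreal c \<le> max_fun E (radial_ind B) x"
          unfolding max_fun_def using av by (meson SUP_upper2)
      qed
      also have "\<dots> \<le> ennreal C * Lp_norm p (\<lambda>x. ennreal (norm (radial_ind B x)))"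
        by (rule C[OF f])
      also have "\<dots> \<le> ennreal (max C 1) * ennreal (s powr enn2real (1/p))"
        by (intro mult_mono le ennreal_leI) auto
      also have "\<dots> = ennreal (max C 1 * s powr enn2real (1/p))"
        by (rule ennreal_mult[symmetric]) auto
      finally show "c * m powr enn2real (1/q) \<le> max C 1 * s powr enn2real (1/p)"
        by (subst (asm) ennreal_le_iff) auto
    qed
  qed simp
qed

lemma powr_le_imp_exponent_le_at_top:
  fixes D z0 \<alpha> \<beta> :: real
  assumes "\<And>z. z \<ge> z0 \<Longrightarrow> z > 0 \<Longrightarrow> z powr \<alpha> \<le> D * z powr \<beta>"
  shows "\<alpha> \<le> \<beta>"
proof (rule ccontr)
  assume "\<not> \<alpha> \<le> \<beta>"
  then have d: "\<alpha> - \<beta> > 0" by simp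
  define z where "z = max (max z0 1) ((\<bar>D\<bar> + 1) powr (1 / (\<alpha> - \<beta>)))"
  have z: "z \<ge> z0" "z \<ge> 1" "z \<ge> (\<bar>D\<bar> + 1) powr (1 / (\<alpha> - \<beta>))" by (auto simp: z_def)
  have "\<bar>D\<bar> + 1 = ((\<bar>D\<bar> + 1) powr (1 / (\<alpha> - \<beta>))) powr (\<alpha> - \<beta>)"
    using d by (simp add: powr_powr)
  also have "\<dots> \<le> z powr (\<alpha> - \<beta>)"
    using z d by (intro powr_mono2) auto
  finally have "\<bar>D\<bar> + 1 \<le> z powr (\<alpha> - \<beta>)" .
  moreover have "z powr \<alpha> \<le> D * z powr \<beta>" using z by (intro assms) auto
  then have "z powr (\<alpha> - \<beta>) \<le> D" using z by (simp add: powr_diff divide_le_eq)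
  ultimately show False by linarith
qed

lemma powr_le_imp_exponent_le_at_0:
  fixes D d \<alpha> \<beta> :: real
  assumes "d > 0" "\<And>z. 0 < z \<Longrightarrow> z < d \<Longrightarrow> z powr \<alpha> \<le> D * z powr \<beta>"
  shows "\<beta> \<le> \<alpha>"
proof -
  have "-\<alpha> \<le> -\<beta>"
  proof (rule powr_le_imp_exponent_le_at_top)
    fix z :: real assume z: "z \<ge> 2 / d" "z > 0"
    have "1 / z < d" using z assms(1) by (simp add: field_simps)
    then have "(1/z) powr \<alpha> \<le> D * (1/z) powr \<beta>" using z by (intro assms(2)) auto
    then show "z powr (-\<alpha>) \<le> D * z powr (-\<beta>)" using z by (simp add: powr_divide powr_minus_divide)
  qed
  then show ?thesis by simp
qed

lemma emeasure_radial_interval: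
  assumes "0 \<le> l" "l \<le> u"
  shows "emeasure lborel {y::real^2. (norm y)\<^sup>2 \<in> {l..u}} = ennreal (pi * (u - l))"
proof -
  have "{l..u} \<inter> {0..} = {l..u}" using assms by auto
  then show ?thesis
    using assms by (subst emeasure_norm_power2_vimage) (auto simp: ennreal_mult)
qed

lemma cos_ge_quadratic: "1 - u\<^sup>2 / 2 \<le> cos (u::real)"
proof -
  have "(sin (u/2))\<^sup>2 \<le> (u/2)\<^sup>2"
    using abs_sin_x_le_abs_x[of "u/2"] by (metis abs_le_square_iff)
  moreover have "cos u = 1 - 2 * (sin (u/2))\<^sup>2"
    using cos_double_sin[of "u/2"] by simp
  ultimately show ?thesis by (simp add: power_divide)
qed

lemma powr_scaled_power2: "z > 0 \<Longrightarrow> (c * z\<^sup>2) powr e = c powr e * z powr (2 * e)" for z c e :: real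
proof -
  assume "z > 0"
  then have "z\<^sup>2 = z powr 2" by simp
  then show ?thesis by (simp only: powr_mult powr_powr)
qed

text \<open>The third bound rests on 1 - cos u \<le> u^2/2 and decides how long an arc around the
  point closest to the origin stays in a thin annulus or a small disc.\<close>

lemma circle_param_bounds:
  fixes r t u :: real
  assumes "0 \<le> r" "0 \<le> t"
  shows "(r - t)\<^sup>2 \<le> r\<^sup>2 + t\<^sup>2 - 2 * r * t * cos u" "r\<^sup>2 + t\<^sup>2 - 2 * r * t * cos u \<le> (r + t)\<^sup>2"
    "r\<^sup>2 + t\<^sup>2 - 2 * r * t * cos u \<le> (r - t)\<^sup>2 + r * t * u\<^sup>2"
    "0 \<le> r\<^sup>2 + t\<^sup>2 - 2 * r * t * cos u"
proof -
  have rt: "r * t \<ge> 0" using assms by simp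
  have "(r * t) * cos u \<le> (r * t) * 1" using rt by (intro mult_left_mono) auto
  then show 1: "(r - t)\<^sup>2 \<le> r\<^sup>2 + t\<^sup>2 - 2 * r * t * cos u" by (simp add: power2_diff)
  show "0 \<le> r\<^sup>2 + t\<^sup>2 - 2 * r * t * cos u" using 1 zero_le_power2[of "r - t"] by linarith
  have "(r * t) * (-1) \<le> (r * t) * cos u" using rt by (intro mult_left_mono) auto
  then show "r\<^sup>2 + t\<^sup>2 - 2 * r * t * cos u \<le> (r + t)\<^sup>2" by (simp add: power2_sum)
  have "(r * t) * (1 - u\<^sup>2 / 2) \<le> (r * t) * cos u" using rt by (intro mult_left_mono cos_ge_quadratic) auto
  then show "r\<^sup>2 + t\<^sup>2 - 2 * r * t * cos u \<le> (r - t)\<^sup>2 + r * t * u\<^sup>2" by (simp add: power2_diff algebra_simps)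
qed

section \<open>The three sides of the triangle\<close>

context
  fixes E :: "real set" and a b C :: real
  assumes E: "E \<subseteq> {1..2}" "E \<noteq> {}" and b0: "b \<ge> 0" and C0: "C > 0" and test: "indicator_test E a b C"
begin

text \<open>A disc of radius R has averages 1 on the disc of radius R - 2, because t \<le> 2. Both
  areas grow like R^2, and R tends to infinity.\<close>

lemma necessary_q_ge_p: "b \<le> a"
proof -
  obtain t where "t \<in> E" using E(2) by blast
  then have t: "t \<in> E" "1 \<le> t" "t \<le> 2" using E(1) by auto
  have "2 * b \<le> 2 * a"
  proof (rule powr_le_imp_exponent_le_at_top)
    fix R :: real assume R: "R \<ge> 4" "R > 0"
    have "1 * (pi * (R - 2)\<^sup>2) powr b \<le> C * (pi * R\<^sup>2) powr a"
    proof (rule indicator_testD[OF test, where B = "{0..R\<^sup>2}" and T = "cball 0 (R - 2)"])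
      show "emeasure lborel {y::real^2. (norm y)\<^sup>2 \<in> {0..R\<^sup>2}} = ennreal (pi * R\<^sup>2)"
        using emeasure_radial_interval[of 0 "R\<^sup>2"] by simp
      show "emeasure lborel (cball (0 :: real^2) (R - 2)) = ennreal (pi * (R - 2)\<^sup>2)"
        using R by (intro emeasure_cball_plane) auto
      fix x :: "real^2" assume x: "x \<in> cball 0 (R - 2)"
      have "ennreal (pi / pi) \<le> abs_circ_avg (radial_ind {0..R\<^sup>2}) t x"
      proof (rule circle_avg_radial_ind_ge)
        fix u :: real
        have "(norm x + t)\<^sup>2 \<le> R\<^sup>2" using x t by (intro power_mono) auto
        then show "(norm x)\<^sup>2 + t\<^sup>2 - 2 * norm x * t * cos u \<in> {0..R\<^sup>2}"
          unfolding atLeastAtMost_iff using circle_param_bounds(2,4)[of "norm x" t u] t norm_ge_zero[of x] by linarith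
      qed auto
      then show "\<exists>t\<in>E. ennreal 1 \<le> abs_circ_avg (radial_ind {0..R\<^sup>2}) t x"
        using t by auto
    qed (use R in auto)
    moreover have "(pi / 4 * R\<^sup>2) powr b \<le> (pi * (R - 2)\<^sup>2) powr b"
    proof (rule powr_mono2[OF b0])
      have "(R / 2)\<^sup>2 \<le> (R - 2)\<^sup>2" using R by (intro power_mono) auto
      then have "pi * (R / 2)\<^sup>2 \<le> pi * (R - 2)\<^sup>2" by (intro mult_left_mono) auto
      then show "pi / 4 * R\<^sup>2 \<le> pi * (R - 2)\<^sup>2" by (simp add: power_divide)
    qed simp
    ultimately have "(pi / 4) powr b * R powr (2 * b) \<le> C * (pi powr a * R powr (2 * a))"
      unfolding powr_scaled_power2[OF R(2)] by linarith
    then show "R powr (2 * b) \<le> (C * pi powr a / (pi / 4) powr b) * R powr (2 * a)"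
      by (simp add: field_simps)
  qed
  then show ?thesis by simp
qed

text \<open>If |x| \<le> \<delta>, the circle of radius t about x stays within \<delta> of the norm
  t: an annulus of area of order \<delta> has averages 1 on a disc of area of order
  \<delta>^2.\<close>

lemma necessary_q_le_2p: "a \<le> 2 * b"
proof -
  obtain t where "t \<in> E" using E(2) by blast
  then have t: "t \<in> E" "1 \<le> t" "t \<le> 2" using E(1) by auto
  show ?thesis
  proof (rule powr_le_imp_exponent_le_at_0)
    show "(0::real) < 1" by simp
    fix \<delta> :: real assume \<delta>: "0 < \<delta>" "\<delta> < 1"
    define B where "B = {(t - \<delta>)\<^sup>2..(t + \<delta>)\<^sup>2}"
    have "1 * (pi * \<delta>\<^sup>2) powr b \<le> C * (4 * pi * t * \<delta>) powr a"
    proof (rule indicator_testD[OF test, where B = B and T = "cball 0 \<delta>"])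
      have "(t - \<delta>)\<^sup>2 \<le> (t + \<delta>)\<^sup>2" using t \<delta> by (intro power_mono) auto
      then have "emeasure lborel {y::real^2. (norm y)\<^sup>2 \<in> B} = ennreal (pi * ((t + \<delta>)\<^sup>2 - (t - \<delta>)\<^sup>2))"
        unfolding B_def by (intro emeasure_radial_interval) auto
      also have "pi * ((t + \<delta>)\<^sup>2 - (t - \<delta>)\<^sup>2) = 4 * pi * t * \<delta>" by (simp add: power2_eq_square algebra_simps)
      finally show "emeasure lborel {y::real^2. (norm y)\<^sup>2 \<in> B} = ennreal (4 * pi * t * \<delta>)" .
      show "emeasure lborel (cball (0 :: real^2) \<delta>) = ennreal (pi * \<delta>\<^sup>2)"
        using \<delta> by (intro emeasure_cball_plane) auto
      fix x :: "real^2" assume x: "x \<in> cball 0 \<delta>"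
      have "ennreal (pi / pi) \<le> abs_circ_avg (radial_ind B) t x"
      proof (rule circle_avg_radial_ind_ge)
        fix u :: real
        have "(norm x + t)\<^sup>2 \<le> (t + \<delta>)\<^sup>2" using x t by (intro power_mono) auto
        moreover have "(t - \<delta>)\<^sup>2 \<le> (t - norm x)\<^sup>2" using x t \<delta> by (intro power_mono) auto
        ultimately show "(norm x)\<^sup>2 + t\<^sup>2 - 2 * norm x * t * cos u \<in> B"
          unfolding B_def atLeastAtMost_iff power2_commute[of t "norm x"]
          using circle_param_bounds(1,2)[of "norm x" t u] t norm_ge_zero[of x] by linarith
      qed (auto simp: B_def)
      then show "\<exists>t\<in>E. ennreal 1 \<le> abs_circ_avg (radial_ind B) t x"
        using t by auto
    qed (use \<delta> t in \<open>auto simp: B_def\<close>)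
    then have "pi powr b * \<delta> powr (2 * b) \<le> C * ((4 * pi * t) powr a * \<delta> powr a)"
      unfolding powr_scaled_power2[OF \<delta>(1)] powr_mult[of "4 * pi * t" \<delta> a] by simp
    then show "\<delta> powr (2 * b) \<le> (C * (4 * pi * t) powr a / pi powr b) * \<delta> powr a"
      by (simp add: field_simps)
  qed
qed

text \<open>For a disc of radius of order \<delta>, averages of size \<delta> occur at every x whose
  norm is within \<delta> of \<open>E\<close>, a set \<open>T\<close> of area at least of order N
  \<delta>. Hence \<delta> (N \<delta>)^b is at most of order \<delta>^(2a).\<close>

lemma cover_num_powr_le:
  obtains D where "D > 0" "\<And>\<delta>. 0 < \<delta> \<Longrightarrow> \<delta> < 1 \<Longrightarrow> real (cover_num E \<delta>) powr b \<le> D * \<delta> powr (2*a - 1 - b)"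
proof -
  show ?thesis
  proof (rule that[of "C * (7 * pi) powr a * pi / pi powr b"])
    show "C * (7 * pi) powr a * pi / pi powr b > 0" using C0 by simp
    fix \<delta> :: real assume \<delta>: "0 < \<delta>" "\<delta> < 1"
    define N where "N = real (cover_num E \<delta>)"
    define T where "T = (\<Union>t\<in>E. {x::real^2. \<bar>norm x - t\<bar> < \<delta>})"
    have "open T" unfolding T_def by (intro open_UN ballI open_Collect_less continuous_intros)
    then have [measurable]: "T \<in> sets borel" by simp
    have "T \<subseteq> cball 0 4" using E \<delta> unfolding T_def by fastforce
    then have "emeasure lborel T \<le> emeasure lborel (cball (0::real^2) 4)" by (intro emeasure_mono) auto
    also have "\<dots> < \<infinity>" by (simp add: emeasure_cball_plane)
    finally obtain m where m: "emeasure lborel T = ennreal m" "m \<ge> 0"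
      by (cases "emeasure lborel T") auto
    \<comment> \<open>For the lower bound on the area of \<open>T\<close>: the cells from i \<delta>
      to (i+1) \<delta> that meet \<open>E\<close> form a cover, so there are at least N of them,
      and their shells \<open>A i\<close> are disjoint parts of \<open>T\<close> of area at least pi
      \<delta>.\<close>
    define I where "I = {i::nat. \<exists>t\<in>E. real i * \<delta> \<le> t \<and> t < real (Suc i) * \<delta>}"
    define A where "A i = {x::real^2. (norm x)\<^sup>2 \<in> {(real i * \<delta>)\<^sup>2..<(real (Suc i) * \<delta>)\<^sup>2}}" for i
    have finI: "finite I"
    proof (rule finite_subset)
      show "I \<subseteq> {..nat \<lceil>2 / \<delta>\<rceil>}"
      proof
        fix i assume "i \<in> I"
        then have "real i * \<delta> \<le> 2" using E by (auto simp: I_def)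
        then have "real i \<le> 2 / \<delta>" using \<delta> by (simp add: le_divide_eq)
        then show "i \<in> {..nat \<lceil>2 / \<delta>\<rceil>}" by (simp add: le_nat_iff le_ceiling_iff)
      qed
    qed simp
    have covE: "\<exists>i\<in>I. real i * \<delta> \<le> t \<and> t < real (Suc i) * \<delta>" if "t \<in> E" for t
    proof -
      define i where "i = nat \<lfloor>t / \<delta>\<rfloor>"
      have "t / \<delta> \<ge> 0" using that E \<delta> by auto
      then have "real i \<le> t / \<delta>" "t / \<delta> < real i + 1" by (simp_all add: i_def)
      then have "real i * \<delta> \<le> t" "t < real (Suc i) * \<delta>" using \<delta> by (simp_all add: field_simps)
      with that show ?thesis unfolding I_def by blast
    qed
    have "cover_num E \<delta> \<le> card ((\<lambda>i. real i * \<delta>) ` I)"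
    proof (rule cover_num_le_card)
      show "E \<subseteq> (\<Union>a\<in>(\<lambda>i. real i * \<delta>) ` I. {a..a + \<delta>})"
      proof
        fix t assume "t \<in> E"
        from covE[OF this] obtain i where "i \<in> I" "real i * \<delta> \<le> t" "t < real (Suc i) * \<delta>" by blast
        then show "t \<in> (\<Union>a\<in>(\<lambda>i. real i * \<delta>) ` I. {a..a + \<delta>})" by (auto simp: algebra_simps intro!: bexI[of _ i])
      qed
    qed (use finI in simp)
    also have "\<dots> \<le> card I" by (rule card_image_le[OF finI])
    finally have NI: "N \<le> real (card I)" by (simp add: N_def)
    have Am [measurable]: "A i \<in> sets borel" for i unfolding A_def by measurable
    have Ameas: "ennreal (pi * \<delta>) \<le> emeasure lborel (A i)" if i: "i \<in> I" for i
    proof -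
      obtain t where "t \<in> E" "t < real (Suc i) * \<delta>" using i unfolding I_def by blast
      then have "1 < real (Suc i) * \<delta>" using E by force
      also have "\<dots> \<le> real (2 * i + 1) * \<delta>" using \<delta> by (intro mult_right_mono) auto
      finally have "1 \<le> real (2 * i + 1) * \<delta>" by simp
      then have "pi * \<delta> * 1 \<le> pi * \<delta> * (real (2 * i + 1) * \<delta>)" using \<delta> by (intro mult_left_mono) auto
      also have "pi * \<delta> * (real (2 * i + 1) * \<delta>) = pi * ((real (Suc i) * \<delta>)\<^sup>2 - (real i * \<delta>)\<^sup>2)"
        by (simp add: power2_eq_square algebra_simps)
      finally have "pi * \<delta> \<le> pi * ((real (Suc i) * \<delta>)\<^sup>2 - (real i * \<delta>)\<^sup>2)" by simp
      moreover have "(real i * \<delta>)\<^sup>2 \<le> (real (Suc i) * \<delta>)\<^sup>2" using \<delta> by (intro power_mono mult_right_mono) auto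
      moreover have "{(real i * \<delta>)\<^sup>2..<(real (Suc i) * \<delta>)\<^sup>2} \<inter> {0..} = {(real i * \<delta>)\<^sup>2..<(real (Suc i) * \<delta>)\<^sup>2}"
        using order.trans[OF zero_le_power2[of "real i * \<delta>"]] by auto
      then have "emeasure lborel (A i) = ennreal pi * emeasure lborel {(real i * \<delta>)\<^sup>2..<(real (Suc i) * \<delta>)\<^sup>2}"
        unfolding A_def by (subst emeasure_norm_power2_vimage) (simp_all only: atLeastLessThan_borel)
      ultimately show ?thesis by (simp add: ennreal_mult[symmetric] ennreal_leI del: of_nat_Suc)
    qed
    have sub: "(\<Union>i\<in>I. A i) \<subseteq> T"
    proof
      fix x assume "x \<in> (\<Union>i\<in>I. A i)"
      then obtain i where i0: "i \<in> I" "x \<in> A i" by blast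
      then have i: "i \<in> I" "(real i * \<delta>)\<^sup>2 \<le> (norm x)\<^sup>2" "(norm x)\<^sup>2 < (real (Suc i) * \<delta>)\<^sup>2"
        unfolding A_def by (simp_all del: of_nat_Suc)
      from i(1) obtain t where t: "t \<in> E" "real i * \<delta> \<le> t" "t < real (Suc i) * \<delta>" unfolding I_def by blast
      have "real i * \<delta> \<le> norm x" by (rule power2_le_imp_le[OF i(2)]) simp
      moreover have "norm x < real (Suc i) * \<delta>" by (rule power2_less_imp_less[OF i(3)]) (use \<delta> in simp)
      moreover have "real (Suc i) * \<delta> = real i * \<delta> + \<delta>" by (simp add: algebra_simps)
      ultimately have "\<bar>norm x - t\<bar> < \<delta>" using t by linarith
      with t(1) show "x \<in> T" unfolding T_def by blast
    qed
    have disj: "disjoint_family_on A I"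
      unfolding disjoint_family_on_def
    proof (intro ballI impI)
      fix i j :: nat assume "i \<noteq> j"
      have *: "A i \<inter> A j = {}" if "i < j" for i j
      proof -
        have "(real (Suc i) * \<delta>)\<^sup>2 \<le> (real j * \<delta>)\<^sup>2" using that \<delta> by (intro power_mono mult_right_mono) auto
        then show ?thesis by (auto simp: A_def)
      qed
      show "A i \<inter> A j = {}" using *[of i j] *[of j i] \<open>i \<noteq> j\<close> by (cases "i < j") auto
    qed
    have "ennreal (real (card I) * (pi * \<delta>)) = (\<Sum>i\<in>I. ennreal (pi * \<delta>))"
      using \<delta> by (simp add: ennreal_mult ennreal_of_nat_eq_real_of_nat)
    also have "\<dots> \<le> (\<Sum>i\<in>I. emeasure lborel (A i))" by (intro sum_mono Ameas)
    also have "\<dots> = emeasure lborel (\<Union>i\<in>I. A i)" by (intro sum_emeasure disj finI) auto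
    also have "\<dots> \<le> ennreal m" unfolding m(1)[symmetric] by (intro emeasure_mono sub) simp
    finally have "real (card I) * (pi * \<delta>) \<le> m" using m(2) by simp
    moreover have "N * (pi * \<delta>) \<le> real (card I) * (pi * \<delta>)" using NI \<delta> by (intro mult_right_mono) auto
    ultimately have Nm: "N * (pi * \<delta>) \<le> m" by linarith
    have N1: "N \<ge> 1"
      unfolding N_def using cover_num_pos[OF \<delta>(1) bounded_subset_12[OF E(1)] E(2)] by simp
    then have "1 * (pi * \<delta>) \<le> N * (pi * \<delta>)" using \<delta> by (intro mult_right_mono) auto
    then have m0: "m > 0" using Nm \<delta> mult_pos_pos[OF pi_gt_zero \<delta>(1)] by linarith
    have "\<delta> / pi * m powr b \<le> C * (7 * pi * \<delta>\<^sup>2) powr a"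
    \<comment> \<open>7 = 1 + 6: (|x| - t)^2 \<le> \<delta>^2, and on the arc |u| \<le> \<delta> the
      increment |x| t u^2 is at most 3 * 2 * \<delta>^2.\<close>
    proof (rule indicator_testD[OF test, where B = "{0..7 * \<delta>\<^sup>2}" and T = T])
      show "emeasure lborel {y::real^2. (norm y)\<^sup>2 \<in> {0..7 * \<delta>\<^sup>2}} = ennreal (7 * pi * \<delta>\<^sup>2)"
        by (subst emeasure_radial_interval) (auto simp: mult_ac)
      show "emeasure lborel T = ennreal m" by (fact m)
      fix x assume "x \<in> T"
      then obtain t where t: "t \<in> E" "\<bar>norm x - t\<bar> < \<delta>" by (auto simp: T_def)
      have t12: "1 \<le> t" "t \<le> 2" using t E by auto
      have "ennreal (\<delta> / pi) \<le> abs_circ_avg (radial_ind {0..7 * \<delta>\<^sup>2}) t x"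
      proof (rule circle_avg_radial_ind_ge)
        show "\<delta> \<le> pi" using \<delta> pi_gt3 by linarith
        fix u :: real assume u: "\<bar>u\<bar> \<le> \<delta>"
        have "u\<^sup>2 \<le> \<delta>\<^sup>2" using u \<delta> by (simp add: abs_le_square_iff[symmetric])
        moreover have "norm x * t \<le> 3 * 2" using t t12 \<delta> by (intro mult_mono) auto
        ultimately have "norm x * t * u\<^sup>2 \<le> 6 * \<delta>\<^sup>2" using t12 by (intro mult_mono) auto
        moreover have "(norm x - t)\<^sup>2 \<le> \<delta>\<^sup>2" using t \<delta> by (simp add: abs_le_square_iff[symmetric])
        ultimately show "(norm x)\<^sup>2 + t\<^sup>2 - 2 * norm x * t * cos u \<in> {0..7 * \<delta>\<^sup>2}"
          unfolding atLeastAtMost_iff using circle_param_bounds(3,4)[of "norm x" t u] t12 norm_ge_zero[of x] by linarith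
      qed (use \<delta> in auto)
      then show "\<exists>t\<in>E. ennreal (\<delta> / pi) \<le> abs_circ_avg (radial_ind {0..7 * \<delta>\<^sup>2}) t x"
        using t by auto
    qed (use \<delta> m0 in auto)
    moreover have "\<delta> / pi * (N * (pi * \<delta>)) powr b \<le> \<delta> / pi * m powr b"
      using Nm N1 \<delta> b0 by (intro mult_left_mono powr_mono2) auto
    ultimately have le: "\<delta> / pi * (N powr b * (pi powr b * \<delta> powr b)) \<le> C * ((7 * pi) powr a * \<delta> powr (2 * a))"
      unfolding powr_scaled_power2[OF \<delta>(1)] powr_mult[of N "pi * \<delta>" b] powr_mult[of pi \<delta> b] by linarith
    have eq: "\<delta> powr (2*a - 1 - b) * (\<delta> * \<delta> powr b) = \<delta> powr (2 * a)"
    proof -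
      have "\<delta> * \<delta> powr b = \<delta> powr (1 + b)" using \<delta> by (simp add: powr_add)
      then show ?thesis by (simp add: powr_add[symmetric])
    qed
    have "\<delta> * (N powr b * (pi powr b * \<delta> powr b)) \<le> pi * (C * ((7 * pi) powr a * (\<delta> powr (2*a - 1 - b) * (\<delta> * \<delta> powr b))))"
      unfolding eq using le by (simp add: field_simps)
    then have "(N powr b * pi powr b) * (\<delta> * \<delta> powr b) \<le> ((C * (7 * pi) powr a * pi) * \<delta> powr (2*a - 1 - b)) * (\<delta> * \<delta> powr b)"
      by (simp only: mult_ac)
    then have "N powr b * pi powr b \<le> (C * (7 * pi) powr a * pi) * \<delta> powr (2*a - 1 - b)"
      using \<delta> by (subst (asm) mult_le_cancel_right_pos) auto
    then show "real (cover_num E \<delta>) powr b \<le> C * (7 * pi) powr a * pi / pi powr b * \<delta> powr (2*a - 1 - b)"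
      unfolding N_def[symmetric] by (simp add: field_simps)
  qed
qed

lemma necessary_minkowski: "2 * a \<le> 1 + (1 - minkowski_dim E) * b"
proof -
  obtain D where D: "D > 0" "\<And>\<delta>. 0 < \<delta> \<Longrightarrow> \<delta> < 1 \<Longrightarrow> real (cover_num E \<delta>) powr b \<le> D * \<delta> powr (2*a - 1 - b)"
    using cover_num_powr_le by blast
  show ?thesis
  proof (cases "b = 0")
    case True
    have "2*a - 1 \<le> 0"
    proof (rule powr_le_imp_exponent_le_at_0)
      show "(0::real) < 1" by simp
      fix \<delta> :: real assume \<delta>: "0 < \<delta>" "\<delta> < 1"
      have "cover_num E \<delta> \<ge> 1" by (rule cover_num_pos[OF \<delta>(1) bounded_subset_12[OF E(1)] E(2)])
      then show "\<delta> powr 0 \<le> D * \<delta> powr (2*a - 1)" using D(2)[OF \<delta>] True \<delta> by simp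
    qed
    then show ?thesis using True by simp
  next
    case False
    with b0 have b: "b > 0" by simp
    have "minkowski_dim E \<le> (1 + b - 2*a) / b"
    proof (rule minkowski_dim_le[OF E, of "D powr (1/b)" 1])
      fix \<delta> :: real assume \<delta>: "0 < \<delta>" "\<delta> < 1"
      have "real (cover_num E \<delta>) = (real (cover_num E \<delta>) powr b) powr (1/b)" using b by (simp add: powr_powr)
      also have "\<dots> \<le> (D * \<delta> powr (2*a - 1 - b)) powr (1/b)"
        using b by (intro powr_mono2 D(2) \<delta>) auto
      also have "\<dots> = D powr (1/b) * \<delta> powr ((2*a - 1 - b) * (1/b))"
        by (simp only: powr_mult powr_powr)
      also have "(2*a - 1 - b) * (1/b) = - ((1 + b - 2*a) / b)" using b by (simp add: field_simps)
      finally show "real (cover_num E \<delta>) \<le> D powr (1/b) * \<delta> powr (- ((1 + b - 2*a) / b))" .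
    qed (use D in auto)
    then have "minkowski_dim E * b \<le> 1 + b - 2*a" using b by (simp add: le_divide_eq)
    then show ?thesis by (simp add: algebra_simps)
  qed
qed

end

section \<open>The reciprocals of the integers\<close>

text \<open>Consecutive points near 1 + r are about r^2 apart. So within sqrt \<delta> of 1 the set
  is dense at scale \<delta>, which gives \<gamma> = 1, while only about \<delta>^(-1/2) points lie
  beyond, which gives \<beta> = 1/2; then 2\<gamma> - \<beta> = 3/2.\<close>

definition recip_set :: "real set" where
  "recip_set = (\<lambda>n. 1 + 1 / real (Suc n)) ` UNIV"

lemma recip_set_subset: "recip_set \<subseteq> {1..2}" "recip_set \<noteq> {}"
  by (auto simp: recip_set_def)

text \<open>With k the ceiling of 1/r and t = 1 + 1/k: r k < 1 + r, so r - 1/k < r/k \<le>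
  r^2.\<close>

lemma recip_set_near:
  assumes "0 < r" "r \<le> 1"
  obtains t where "t \<in> recip_set" "t - 1 \<le> r" "r - (t - 1) \<le> r\<^sup>2"
proof -
  define k where "k = nat \<lceil>1 / r\<rceil>"
  have r1: "1 / r \<ge> 1" using assms by simp
  have k: "1 / r \<le> real k" "real k < 1 / r + 1"
    using r1 by (simp_all add: k_def) linarith+
  then have k1: "real k \<ge> 1" using r1 by linarith
  then have kS: "k = Suc (k - 1)" by simp
  have le: "1 / real k \<le> r" using k(1) k1 assms by (simp add: field_simps)
  have "r * real k < 1 + r" using k(2) assms by (simp add: field_simps)
  then have "(r * real k - 1) / real k \<le> r / real k" using k1 by (intro divide_right_mono) auto
  then have "r - 1 / real k \<le> r * (1 / real k)" using k1 by (simp add: diff_divide_distrib)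
  also have "\<dots> \<le> r * r" using le assms by (intro mult_left_mono) auto
  finally have "r - 1 / real k \<le> r\<^sup>2" by (simp add: power2_eq_square)
  moreover have "1 + 1 / real k \<in> recip_set"
    unfolding recip_set_def by (subst kS) (rule rangeI)
  ultimately show ?thesis using le by (intro that[of "1 + 1 / real k"]) auto
qed

lemma powr_minus_half: "\<delta> > 0 \<Longrightarrow> \<delta> powr (-(1/2)) = 1 / sqrt \<delta>"
  by (simp add: powr_minus_divide powr_half_sqrt)

text \<open>By the gap estimate every point of (1, 1 + sqrt \<delta>] is at most \<delta> to the
  right of a point of the set, so covering intervals of doubled length cover it, and comparing
  lengths gives sqrt \<delta> \<le> 2 N \<delta>.\<close>

lemma cover_num_recip_ge:
  assumes \<delta>: "0 < \<delta>" "\<delta> \<le> 1"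
  shows "1/2 * \<delta> powr (-(1/2)) \<le> real (cover_num (recip_set \<inter> {1..1 + sqrt \<delta>}) \<delta>)"
proof -
  have "bounded (recip_set \<inter> {1..1 + sqrt \<delta>})"
    using bounded_subset_12[OF recip_set_subset(1)] by (rule bounded_subset) auto
  then obtain A where A: "finite A" "card A \<le> cover_num (recip_set \<inter> {1..1 + sqrt \<delta>}) \<delta>"
    "recip_set \<inter> {1..1 + sqrt \<delta>} \<subseteq> (\<Union>a\<in>A. {a..a+\<delta>})"
    using cover_num_attained \<delta>(1) by metis
  have "{1<..1 + sqrt \<delta>} \<subseteq> (\<Union>a\<in>A. {a..a+2*\<delta>})"
  proof
    fix z assume z: "z \<in> {1<..1 + sqrt \<delta>}"
    define r where "r = z - 1"
    have "sqrt \<delta> \<le> 1" using \<delta> by simp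
    then have r: "0 < r" "r \<le> 1" "r \<le> sqrt \<delta>" using z unfolding r_def greaterThanAtMost_iff by linarith+
    obtain t where t: "t \<in> recip_set" "t - 1 \<le> r" "r - (t - 1) \<le> r\<^sup>2"
      using recip_set_near[OF r(1,2)] by blast
    have "r\<^sup>2 \<le> (sqrt \<delta>)\<^sup>2" using r by (intro power_mono) auto
    then have "z \<le> t + \<delta>" "t \<le> z" using t \<delta> by (auto simp: r_def)
    moreover have "t \<in> {1..1 + sqrt \<delta>}" using t(1,2) r recip_set_subset by auto
    then obtain a where "a \<in> A" "t \<in> {a..a+\<delta>}" using A(3) t(1) by blast
    ultimately show "z \<in> (\<Union>a\<in>A. {a..a+2*\<delta>})" by (intro UN_I[of a]) auto
  qed
  then have "emeasure lborel {1<..1 + sqrt \<delta>} \<le> emeasure lborel (\<Union>a\<in>A. {a..a+2*\<delta>})"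
    using A(1) by (intro emeasure_mono) auto
  also have "\<dots> \<le> (\<Sum>a\<in>A. emeasure lborel {a..a+2*\<delta>})"
    using A(1) by (intro emeasure_subadditive_finite) auto
  also have "\<dots> = ennreal (real (card A) * (2 * \<delta>))"
    using \<delta> by (simp add: ennreal_mult ennreal_of_nat_eq_real_of_nat)
  finally have "ennreal (sqrt \<delta>) \<le> ennreal (real (card A) * (2 * \<delta>))" using \<delta> by simp
  then have "sqrt \<delta> \<le> real (card A) * (2 * \<delta>)" using \<delta> by simp
  also have "\<dots> = (2 * real (card A) * sqrt \<delta>) * sqrt \<delta>" using \<delta> by simp
  finally have "1 \<le> 2 * real (card A) * sqrt \<delta>" using \<delta> by simp
  then have "1/2 * (1 / sqrt \<delta>) \<le> real (card A)" using \<delta> by (simp add: field_simps)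
  then show ?thesis using A(2) \<delta> unfolding powr_minus_half[OF \<delta>(1)] by linarith
qed

text \<open>The first m points, m about \<delta>^(-1/2), get one interval each; the rest lie in
  [1, 1 + sqrt \<delta>], which takes at most 1 + \<delta>^(-1/2) intervals.\<close>

lemma cover_num_recip_le:
  assumes \<delta>: "0 < \<delta>" "\<delta> < 1"
  shows "real (cover_num recip_set \<delta>) \<le> 4 * \<delta> powr (-(1/2))"
proof -
  define w where "w = 1 / sqrt \<delta>"
  have w: "w \<ge> 1" using \<delta> by (simp add: w_def)
  define m where "m = nat \<lceil>w\<rceil>"
  have m: "w \<le> real m" "real m \<le> w + 1" using w by (simp_all add: m_def)
  obtain A where A: "finite A" "real (card A) \<le> 1 + sqrt \<delta> / \<delta>" "{1..1 + sqrt \<delta>} \<subseteq> (\<Union>a\<in>A. {a..a+\<delta>})"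
    using real_interval_cover[of \<delta> "sqrt \<delta>" 1] \<delta> by (metis less_imp_le real_sqrt_ge_zero)
  define A' where "A' = (\<lambda>n. 1 + 1 / real (Suc n)) ` {..<m}"
  have "card A' \<le> card {..<m}" unfolding A'_def by (rule card_image_le) simp
  then have cA': "card A' \<le> m" by simp
  have "cover_num recip_set \<delta> \<le> card (A' \<union> A)"
  proof (rule cover_num_le_card)
    show "finite (A' \<union> A)" using A by (simp add: A'_def)
    show "recip_set \<subseteq> (\<Union>a\<in>A' \<union> A. {a..a+\<delta>})"
    proof
      fix t assume "t \<in> recip_set"
      then obtain n where n: "t = 1 + 1 / real (Suc n)" by (auto simp: recip_set_def)
      show "t \<in> (\<Union>a\<in>A' \<union> A. {a..a+\<delta>})"
      proof (cases "n < m")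
        case True
        then have "t \<in> A'" unfolding n A'_def by blast
        then show ?thesis using \<delta> by (intro UN_I[of t]) auto
      next
        case False
        then have "w \<le> real (Suc n)" using m by linarith
        then have "1 / real (Suc n) \<le> 1 / w" using w by (intro divide_left_mono) auto
        then have "t \<in> {1..1 + sqrt \<delta>}" unfolding n by (simp add: w_def)
        then show ?thesis using A(3) by blast
      qed
    qed
  qed
  also have "card (A' \<union> A) \<le> card A' + card A" by (rule card_Un_le)
  finally have "real (cover_num recip_set \<delta>) \<le> real m + real (card A)" using cA' by linarith
  moreover have "sqrt \<delta> / \<delta> = w"
    using \<delta> by (simp add: w_def field_simps)
  ultimately have "real (cover_num recip_set \<delta>) \<le> 4 * w" using m A(2) w by linarith
  then show ?thesis unfolding powr_minus_half[OF \<delta>(1)] w_def .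
qed

lemma minkowski_dim_recip: "minkowski_dim recip_set = 1/2"
proof (rule antisym)
  show "minkowski_dim recip_set \<le> 1/2"
    using cover_num_recip_le by (intro minkowski_dim_le[OF recip_set_subset, of 4 1]) auto
  show "1/2 \<le> minkowski_dim recip_set"
  proof (rule minkowski_dim_ge[OF recip_set_subset, of "1/2" 1])
    fix \<delta> :: real assume \<delta>: "0 < \<delta>" "\<delta> < 1"
    have "cover_num (recip_set \<inter> {1..1 + sqrt \<delta>}) \<delta> \<le> cover_num recip_set \<delta>"
      by (intro cover_num_mono \<delta> bounded_subset_12 recip_set_subset) auto
    then show "1/2 * \<delta> powr (-(1/2)) \<le> real (cover_num recip_set \<delta>)"
      using cover_num_recip_ge[of \<delta>] \<delta> by linarith
  qed auto
qed

text \<open>\<theta> = 1/2 already suffices: J = [1, 1 + sqrt \<delta>] has exactly the length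
  \<delta>^(1/2), and its covering number is at least half of |J| / \<delta>.\<close>

lemma quasi_assouad_dim_recip: "quasi_assouad_dim recip_set = 1"
proof (rule antisym[OF quasi_assouad_dim_le_1])
  have "1 \<le> upper_assouad_spectrum (1/2) recip_set"
    unfolding upper_assouad_spectrum_eq
  proof (rule cInf_greatest)
    show "assouad_exponents (1/2) recip_set \<noteq> {}" using assouad_exponents_1[of "1/2"] by auto
    fix a assume "a \<in> assouad_exponents (1/2) recip_set"
    then obtain c where c: "c > 0" "\<And>\<delta> u v. \<delta> \<in> {0<..<1} \<Longrightarrow> 1 \<le> u \<Longrightarrow> u \<le> v \<Longrightarrow> v \<le> 2 \<Longrightarrow> v - u \<ge> \<delta> powr (1/2) \<Longrightarrow>
      real (cover_num (recip_set \<inter> {u..v}) \<delta>) \<le> c * ((v - u) / \<delta>) powr a"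
      unfolding assouad_exponents_def by blast
    have "- (a/2) \<le> - (1/2)"
    proof (rule powr_le_imp_exponent_le_at_0)
      show "(0::real) < 1" by simp
      fix \<delta> :: real assume \<delta>: "0 < \<delta>" "\<delta> < 1"
      have "1/2 * \<delta> powr (-(1/2)) \<le> real (cover_num (recip_set \<inter> {1..1 + sqrt \<delta>}) \<delta>)"
        using cover_num_recip_ge \<delta> by simp
      also have "\<dots> \<le> c * ((1 + sqrt \<delta> - 1) / \<delta>) powr a"
        using \<delta> by (intro c(2)) (auto simp: powr_half_sqrt)
      also have "(1 + sqrt \<delta> - 1) / \<delta> = \<delta> powr (-(1/2))"
        using \<delta> unfolding powr_minus_half[OF \<delta>(1)] by (simp add: field_simps)
      also have "(\<delta> powr (-(1/2))) powr a = \<delta> powr (- (a/2))" by (simp add: powr_powr)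
      finally show "\<delta> powr (- (1/2)) \<le> (2 * c) * \<delta> powr (- (a/2))" by simp
    qed
    then show "1 \<le> a" by simp
  qed
  also have "\<dots> \<le> quasi_assouad_dim recip_set"
    by (rule upper_assouad_spectrum_le_quasi_assouad_dim) simp
  finally show "1 \<le> quasi_assouad_dim recip_set" .
qed

text \<open>For r = |x| of order \<rho> some t in the set has 1 - \<rho>^2 \<le> t - r \<le> 1, so
  the circle comes within order \<rho>^2 of the unit circle, and it stays there along an arc of
  angle sqrt \<rho> because r t u^2 \<le> 2 \<rho>^2. Comparing sqrt \<rho> times \<rho>^(2b) with
  \<rho>^(2a) gives the line through \<open>P4_rad 1\<close> = (1/2, 1/4) and
  \<open>P5_rad (1/2) 1\<close> = (7/12, 1/3).\<close>

lemma necessary_recip: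
  assumes test: "indicator_test recip_set a b C"
  shows "a - b \<le> 1/4"
proof -
  have "2 * a \<le> 1/2 + 2 * b"
  proof (rule powr_le_imp_exponent_le_at_0)
    show "(0::real) < 1/2" by simp
    fix \<rho> :: real assume \<rho>: "0 < \<rho>" "\<rho> < 1/2"
    have "\<rho>\<^sup>2 \<le> (1/2)\<^sup>2" using \<rho> by (intro power_mono) auto
    then have \<rho>2: "\<rho>\<^sup>2 \<le> 1/4" by (simp add: power_divide)
    define B where "B = {1 - 2 * \<rho>\<^sup>2..1 + 2 * \<rho>\<^sup>2}"
    define T where "T = {x::real^2. (norm x)\<^sup>2 \<in> {(\<rho>/2)\<^sup>2..\<rho>\<^sup>2}}"
    have "sqrt \<rho> / pi * (3/4 * pi * \<rho>\<^sup>2) powr b \<le> C * (4 * pi * \<rho>\<^sup>2) powr a"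
    proof (rule indicator_testD[OF test, where B = B and T = T])
      have "emeasure lborel {y::real^2. (norm y)\<^sup>2 \<in> B} = ennreal (pi * ((1 + 2 * \<rho>\<^sup>2) - (1 - 2 * \<rho>\<^sup>2)))"
        unfolding B_def using \<rho>2 by (intro emeasure_radial_interval) auto
      also have "pi * ((1 + 2 * \<rho>\<^sup>2) - (1 - 2 * \<rho>\<^sup>2)) = 4 * pi * \<rho>\<^sup>2" by simp
      finally show "emeasure lborel {y::real^2. (norm y)\<^sup>2 \<in> B} = ennreal (4 * pi * \<rho>\<^sup>2)" .
      have "emeasure lborel T = ennreal (pi * (\<rho>\<^sup>2 - (\<rho>/2)\<^sup>2))"
        unfolding T_def using \<rho> by (intro emeasure_radial_interval power_mono) auto
      also have "pi * (\<rho>\<^sup>2 - (\<rho>/2)\<^sup>2) = 3/4 * pi * \<rho>\<^sup>2" by (simp add: power_divide)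
      finally show "emeasure lborel T = ennreal (3/4 * pi * \<rho>\<^sup>2)" .
      show "T \<in> sets borel" unfolding T_def by measurable
      fix x assume x: "x \<in> T"
      define r where "r = norm x"
      have r: "\<rho>/2 \<le> r" "r \<le> \<rho>"
        using x \<rho> power2_le_imp_le[of "\<rho>/2" r] power2_le_imp_le[of r \<rho>] by (auto simp: T_def r_def)
      then have r01: "0 < r" "r \<le> 1" using \<rho> by auto
      obtain t where t: "t \<in> recip_set" "t - 1 \<le> r" "r - (t - 1) \<le> r\<^sup>2"
        using recip_set_near[OF r01] by blast
      have t12: "1 \<le> t" "t \<le> 2" using t(1) recip_set_subset by auto
      have rr: "r\<^sup>2 \<le> \<rho>\<^sup>2" using r r01 by (intro power_mono) auto
      have "ennreal (sqrt \<rho> / pi) \<le> abs_circ_avg (radial_ind B) t x"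
      proof (rule circle_avg_radial_ind_ge)
        have "sqrt \<rho> \<le> 1" using \<rho> by simp
        then show "sqrt \<rho> \<le> pi" using pi_gt3 by linarith
        fix u :: real assume "\<bar>u\<bar> \<le> sqrt \<rho>"
        then have "\<bar>u\<bar>\<^sup>2 \<le> (sqrt \<rho>)\<^sup>2" by (intro power_mono) auto
        then have u2: "u\<^sup>2 \<le> \<rho>" using \<rho> by simp
        have "r * t * u\<^sup>2 \<le> (\<rho> * 2) * \<rho>"
          using r r01 t12 u2 \<rho> by (intro mult_mono) auto
        then have 1: "r * t * u\<^sup>2 \<le> 2 * \<rho>\<^sup>2" by (simp add: power2_eq_square)
        define s where "s = t - r"
        have s: "1 - \<rho>\<^sup>2 \<le> s" "s \<le> 1" using t rr by (auto simp: s_def)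
        have "(1 - \<rho>\<^sup>2)\<^sup>2 \<le> s\<^sup>2" using s \<rho>2 by (intro power_mono) auto
        moreover have "(1 - \<rho>\<^sup>2)\<^sup>2 = 1 - 2 * \<rho>\<^sup>2 + (\<rho>\<^sup>2)\<^sup>2" by (simp add: power2_eq_square algebra_simps)
        moreover have "s\<^sup>2 \<le> 1" using s \<rho>2 by (intro power_le_one) auto
        moreover have "(r - t)\<^sup>2 = s\<^sup>2" by (simp add: s_def power2_commute)
        ultimately show "(norm x)\<^sup>2 + t\<^sup>2 - 2 * norm x * t * cos u \<in> B"
          using circle_param_bounds(1,3)[of r t u] r01 t12 1 zero_le_power2[of "\<rho>\<^sup>2"]
          unfolding B_def r_def[symmetric] atLeastAtMost_iff by linarith
      qed (use \<rho> in \<open>auto simp: B_def\<close>)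
      then show "\<exists>t\<in>recip_set. ennreal (sqrt \<rho> / pi) \<le> abs_circ_avg (radial_ind B) t x"
        using t by blast
    qed (use \<rho> in \<open>auto simp: B_def\<close>)
    then have "\<rho> powr (1/2) / pi * ((3/4 * pi) powr b * \<rho> powr (2 * b)) \<le> C * ((4 * pi) powr a * \<rho> powr (2 * a))"
      using \<rho> unfolding powr_scaled_power2[OF \<rho>(1)] by (simp add: powr_half_sqrt)
    then have "(3/4 * pi) powr b * (\<rho> powr (1/2) * \<rho> powr (2 * b)) \<le> (C * pi * (4 * pi) powr a) * \<rho> powr (2 * a)"
      by (simp add: field_simps)
    then show "\<rho> powr (1/2 + 2 * b) \<le> (C * pi * (4 * pi) powr a / (3/4 * pi) powr b) * \<rho> powr (2 * a)"
      unfolding powr_add by (simp add: field_simps)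
  qed
  then show ?thesis by simp
qed

section \<open>The type set\<close>

text \<open>The hypotheses of \<open>radial_type_set_interior\<close> with strict inequalities
  relaxed and \<mu> projected out. They are linear in (a, b, \<mu>), so the region is convex and a
  polygon lies in it as soon as its vertices do.\<close>

definition type_region :: "real \<Rightarrow> real \<Rightarrow> (real \<times> real) set" where
  "type_region \<beta> g = {(a, b). \<exists>\<mu>. 0 \<le> \<mu> \<and> \<mu> \<le> b \<and> b \<le> a \<and> \<beta> * \<mu> \<le> 2*b - a \<and> 2*a \<le> 1 + (1 - \<beta>) * b \<and>
     0 \<le> 1/2 - a + b - g*b + (g - \<beta>)*\<mu>}"

lemma convex_type_region: "convex (type_region \<beta> g)"
proof (rule convexI)
  fix x y :: "real \<times> real" and u v :: real
  assume xy: "x \<in> type_region \<beta> g" "y \<in> type_region \<beta> g" and uv: "0 \<le> u" "0 \<le> v" "u + v = 1"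
  obtain a b a' b' where x: "x = (a, b)" and y: "y = (a', b')" by fastforce
  from xy obtain \<mu> \<mu>' where
    1: "0 \<le> \<mu>" "\<mu> \<le> b" "b \<le> a" "\<beta> * \<mu> \<le> 2*b - a" "2*a \<le> 1 + (1 - \<beta>) * b" "0 \<le> 1/2 - a + b - g*b + (g - \<beta>)*\<mu>" and
    2: "0 \<le> \<mu>'" "\<mu>' \<le> b'" "b' \<le> a'" "\<beta> * \<mu>' \<le> 2*b' - a'" "2*a' \<le> 1 + (1 - \<beta>) * b'" "0 \<le> 1/2 - a' + b' - g*b' + (g - \<beta>)*\<mu>'"
    unfolding type_region_def x y by auto
  have v: "v = 1 - u" using uv by simp
  have comb: "u * s + v * s' \<ge> 0" if "s \<ge> 0" "s' \<ge> 0" for s s' :: real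
    using that uv by simp
  have "0 \<le> u * \<mu> + v * \<mu>'" "u * \<mu> + v * \<mu>' \<le> u * b + v * b'" "u * b + v * b' \<le> u * a + v * a'"
    using 1 2 uv by (auto intro!: add_mono mult_left_mono)
  moreover have "\<beta> * (u * \<mu> + v * \<mu>') \<le> 2*(u * b + v * b') - (u * a + v * a')"
    using comb[of "2*b - a - \<beta> * \<mu>" "2*b' - a' - \<beta> * \<mu>'"] 1 2 by (simp add: algebra_simps)
  moreover have "2*(u * a + v * a') \<le> 1 + (1 - \<beta>) * (u * b + v * b')"
    using comb[of "1 + (1 - \<beta>) * b - 2*a" "1 + (1 - \<beta>) * b' - 2*a'"] 1 2 unfolding v by (simp add: algebra_simps)
  moreover have "0 \<le> 1/2 - (u * a + v * a') + (u * b + v * b') - g*(u * b + v * b') + (g - \<beta>)*(u * \<mu> + v * \<mu>')"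
    using comb[of "1/2 - a + b - g*b + (g - \<beta>)*\<mu>" "1/2 - a' + b' - g*b' + (g - \<beta>)*\<mu>'"] 1 2 unfolding v by (simp add: algebra_simps diff_divide_distrib)
  ultimately show "u *\<^sub>R x + v *\<^sub>R y \<in> type_region \<beta> g"
    unfolding type_region_def x y by (auto intro!: exI[of _ "u * \<mu> + v * \<mu>'"])
qed

text \<open>\<open>(1/4, 1/6)\<close> satisfies all constraints strictly with \<open>\<mu> = 0\<close>, so moving towards it makes every
  point of the region strict.\<close>
lemma type_region_subset_closure:
  assumes E: "E \<subseteq> {1..2}" "E \<noteq> {}" and \<beta>: "\<beta> = minkowski_dim E" and g: "g \<ge> quasi_assouad_dim E" "g \<le> 1"
  shows "type_region \<beta> g \<subseteq> closure (radial_type_set E)"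
proof
  fix x assume "x \<in> type_region \<beta> g"
  then obtain a b \<mu> where x: "x = (a, b)" and
    1: "0 \<le> \<mu>" "\<mu> \<le> b" "b \<le> a" "\<beta> * \<mu> \<le> 2*b - a" "2*a \<le> 1 + (1 - \<beta>) * b" "0 \<le> 1/2 - a + b - g*b + (g - \<beta>)*\<mu>"
    unfolding type_region_def by auto
  have \<beta>1: "0 \<le> \<beta>" "\<beta> \<le> 1" unfolding \<beta> using minkowski_dim_nonneg[OF E] minkowski_dim_le_1[OF E] by auto
  define s where "s n = inverse (real (Suc n))" for n
  have s: "0 < s n" "s n \<le> 1" for n by (simp_all add: s_def inverse_le_1_iff)
  define X where "X n = (a + s n * (1/4 - a), b + s n * (1/6 - b))" for n
  have "X n \<in> radial_type_set E" for n
  proof -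
    define r where "r = s n"
    have r: "0 < r" "0 \<le> 1 - r" using s[of n] by (auto simp: r_def)
    have comb: "(1 - r) * z + r * z' > 0" if "z \<ge> 0" "z' > 0" for z z' :: real
      using that r by (intro add_nonneg_pos mult_nonneg_nonneg mult_pos_pos) auto
    have "(a + r * (1/4 - a), b + r * (1/6 - b)) \<in> radial_type_set E"
    proof (rule radial_type_set_interior[OF E \<beta> g, where \<mu> = "(1 - r) * \<mu>"])
      show "0 \<le> (1 - r) * \<mu>" using r 1 by simp
      have "(1 - r) * (b - \<mu>) + r * (1/6) > 0" by (rule comb) (use 1 in auto)
      then show "(1 - r) * \<mu> \<le> b + r * (1/6 - b)" by (simp add: algebra_simps)
      have "(1 - r) * (a - b) + r * (1/12) > 0" by (rule comb) (use 1 in auto)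
      then show "b + r * (1/6 - b) < a + r * (1/4 - a)" by (simp add: algebra_simps)
      have "(1 - r) * (2*b - a - \<beta> * \<mu>) + r * (1/12) > 0" by (rule comb) (use 1 in auto)
      then show "\<beta> * ((1 - r) * \<mu>) < 2 * (b + r * (1/6 - b)) - (a + r * (1/4 - a))" by (simp add: algebra_simps)
      have "1/2 + (1 - \<beta>) / 6 > 0" using \<beta>1 by (intro add_pos_nonneg) auto
      then have "(1 - r) * (1 + (1 - \<beta>) * b - 2*a) + r * (1/2 + (1 - \<beta>) / 6) > 0" by (intro comb) (use 1 in simp)
      then show "2 * (a + r * (1/4 - a)) < 1 + (1 - \<beta>) * (b + r * (1/6 - b))" by (simp add: algebra_simps)
      \<comment> \<open>At (1/4, 1/6) with \<mu> = 0 the last constraint has the value 5/12 - g/6,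
        positive because g \<le> 1.\<close>
      have "(1 - r) * (1/2 - a + b - g*b + (g - \<beta>)*\<mu>) + r * (5/12 - g/6) > 0" by (rule comb) (use 1 g in auto)
      then show "0 < 1/2 - (a + r * (1/4 - a)) + (b + r * (1/6 - b)) - g * (b + r * (1/6 - b)) + (g - \<beta>) * ((1 - r) * \<mu>)"
        by (simp add: algebra_simps diff_divide_distrib)
    qed
    then show ?thesis by (simp add: X_def r_def)
  qed
  moreover have "X \<longlonglongrightarrow> x"
  proof -
    have "s \<longlonglongrightarrow> 0" unfolding s_def by (rule LIMSEQ_inverse_real_of_nat)
    then have "X \<longlonglongrightarrow> (a + 0 * (1/4 - a), b + 0 * (1/6 - b))"
      unfolding X_def by (intro tendsto_intros)
    then show ?thesis by (simp add: x)
  qed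
  ultimately show "x \<in> closure (radial_type_set E)"
    unfolding closure_sequential by blast
qed

lemma type_regionI:
  "0 \<le> \<mu> \<Longrightarrow> \<mu> \<le> b \<Longrightarrow> b \<le> a \<Longrightarrow> \<beta> * \<mu> \<le> 2*b - a \<Longrightarrow> 2*a \<le> 1 + (1 - \<beta>) * b \<Longrightarrow>
     0 \<le> 1/2 - a + b - g*b + (g - \<beta>)*\<mu> \<Longrightarrow> (a, b) \<in> type_region \<beta> g"
  unfolding type_region_def by auto

section \<open>The vertices\<close>

lemma P1_in_type_region: "P1 \<in> type_region \<beta> g"
  unfolding P1_def by (rule type_regionI[where \<mu> = 0]) auto

text \<open>Here \<mu> = b, the pure Minkowski bound: \<open>g\<close> cancels from the last
  constraint, and the others reduce to \<beta> \<le> 1.\<close>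

lemma P2_in_type_region:
  assumes "0 \<le> \<beta>" "\<beta> \<le> 1"
  shows "P2 \<beta> \<in> type_region \<beta> g"
proof -
  define b where "b = 1 / (1 + \<beta>)"
  have b: "b > 0" "(1 + \<beta>) * b = 1" using assms by (simp_all add: b_def)
  have \<beta>b: "\<beta> * b \<le> b" "b + \<beta> * b = 1" using assms b by (simp_all add: mult_left_le_one_le distrib_right)
  show ?thesis
    unfolding P2_def b_def[symmetric]
  proof (rule type_regionI[where \<mu> = b])
    show "\<beta> * b \<le> 2 * b - b" "2 * b \<le> 1 + (1 - \<beta>) * b" "0 \<le> 1/2 - b + b - g * b + (g - \<beta>) * b"
      unfolding left_diff_distrib using \<beta>b by linarith+
  qed (use b in auto)
qed

text \<open>With a = 2b, b = 1/(3 + \<beta>) and \<mu> = 0 the last constraint is equivalent to g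
  \<le> (1 + \<beta>)/2; hence this value of \<open>g\<close>.\<close>

lemma P3_in_type_region:
  assumes "0 \<le> \<beta>" "\<beta> \<le> 1"
  shows "P3_rad \<beta> \<in> type_region \<beta> ((1 + \<beta>) / 2)"
proof -
  define b where "b = 1 / (3 + \<beta>)"
  have "(3 + \<beta>) * b = 1" using assms by (simp add: b_def)
  moreover have "b > 0" using assms by (simp add: b_def)
  ultimately have b: "b > 0" "3 * b + \<beta> * b = 1" by (simp_all add: distrib_right)
  have "2 / (3 + \<beta>) = 2 * b" by (simp add: b_def)
  moreover have "(2 * b, b) \<in> type_region \<beta> ((1 + \<beta>) / 2)"
  proof (rule type_regionI[where \<mu> = 0])
    show "2 * (2 * b) \<le> 1 + (1 - \<beta>) * b"
      unfolding left_diff_distrib using b by linarith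
    have "(1 + \<beta>) / 2 * b = b / 2 + \<beta> * b / 2" by (simp add: algebra_simps add_divide_distrib)
    then show "0 \<le> 1/2 - 2 * b + b - (1 + \<beta>) / 2 * b + ((1 + \<beta>) / 2 - \<beta>) * 0"
      using b by linarith
  qed (use b in auto)
  ultimately show ?thesis
    unfolding P3_rad_def b_def[symmetric] by simp
qed

text \<open>Again a = 2b and \<mu> = 0, with equality in the last constraint. That 2g - \<beta> > 1
  keeps the point in the half-plane of the Minkowski condition.\<close>

lemma P4_in_type_region:
  assumes "0 \<le> \<beta>" "\<beta> \<le> g" "g \<le> 1" "2*g - \<beta> > 1"
  shows "P4_rad g \<in> type_region \<beta> g"
proof -
  define b where "b = 1 / (2 * (1 + g))"
  have "2 * (1 + g) * b = 1" using assms by (simp add: b_def)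
  moreover have "b > 0" using assms by (simp add: b_def)
  ultimately have b: "b > 0" "2 * b + 2 * (g * b) = 1" by (simp_all add: distrib_right distrib_left)
  have a: "1 / (1 + g) = 2 * b" by (simp add: b_def del: distrib_left_numeral)
  have "0 \<le> (2*g - \<beta> - 1) * b" using assms b by simp
  then show ?thesis
    unfolding P4_rad_def b_def[symmetric] a using b by (intro type_regionI[where \<mu> = 0]) (auto simp: algebra_simps)
qed

text \<open>The point where the last three constraints are all equalities; solving this linear
  system gives a, b and \<mu>, and \<mu> \<ge> 0 because 2g > 1 + \<beta>. It is the one vertex at
  which the two covering bounds are properly mixed.\<close>

lemma P5_in_type_region:
  assumes "0 \<le> \<beta>" "\<beta> \<le> g" "g \<le> 1" "2*g - \<beta> > 1"
  shows "P5_rad \<beta> g \<in> type_region \<beta> g"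
proof -
  have g: "g > 0" and \<beta>1: "\<beta> < 1" using assms by auto
  \<comment> \<open>\<open>e\<close> is g times the denominator (1 - \<beta>) + 2 (1 - \<beta>/g) of
    the second coordinate; clearing it makes the identities below polynomial.\<close>
  define e where "e = (1 - \<beta>) * g + 2 * (g - \<beta>)"
  have e: "e > 0" using assms g \<beta>1 unfolding e_def by (intro add_pos_nonneg) auto
  define i where "i = 1 / (2 * e)"
  have i: "i > 0" "2 * (e * i) = 1" using e by (simp_all add: i_def)
  define a b \<mu> where "a = ((1 - \<beta>) * (2*g - \<beta>) + 2 * (g - \<beta>)) * i" and "b = 2 * (g - \<beta>) * i" and "\<mu> = (2*g - 1 - \<beta>) * i"
  have D: "(1 - \<beta>) + 2 * (1 - \<beta>/g) = e / g" using g by (simp add: e_def field_simps)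
  have "P5_rad \<beta> g = (a, b)"
  proof -
    have "((1 - \<beta>) * (2 - \<beta>/g) + 2 * (1 - \<beta>/g)) = ((1 - \<beta>) * (2*g - \<beta>) + 2 * (g - \<beta>)) / g"
      "1 - \<beta>/g = (g - \<beta>) / g"
      using g by (simp_all add: field_simps)
    moreover have "b = (g - \<beta>) / e" "a = ((1 - \<beta>) * (2*g - \<beta>) + 2 * (g - \<beta>)) / (2 * e)"
      unfolding a_def b_def i_def using e by (simp_all add: field_simps)
    ultimately show ?thesis
      unfolding P5_rad_def D using g by (simp only:) simp
  qed
  moreover have "(a, b) \<in> type_region \<beta> g"
  proof (rule type_regionI)
    show "0 \<le> \<mu>" unfolding \<mu>_def using assms i by (intro mult_nonneg_nonneg) auto
    show "\<mu> \<le> b" unfolding \<mu>_def b_def using assms i \<beta>1 by (intro mult_right_mono) auto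
    show "b \<le> a" unfolding a_def b_def using assms i \<beta>1 g by (intro mult_right_mono) auto
    have "\<beta> * \<mu> = 2*b - a" unfolding a_def b_def \<mu>_def by algebra
    then show "\<beta> * \<mu> \<le> 2*b - a" by simp
    have "2*a = 2 * (e * i) + (1 - \<beta>) * b" unfolding a_def b_def e_def by algebra
    then show "2*a \<le> 1 + (1 - \<beta>) * b" using i by simp
    have "e * i - a + b - g*b + (g - \<beta>)*\<mu> = 0" unfolding a_def b_def \<mu>_def e_def by algebra
    then show "0 \<le> 1/2 - a + b - g*b + (g - \<beta>)*\<mu>" using i by simp
  qed
  ultimately show ?thesis by simp
qed

section \<open>The type set against the polygons\<close>

text \<open>The barycentric coordinates of (a, b) are the slacks of the three necessary conditions
  up to positive factors: a \<le> 2b at \<open>P2\<close>, b \<le> a at \<open>P3_rad\<close>, and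
  the Minkowski condition at \<open>P1\<close>.\<close>

lemma radial_type_set_subset_triangle:
  assumes E: "E \<subseteq> {1..2}" "E \<noteq> {}"
  shows "radial_type_set E \<subseteq> triangle_rad (minkowski_dim E)"
proof
  define \<beta> where "\<beta> = minkowski_dim E"
  have \<beta>0: "\<beta> \<ge> 0" unfolding \<beta>_def by (rule minkowski_dim_nonneg[OF E])
  fix x assume "x \<in> radial_type_set E"
  then obtain p q where pq: "1 \<le> p" "1 \<le> q" "max_bounded E p q" and x: "x = (enn2real (1/p), enn2real (1/q))"
    unfolding radial_type_set_def by blast
  define a b where "a = enn2real (1/p)" and "b = enn2real (1/q)"
  have b0: "b \<ge> 0" by (simp add: b_def)
  obtain C where C: "C > 0" "indicator_test E a b C"
    unfolding a_def b_def using max_bounded_imp_indicator_test[OF pq(3,1,2)] .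
  have 1: "b \<le> a" "a \<le> 2*b" "2*a \<le> 1 + (1 - \<beta>) * b"
    using necessary_q_ge_p[OF E b0 C] necessary_q_le_2p[OF E b0 C]
      necessary_minkowski[OF E b0 C] by (simp_all add: \<beta>_def)
  define w2 w3 where "w2 = (1 + \<beta>) * (2*b - a)" and "w3 = (3 + \<beta>) * (a - b)"
  have w: "w2 \<ge> 0" "w3 \<ge> 0" using 1 \<beta>0 by (simp_all add: w2_def w3_def)
  have "w2 + w3 = 2*a - (1 - \<beta>) * b" by (simp add: w2_def w3_def algebra_simps)
  then have w1: "1 - w2 - w3 \<ge> 0" using 1 by simp
  have "w2 * (1 / (1 + \<beta>)) = 2*b - a" "w3 * (1 / (3 + \<beta>)) = a - b" "w3 * (2 / (3 + \<beta>)) = 2 * (a - b)"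
    using \<beta>0 by (simp_all add: w2_def w3_def)
  then have "(a, b) = (1 - w2 - w3) *\<^sub>R P1 + w2 *\<^sub>R P2 \<beta> + w3 *\<^sub>R P3_rad \<beta>"
    by (simp add: P1_def P2_def P3_rad_def)
  moreover have "(1 - w2 - w3) + w2 + w3 = 1" by simp
  ultimately show "x \<in> triangle_rad (minkowski_dim E)"
    unfolding triangle_rad_def convex_hull_3 x a_def[symmetric] b_def[symmetric] \<beta>_def[symmetric]
    using w w1 by blast
qed

lemma closed_convex_hull_finite: "finite S \<Longrightarrow> closed (convex hull S)" for S :: "(real \<times> real) set"
  by (intro compact_imp_closed finite_imp_compact_convex_hull)

text \<open>Covering bounds remain true for larger exponents, so \<gamma> may be replaced by g = (1
  + \<beta>)/2, the value for which \<open>P3_rad\<close> qualifies; that it is at least \<gamma> is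
  the case hypothesis.\<close>

lemma triangle_subset_closure:
  assumes E: "E \<subseteq> {1..2}" "E \<noteq> {}" and g: "2 * quasi_assouad_dim E - minkowski_dim E \<le> 1"
  shows "triangle_rad (minkowski_dim E) \<subseteq> closure (radial_type_set E)"
proof -
  define \<beta> where "\<beta> = minkowski_dim E"
  have \<beta>: "0 \<le> \<beta>" "\<beta> \<le> 1" unfolding \<beta>_def using minkowski_dim_nonneg[OF E] minkowski_dim_le_1[OF E] by auto
  have "triangle_rad \<beta> \<subseteq> type_region \<beta> ((1 + \<beta>) / 2)"
    unfolding triangle_rad_def
    using P1_in_type_region P2_in_type_region[OF \<beta>] P3_in_type_region[OF \<beta>]
    by (intro hull_minimal convex_type_region) auto
  also have "\<dots> \<subseteq> closure (radial_type_set E)"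
    using g \<beta> by (intro type_region_subset_closure[OF E \<beta>_def]) (auto simp: \<beta>_def)
  finally show ?thesis by (simp add: \<beta>_def)
qed

lemma quadrangle_subset_closure:
  assumes E: "E \<subseteq> {1..2}" "E \<noteq> {}" and g: "2 * quasi_assouad_dim E - minkowski_dim E > 1"
  shows "quadrangle_rad (minkowski_dim E) (quasi_assouad_dim E) \<subseteq> closure (radial_type_set E)"
proof -
  define \<beta> \<gamma> where "\<beta> = minkowski_dim E" and "\<gamma> = quasi_assouad_dim E"
  have \<beta>: "0 \<le> \<beta>" "\<beta> \<le> 1" unfolding \<beta>_def using minkowski_dim_nonneg[OF E] minkowski_dim_le_1[OF E] by auto
  have \<gamma>: "\<beta> \<le> \<gamma>" "\<gamma> \<le> 1" "2*\<gamma> - \<beta> > 1"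
    unfolding \<beta>_def \<gamma>_def using minkowski_dim_le_quasi_assouad_dim[OF E] quasi_assouad_dim_le_1 g by auto
  have "quadrangle_rad \<beta> \<gamma> \<subseteq> type_region \<beta> \<gamma>"
    unfolding quadrangle_rad_def
    using P1_in_type_region P2_in_type_region[OF \<beta>] P4_in_type_region[OF \<beta>(1) \<gamma>] P5_in_type_region[OF \<beta>(1) \<gamma>]
    by (intro hull_minimal convex_type_region) auto
  also have "\<dots> \<subseteq> closure (radial_type_set E)"
    using \<gamma> by (intro type_region_subset_closure[OF E \<beta>_def]) (auto simp: \<gamma>_def)
  finally show ?thesis by (simp add: \<beta>_def \<gamma>_def)
qed

lemma radial_type_set_recip_subset_quadrangle: "radial_type_set recip_set \<subseteq> quadrangle_rad (1/2) 1"
proof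
  fix x assume "x \<in> radial_type_set recip_set"
  then obtain p q where pq: "1 \<le> p" "1 \<le> q" "max_bounded recip_set p q" and x: "x = (enn2real (1/p), enn2real (1/q))"
    unfolding radial_type_set_def by blast
  define a b where "a = enn2real (1/p)" and "b = enn2real (1/q)"
  have b0: "b \<ge> 0" by (simp add: b_def)
  obtain C where C: "C > 0" "indicator_test recip_set a b C"
    unfolding a_def b_def using max_bounded_imp_indicator_test[OF pq(3,1,2)] .
  have 1: "b \<le> a" "a \<le> 2*b" "2*a \<le> 1 + b / 2" "a - b \<le> 1/4"
    using necessary_q_ge_p[OF recip_set_subset b0 C] necessary_q_le_2p[OF recip_set_subset b0 C]
      necessary_minkowski[OF recip_set_subset b0 C] necessary_recip[OF C(2)]
    by (simp_all add: minkowski_dim_recip)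
  have P: "P1 = (0, 0)" "P2 (1/2) = (2/3, 2/3)" "P4_rad 1 = (1/2, 1/4)" "P5_rad (1/2) 1 = (7/12, 1/3)"
    by (simp_all add: P1_def P2_def P4_rad_def P5_rad_def)
  have "(a, b) \<in> quadrangle_rad (1/2) 1"
  \<comment> \<open>The diagonal from \<open>P1\<close> to \<open>P5_rad (1/2) 1\<close> = (7/12,
    1/3) is a = 7/4 b. On either side the coefficients are barycentric coordinates in the adjacent
    triangle, and their signs come from the necessary conditions and the case.\<close>
  proof (cases "a \<le> 7/4 * b")
    case True
    have "(a, b) = (1 - 2 * (7/4 * b - a) - 4 * (a - b)) *\<^sub>R P1 + (2 * (7/4 * b - a)) *\<^sub>R P2 (1/2) + (4 * (a - b)) *\<^sub>R P5_rad (1/2) 1"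
      unfolding P by (simp add: field_simps)
    moreover have "0 \<le> 1 - 2 * (7/4 * b - a) - 4 * (a - b)" "0 \<le> 2 * (7/4 * b - a)" "0 \<le> 4 * (a - b)"
      "(1 - 2 * (7/4 * b - a) - 4 * (a - b)) + 2 * (7/4 * b - a) + 4 * (a - b) = 1"
      using 1 True by simp_all
    ultimately have "(a, b) \<in> convex hull {P1, P2 (1/2), P5_rad (1/2) 1}"
      unfolding convex_hull_3 by blast
    also have "\<dots> \<subseteq> quadrangle_rad (1/2) 1"
      unfolding quadrangle_rad_def by (rule hull_mono) auto
    finally show ?thesis .
  next
    case False
    have "(a, b) = (1 - 16 * (a - 7/4 * b) - 12 * (2*b - a)) *\<^sub>R P1 + (16 * (a - 7/4 * b)) *\<^sub>R P4_rad 1 + (12 * (2*b - a)) *\<^sub>R P5_rad (1/2) 1"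
      unfolding P by (simp add: field_simps)
    moreover have "0 \<le> 1 - 16 * (a - 7/4 * b) - 12 * (2*b - a)" "0 \<le> 16 * (a - 7/4 * b)" "0 \<le> 12 * (2*b - a)"
      "(1 - 16 * (a - 7/4 * b) - 12 * (2*b - a)) + 16 * (a - 7/4 * b) + 12 * (2*b - a) = 1"
      using 1 False by simp_all
    ultimately have "(a, b) \<in> convex hull {P1, P4_rad 1, P5_rad (1/2) 1}"
      unfolding convex_hull_3 by blast
    also have "\<dots> \<subseteq> quadrangle_rad (1/2) 1"
      unfolding quadrangle_rad_def by (rule hull_mono) auto
    finally show ?thesis .
  qed
  then show "x \<in> quadrangle_rad (1/2) 1" by (simp add: x a_def b_def)
qed

theorem corollary1p3:
  shows "(\<forall>E \<beta> \<gamma>. E \<subseteq> {1..2::real} \<and> E \<noteq> {} \<and>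
              \<beta> = minkowski_dim E \<and> \<gamma> = quasi_assouad_dim E \<longrightarrow>
            (2*\<gamma> - \<beta> \<le> 1 \<longrightarrow> closure (radial_type_set E) = triangle_rad \<beta>) \<and>
            (2*\<gamma> - \<beta> > 1 \<longrightarrow>
               quadrangle_rad \<beta> \<gamma> \<subseteq> closure (radial_type_set E) \<and>
               closure (radial_type_set E) \<subseteq> triangle_rad \<beta>)) \<and>
         (\<exists>E \<beta> \<gamma>. E \<subseteq> {1..2::real} \<and> E \<noteq> {} \<and>
              \<beta> = minkowski_dim E \<and> \<gamma> = quasi_assouad_dim E \<and> 2*\<gamma> - \<beta> > 1 \<and>
              closure (radial_type_set E) = quadrangle_rad \<beta> \<gamma>)"
proof (rule conjI)
  have upper: "closure (radial_type_set E) \<subseteq> triangle_rad (minkowski_dim E)" if "E \<subseteq> {1..2}" "E \<noteq> {}" for E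
    using radial_type_set_subset_triangle[OF that] unfolding triangle_rad_def
    by (intro closure_minimal closed_convex_hull_finite) auto
  show "\<forall>E \<beta> \<gamma>. E \<subseteq> {1..2::real} \<and> E \<noteq> {} \<and>
              \<beta> = minkowski_dim E \<and> \<gamma> = quasi_assouad_dim E \<longrightarrow>
            (2*\<gamma> - \<beta> \<le> 1 \<longrightarrow> closure (radial_type_set E) = triangle_rad \<beta>) \<and>
            (2*\<gamma> - \<beta> > 1 \<longrightarrow>
               quadrangle_rad \<beta> \<gamma> \<subseteq> closure (radial_type_set E) \<and>
               closure (radial_type_set E) \<subseteq> triangle_rad \<beta>)"
    using upper triangle_subset_closure quadrangle_subset_closure by (metis subset_antisym)
  have "closure (radial_type_set recip_set) \<subseteq> quadrangle_rad (1/2) 1"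
    using radial_type_set_recip_subset_quadrangle unfolding quadrangle_rad_def
    by (intro closure_minimal closed_convex_hull_finite) auto
  moreover have "quadrangle_rad (1/2) 1 \<subseteq> closure (radial_type_set recip_set)"
    using quadrangle_subset_closure[OF recip_set_subset]
    by (simp add: minkowski_dim_recip quasi_assouad_dim_recip)
  ultimately have "closure (radial_type_set recip_set) = quadrangle_rad (1/2) 1"
    by (rule subset_antisym)
  then show "\<exists>E \<beta> \<gamma>. E \<subseteq> {1..2::real} \<and> E \<noteq> {} \<and>
              \<beta> = minkowski_dim E \<and> \<gamma> = quasi_assouad_dim E \<and> 2*\<gamma> - \<beta> > 1 \<and>
              closure (radial_type_set E) = quadrangle_rad \<beta> \<gamma>"
    using recip_set_subset minkowski_dim_recip quasi_assouad_dim_recip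
    by (intro exI[of _ recip_set] exI[of _ "1/2"] exI[of _ 1]) auto
qed

end
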